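(* Let $K$ be an infinite field, $\mu=(0,1,\dots,n-1)\in\mathbb Z^n$, and $\lambda=(\lambda_1,\dots,\lambda_n)$ a partition with $\lambda_1=m$ and $\lambda_n\ge n$. Then the reduction number of the specialized Ferrers ideal $\overline I_{\lambda-\mu}$ is $$r(\overline I_{\lambda-\mu})=\min\left\{n-1,\ \left\lfloor\frac{\lambda_i+i}{2}\right\rfloor-1\ :\ 2\le i\le n\right\}.$$
   Context: The specialized Ferrers ideal is $\overline I_{\lambda-\mu}=(x_ix_j:1\le i\le n,\ \mu_i<j\le\lambda_i)\subset K[x_1,\dots,x_m]$. An ideal $J\subset I$ is a reduction of $I$ if $I^{r+1}=JI^r$ for some $r\ge0$; the least such $r$ is $r_J(I)$. A reduction is minimal if no strictly smaller ideal is a reduction of $I$. The reduction number is $r(I)=\min\{r_J(I): J\text{ a minimal reduction of }I\}$. *)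

theory Defs
  imports "HOL-Library.Poly_Mapping"
begin

type_synonym 'a mpoly = "(nat \<Rightarrow>\<^sub>0 nat) \<Rightarrow>\<^sub>0 'a"

definition poly_ring :: "nat \<Rightarrow> ('a::comm_ring_1) mpoly set" where
  "poly_ring m = {p. \<forall>t \<in> Poly_Mapping.keys p. Poly_Mapping.keys t \<subseteq> {1..m}}"

definition Var :: "nat \<Rightarrow> ('a::comm_ring_1) mpoly" where
  "Var i = Poly_Mapping.single (Poly_Mapping.single i 1) 1"

definition is_ideal :: "'a::comm_ring_1 set \<Rightarrow> 'a set \<Rightarrow> bool" where
  "is_ideal R I \<longleftrightarrow> I \<subseteq> R \<and> 0 \<in> I \<and> (\<forall>a\<in>I. \<forall>b\<in>I. a + b \<in> I)
     \<and> (\<forall>r\<in>R. \<forall>a\<in>I. r * a \<in> I)"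

definition ideal_gen :: "'a::comm_ring_1 set \<Rightarrow> 'a set \<Rightarrow> 'a set" where
  "ideal_gen R S = \<Inter>{I. is_ideal R I \<and> S \<subseteq> I}"

definition ideal_mult :: "'a::comm_ring_1 set \<Rightarrow> 'a set \<Rightarrow> 'a set \<Rightarrow> 'a set" where
  "ideal_mult R I J = ideal_gen R {a * b | a b. a \<in> I \<and> b \<in> J}"

fun ideal_pow :: "'a::comm_ring_1 set \<Rightarrow> 'a set \<Rightarrow> nat \<Rightarrow> 'a set" where
  "ideal_pow R I 0 = R"
| "ideal_pow R I (Suc k) = ideal_mult R I (ideal_pow R I k)"

definition is_reduction :: "'a::comm_ring_1 set \<Rightarrow> 'a set \<Rightarrow> 'a set \<Rightarrow> bool" where
  "is_reduction R J I \<longleftrightarrow> is_ideal R J \<and> J \<subseteq> I \<and>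
     (\<exists>r. ideal_pow R I (r + 1) = ideal_mult R J (ideal_pow R I r))"

definition reduction_number_wrt :: "'a::comm_ring_1 set \<Rightarrow> 'a set \<Rightarrow> 'a set \<Rightarrow> nat" where
  "reduction_number_wrt R J I = (LEAST r. ideal_pow R I (r + 1) = ideal_mult R J (ideal_pow R I r))"

definition minimal_reduction :: "'a::comm_ring_1 set \<Rightarrow> 'a set \<Rightarrow> 'a set \<Rightarrow> bool" where
  "minimal_reduction R J I \<longleftrightarrow> is_reduction R J I \<and>
     \<not> (\<exists>J'. J' \<subset> J \<and> is_reduction R J' I)"

definition reduction_number :: "'a::comm_ring_1 set \<Rightarrow> 'a set \<Rightarrow> nat" where
  "reduction_number R I =
     (LEAST r. \<exists>J. minimal_reduction R J I \<and> reduction_number_wrt R J I = r)"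

definition spec_ferrers_ideal ::
  "nat \<Rightarrow> nat \<Rightarrow> (nat \<Rightarrow> nat) \<Rightarrow> (nat \<Rightarrow> int) \<Rightarrow> ('a::comm_ring_1) mpoly set" where
  "spec_ferrers_ideal m n lam mu = ideal_gen (poly_ring m)
     {Var i * Var j | i j. 1 \<le> i \<and> i \<le> n \<and> mu i < int j \<and> j \<le> lam i}"

end

theory Submission
  imports Defs "HOL-Computational_Algebra.Polynomial" "HOL-Library.Multiset" "HOL-Library.FuncSet"
begin

text \<open>
  Let \<open>F\<close> be the special fiber ring of the ideal \<open>I\<close>: its degree \<open>s\<close> part is spanned by the
  products of \<open>s\<close> generators. Replacing two generators \<open>x\<^sub>i x\<^sub>j\<close>, \<open>x\<^sub>k x\<^sub>l\<close> by the
  nested pair with the same product shows that every such monomial is represented by a unique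
  chain of nested pairs. Let \<open>theta d\<close> be the sum of the generators \<open>x\<^sub>i x\<^sub>i\<^sub>+\<^sub>d\<close>. Straightening
  shows that \<open>F\<close> is spanned over \<open>K[theta 0, \<dots>, theta (m - 1)]\<close> by the strictly nested chains
  avoiding the first row, and counting shows that there are no relations. The maximal length of
  such a chain is the claimed number, so the ideal \<open>J0\<close> generated by the \<open>theta d\<close> is a
  reduction with this reduction number.

  Conversely, a minimal reduction has a degree two part spanned by \<open>m\<close> quadrics, and no \<open>m\<close>
  quadrics can do better than the \<open>theta d\<close>, by a semicontinuity argument along the pencil joining
  the two systems. Since ideals need be neither local nor homogeneous here, the minimality of \<open>J0\<close>
  has to be checked at every prime \<open>q\<close>. Locally at \<open>q\<close> the ideal \<open>J0\<close> is generated by as many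
  elements as the analytic spread of \<open>I\<close>; they are analytically independent, as one sees from
  their initial monomials, whereas a smaller reduction would give an equation of integral
  dependence contradicting this.
\<close>

text \<open>The claimed number is the length of a longest strictly nested chain in rows 2, ..., n:
  there are n - 1 such rows, and from row i on both ends of the pairs compete for the indices i,
  ..., lambda_i. Sums over diagonals suit straightening because nesting two pairs raises the sum of
  squared lengths, while a move along a diagonal preserves it; this potential, with the index sum
  breaking ties, makes the rewriting terminate. The obstacle is that minimality refers to all ideals
  of the polynomial ring. In the lower bound it is used in degree two: more than m independent
  quadrics satisfy a homogeneous relation, by counting, and then a hyperplane among them already
  gives a smaller reduction. For \<open>J0\<close>, a smaller reduction J' has a proper colon ideal
  J' : J0, contained in some prime q. A linear form that kills J' modulo q, but is not itself zero
  modulo q, turns integral dependence into a form P that vanishes at the local generators although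
  its value at the coefficients of that linear form is nonzero modulo q.\<close>

abbreviation lookup :: "('b \<Rightarrow>\<^sub>0 'c::zero) \<Rightarrow> 'b \<Rightarrow> 'c" where
  "lookup \<equiv> Poly_Mapping.lookup"

abbreviation keys :: "('b \<Rightarrow>\<^sub>0 'c::zero) \<Rightarrow> 'b set" where
  "keys \<equiv> Poly_Mapping.keys"

abbreviation single :: "'b \<Rightarrow> 'c \<Rightarrow> 'b \<Rightarrow>\<^sub>0 'c::zero" where
  "single \<equiv> Poly_Mapping.single"

subsection \<open>Polynomials\<close>

definition xpow :: "(nat \<Rightarrow>\<^sub>0 nat) \<Rightarrow> 'a::comm_ring_1 mpoly" where
  "xpow t = single t 1"

definition cst :: "'a::comm_ring_1 \<Rightarrow> 'a mpoly" where
  "cst c = single 0 c"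

lemma xpow_add: "xpow (s + t) = xpow s * xpow t"
  by (simp add: xpow_def mult_single)

lemma xpow_zero [simp]: "xpow 0 = 1"
  by (simp add: xpow_def)

lemma xpow_neq_zero [simp]: "xpow t \<noteq> (0 :: 'a::comm_ring_1 mpoly)"
  unfolding xpow_def by (metis lookup_single_eq lookup_zero zero_neq_one)

lemma Var_xpow: "Var i = xpow (single i 1)"
  by (simp add: xpow_def Var_def)

lemma cst_xpow: "cst c * xpow t = single t c"
  by (simp add: cst_def xpow_def mult_single)

lemma cst_add: "cst (a + b) = cst a + cst b"
  by (simp add: cst_def single_add)

lemma cst_mult: "cst (a * b) = cst a * cst b"
  by (simp add: cst_def mult_single)

lemma cst_diff: "cst (a - b) = cst a - cst b"
  by (simp add: cst_def single_diff)

lemma cst_0 [simp]: "cst 0 = 0"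
  by (simp add: cst_def)

lemma cst_1 [simp]: "cst 1 = 1"
  by (simp add: cst_def)

lemma mpoly_expand:
  fixes p :: "'a::comm_ring_1 mpoly"
  assumes "finite S" "keys p \<subseteq> S"
  shows "p = (\<Sum>t\<in>S. cst (lookup p t) * xpow t)"
proof (rule poly_mapping_eqI)
  fix u
  have "lookup (\<Sum>t\<in>S. cst (lookup p t) * xpow t) u = (\<Sum>t\<in>S. if t = u then lookup p u else 0)"
    by (auto simp: lookup_sum cst_xpow lookup_single when_def intro!: sum.cong)
  also have "\<dots> = lookup p u"
    using assms by (auto simp: in_keys_iff)
  finally show "lookup p u = lookup (\<Sum>t\<in>S. cst (lookup p t) * xpow t) u" by simp
qed

lemmas mpoly_expand_keys = mpoly_expand [OF finite_keys subset_refl]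

lemma lookup_cst_mult [simp]: "lookup (cst c * p) t = c * lookup p t"
proof -
  have "cst c * p = (\<Sum>u\<in>keys p. single u (c * lookup p u))"
    by (subst mpoly_expand_keys [of p])
       (simp add: sum_distrib_left cst_def xpow_def mult_single)
  then have "lookup (cst c * p) t = (\<Sum>u\<in>keys p. if u = t then c * lookup p t else 0)"
    by (auto simp: lookup_sum lookup_single when_def intro!: sum.cong)
  then show ?thesis by (auto simp: in_keys_iff)
qed

lemma lookup_mult_xpow [simp]: "lookup (p * xpow t) (u + t) = lookup p u"
proof -
  have "p * xpow t = (\<Sum>v\<in>keys p. single (v + t) (lookup p v))"
    by (subst mpoly_expand_keys [of p])
       (simp add: sum_distrib_right cst_def xpow_def mult_single)
  then have "lookup (p * xpow t) (u + t) = (\<Sum>v\<in>keys p. if v = u then lookup p u else 0)"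
    by (auto simp: lookup_sum lookup_single when_def intro!: sum.cong)
  then show ?thesis by (auto simp: in_keys_iff)
qed

lemma keys_xpow_mult: "keys (p * xpow t) \<subseteq> (\<lambda>u. u + t) ` keys p"
  using keys_mult [of p "xpow t"] by (auto simp: xpow_def split: if_splits)

lemma keys_cst_mult: "keys (cst c * p) \<subseteq> keys p"
  by (auto simp: in_keys_iff)

lemma keys_minus_subset: "keys (p - q) \<subseteq> keys p \<union> keys (q :: 'a::comm_ring_1 mpoly)"
  by (auto simp: in_keys_iff lookup_minus)

lemma lookup_xpow: "lookup (xpow t) u = (if t = u then 1 else 0)"
  by (simp add: xpow_def lookup_single when_def)

lemma keys_xpow [simp]: "keys (xpow t :: 'a::comm_ring_1 mpoly) = {t}"
  by (auto simp: xpow_def)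

lemma keys_sum_subset:
  "(\<And>i. i \<in> I \<Longrightarrow> keys (f i) \<subseteq> S) \<Longrightarrow> keys (\<Sum>i\<in>I. f i) \<subseteq> S"
proof (induction I rule: infinite_finite_induct)
  case (insert x F)
  then show ?case using Poly_Mapping.keys_add [of "f x" "sum f F"] by auto
qed auto

subsection \<open>Subgroups, ideals and subrings\<close>

text \<open>Spanning is tested against arbitrary additive subgroups: straightening only needs
  differences, and kernels of functionals and ideals are then treated alike.\<close>

definition add_subgroup :: "'b::ab_group_add set \<Rightarrow> bool" where
  "add_subgroup U \<longleftrightarrow> 0 \<in> U \<and> (\<forall>a\<in>U. \<forall>b\<in>U. a - b \<in> U)"

lemma add_subgroup_0: "add_subgroup U \<Longrightarrow> 0 \<in> U"
  by (simp add: add_subgroup_def)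

lemma add_subgroup_diff: "add_subgroup U \<Longrightarrow> a \<in> U \<Longrightarrow> b \<in> U \<Longrightarrow> a - b \<in> U"
  by (simp add: add_subgroup_def)

lemma add_subgroup_uminus: "add_subgroup U \<Longrightarrow> a \<in> U \<Longrightarrow> - a \<in> U"
  by (metis add_subgroup_def diff_0)

lemma add_subgroup_add: "add_subgroup U \<Longrightarrow> a \<in> U \<Longrightarrow> b \<in> U \<Longrightarrow> a + b \<in> U"
  by (metis add_subgroup_diff add_subgroup_uminus diff_minus_eq_add)

lemma add_subgroup_sum:
  assumes "add_subgroup U" "\<And>i. i \<in> I \<Longrightarrow> f i \<in> U"
  shows "sum f I \<in> U"
  using assms(2)
  by (induction I rule: infinite_finite_induct)
     (auto intro: add_subgroup_add add_subgroup_0 assms(1))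

definition subring :: "'b::comm_ring_1 set \<Rightarrow> bool" where
  "subring R \<longleftrightarrow> add_subgroup R \<and> 1 \<in> R \<and> (\<forall>a\<in>R. \<forall>b\<in>R. a * b \<in> R)"

lemma subring_subgroup: "subring R \<Longrightarrow> add_subgroup R"
  by (simp add: subring_def)

lemma subring_mult: "subring R \<Longrightarrow> a \<in> R \<Longrightarrow> b \<in> R \<Longrightarrow> a * b \<in> R"
  by (simp add: subring_def)

lemma subring_1: "subring R \<Longrightarrow> 1 \<in> R"
  by (simp add: subring_def)

lemma subring_power: "subring R \<Longrightarrow> a \<in> R \<Longrightarrow> a ^ k \<in> R"
  by (induction k) (auto simp: subring_def)

lemma subring_prod: "subring R \<Longrightarrow> (\<And>i. i \<in> I \<Longrightarrow> f i \<in> R) \<Longrightarrow> prod f I \<in> R"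
  by (induction I rule: infinite_finite_induct) (auto simp: subring_def)

lemma is_ideal_subset: "is_ideal R I \<Longrightarrow> a \<in> I \<Longrightarrow> a \<in> R"
  by (auto simp: is_ideal_def)

lemma is_ideal_mult: "is_ideal R I \<Longrightarrow> r \<in> R \<Longrightarrow> a \<in> I \<Longrightarrow> r * a \<in> I"
  by (auto simp: is_ideal_def)

lemma is_ideal_subgroup:
  assumes "subring R" "is_ideal R I"
  shows "add_subgroup I"
proof -
  have "- 1 \<in> R" using assms(1) by (simp add: subring_def add_subgroup_uminus)
  then have "- b \<in> I" if "b \<in> I" for b
    using is_ideal_mult [OF assms(2) \<open>- 1 \<in> R\<close> that] by simp
  then show ?thesis
    using assms(2) unfolding add_subgroup_def is_ideal_def
    by (metis uminus_add_conv_diff add.commute)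
qed

lemma is_idealI:
  assumes "I \<subseteq> R" "add_subgroup I" "\<And>r a. r \<in> R \<Longrightarrow> a \<in> I \<Longrightarrow> r * a \<in> I"
  shows "is_ideal R I"
  using assms unfolding is_ideal_def by (auto intro: add_subgroup_add add_subgroup_0)

text \<open>One notion for two uses: with \<open>S\<close> the ring it is the ideal generated by
  \<open>f\<close>, and with \<open>S\<close> an ideal J and \<open>f\<close> the monomials of
  degree r in the generators it is J I^r.\<close>

definition lincombs :: "'b::comm_ring_1 set \<Rightarrow> ('i \<Rightarrow> 'b) \<Rightarrow> 'i set \<Rightarrow> 'b set" where
  "lincombs S f A = {\<Sum>i\<in>A. c i * f i |c. \<forall>i. c i \<in> S}"

lemma lincombs_subgroup:
  assumes "add_subgroup S"
  shows "add_subgroup (lincombs S f A)"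
  unfolding add_subgroup_def
proof (intro conjI ballI)
  show "0 \<in> lincombs S f A"
    using add_subgroup_0 [OF assms] by (auto simp: lincombs_def intro!: exI [of _ "\<lambda>_. 0"])
  fix x y assume "x \<in> lincombs S f A" "y \<in> lincombs S f A"
  then obtain c d where "x = (\<Sum>i\<in>A. c i * f i)" "y = (\<Sum>i\<in>A. d i * f i)"
    "\<forall>i. c i \<in> S" "\<forall>i. d i \<in> S" by (auto simp: lincombs_def)
  then show "x - y \<in> lincombs S f A"
    using add_subgroup_diff [OF assms]
    by (auto simp: lincombs_def left_diff_distrib sum_subtractf intro!: exI [of _ "\<lambda>i. c i - d i"])
qed

lemma lincombs_mult:
  assumes S: "is_ideal R S" and r: "r \<in> R" and x: "x \<in> lincombs S f A"
  shows "r * x \<in> lincombs S f A"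
proof -
  obtain c where c: "x = (\<Sum>i\<in>A. c i * f i)" "\<forall>i. c i \<in> S" using x by (auto simp: lincombs_def)
  have "r * x = (\<Sum>i\<in>A. (r * c i) * f i)" by (simp add: c sum_distrib_left mult.assoc)
  moreover have "\<forall>i. r * c i \<in> S" using c r is_ideal_mult [OF S] by blast
  ultimately show ?thesis by (auto simp: lincombs_def)
qed

lemma lincombs_ideal:
  assumes R: "subring R" and S: "is_ideal R S" and f: "\<And>i. i \<in> A \<Longrightarrow> f i \<in> R"
  shows "is_ideal R (lincombs S f A)"
proof (rule is_idealI [OF _ lincombs_subgroup [OF is_ideal_subgroup [OF R S]] lincombs_mult [OF S]])
  show "lincombs S f A \<subseteq> R"
    using is_ideal_subset [OF S] f
    by (auto simp: lincombs_def intro!: add_subgroup_sum [OF subring_subgroup [OF R]] subring_mult [OF R])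
qed

lemma lincombs_member:
  assumes "add_subgroup S" "finite A" "i \<in> A" "a \<in> S"
  shows "a * f i \<in> lincombs S f A"
proof -
  have "(\<Sum>i'\<in>A. (if i' = i then a else 0) * f i') = a * f i"
    using assms by (subst sum.remove [of _ i]) (auto intro!: sum.neutral)
  moreover have "\<forall>i'. (if i' = i then a else 0) \<in> S"
    using assms(4) add_subgroup_0 [OF assms(1)] by simp
  ultimately show ?thesis
    unfolding lincombs_def by (intro CollectI exI [of _ "\<lambda>i'. if i' = i then a else 0"]) simp
qed

lemma is_ideal_self: "subring R \<Longrightarrow> is_ideal R R"
  by (auto intro: is_idealI simp: subring_def)

lemma ideal_gen_eqI:
  assumes "is_ideal R I" "S \<subseteq> I" "\<And>I'. is_ideal R I' \<Longrightarrow> S \<subseteq> I' \<Longrightarrow> I \<subseteq> I'"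
  shows "ideal_gen R S = I"
  using assms unfolding ideal_gen_def by blast

text \<open>Zorn's lemma yields an ideal maximal among those that contain \<open>a\<close> and miss
  1; such an ideal is prime, and only this is exported.\<close>

lemma exists_prime_ideal:
  fixes R :: "'b::comm_ring_1 set"
  assumes R: "subring R" and a: "is_ideal R a" "1 \<notin> a"
  obtains q where "is_ideal R q" "a \<subseteq> q" "1 \<notin> q"
    "\<And>x y. x \<in> R \<Longrightarrow> y \<in> R \<Longrightarrow> x * y \<in> q \<Longrightarrow> x \<in> q \<or> y \<in> q"
proof -
  define F where "F = {I. is_ideal R I \<and> a \<subseteq> I \<and> 1 \<notin> I}"
  have "\<exists>M\<in>F. \<forall>X\<in>F. M \<subseteq> X \<longrightarrow> X = M"
  proof (rule subset_Zorn_nonempty)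
    show "F \<noteq> {}" using a by (auto simp: F_def)
  next
    fix C assume C: "C \<noteq> {}" "subset.chain F C"
    have CF: "\<And>I. I \<in> C \<Longrightarrow> is_ideal R I \<and> a \<subseteq> I \<and> 1 \<notin> I"
      using C(2) by (auto simp: subset.chain_def F_def)
    have "is_ideal R (\<Union>C)"
      unfolding is_ideal_def
    proof (intro conjI ballI)
      show "\<Union>C \<subseteq> R" using CF is_ideal_subset by blast
      show "0 \<in> \<Union>C" using C(1) CF by (auto simp: is_ideal_def)
    next
      fix x y assume "x \<in> \<Union>C" "y \<in> \<Union>C"
      then obtain X Y where XY: "X \<in> C" "x \<in> X" "Y \<in> C" "y \<in> Y" by blast
      then consider "X \<subseteq> Y" | "Y \<subseteq> X" using C(2) by (auto simp: subset.chain_def)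
      then show "x + y \<in> \<Union>C"
      proof cases
        case 1
        then have "x + y \<in> Y" using XY CF [of Y] by (auto simp: is_ideal_def)
        then show ?thesis using XY by blast
      next
        case 2
        then have "x + y \<in> X" using XY CF [of X] by (auto simp: is_ideal_def)
        then show ?thesis using XY by blast
      qed
    next
      fix r x assume "r \<in> R" "x \<in> \<Union>C"
      then show "r * x \<in> \<Union>C" using CF is_ideal_mult by blast
    qed
    then show "\<Union>C \<in> F" using C(1) CF by (auto simp: F_def)
  qed
  then obtain q where qF: "q \<in> F" and max: "\<And>X. X \<in> F \<Longrightarrow> q \<subseteq> X \<Longrightarrow> X = q" by blast
  have q: "is_ideal R q" "a \<subseteq> q" "1 \<notin> q" using qF by (auto simp: F_def)
  note sg = is_ideal_subgroup [OF R q(1)] and sR = subring_subgroup [OF R]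
  \<comment> \<open>Elements outside \<open>q\<close> are invertible modulo \<open>q\<close>: by
    maximality, \<open>q\<close> and \<open>x\<close> together generate 1.\<close>
  have ext: "\<exists>r\<in>R. 1 - r * x \<in> q" if x: "x \<in> R" "x \<notin> q" for x
  proof -
    define X where "X = {z \<in> R. \<exists>r\<in>R. z - r * x \<in> q}"
    have "is_ideal R X"
    proof (rule is_idealI)
      show "X \<subseteq> R" by (auto simp: X_def)
      show "add_subgroup X"
        unfolding add_subgroup_def
      proof (intro conjI ballI)
        show "0 \<in> X"
          using add_subgroup_0 [OF sR] add_subgroup_0 [OF sg]
          by (auto simp: X_def intro!: bexI [of _ 0])
        fix z w assume "z \<in> X" "w \<in> X"
        then obtain r s where "z \<in> R" "w \<in> R" "r \<in> R" "s \<in> R" "z - r * x \<in> q" "w - s * x \<in> q"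
          by (auto simp: X_def)
        moreover from this have "(z - w) - (r - s) * x \<in> q"
          using add_subgroup_diff [OF sg, of "z - r * x" "w - s * x"] by (simp add: algebra_simps)
        ultimately show "z - w \<in> X"
          unfolding X_def using add_subgroup_diff [OF sR] by blast
      qed
      fix s z assume s: "s \<in> R" "z \<in> X"
      then obtain r where r: "z \<in> R" "r \<in> R" "z - r * x \<in> q" by (auto simp: X_def)
      then have "s * z - (s * r) * x \<in> q"
        using is_ideal_mult [OF q(1) s(1) r(3)] by (simp add: algebra_simps)
      then show "s * z \<in> X" unfolding X_def using subring_mult [OF R] s r by blast
    qed
    moreover have "q \<subseteq> X"
      using is_ideal_subset [OF q(1)] add_subgroup_0 [OF sR]
      by (auto simp: X_def intro!: bexI [of _ 0])
    moreover have "x \<in> X"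
      using x subring_1 [OF R] add_subgroup_0 [OF sg]
      by (auto simp: X_def intro!: bexI [of _ 1])
    ultimately have "1 \<in> X" using max [of X] q x by (auto simp: F_def)
    then show ?thesis by (auto simp: X_def)
  qed
  show thesis
  proof (rule that [OF q])
    fix x y assume xy: "x \<in> R" "y \<in> R" "x * y \<in> q"
    show "x \<in> q \<or> y \<in> q"
    proof (rule ccontr)
      assume "\<not> ?thesis"
      then obtain r s where rs: "r \<in> R" "s \<in> R" "1 - r * x \<in> q" "1 - s * y \<in> q"
        using ext xy by blast
      have "1 = (1 - r * x) + r * x * (1 - s * y) + r * s * (x * y)"
        by (simp add: algebra_simps)
      moreover have "r * x * (1 - s * y) \<in> q" "r * s * (x * y) \<in> q"
        using rs xy by (simp_all add: is_ideal_mult [OF q(1)] subring_mult [OF R])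
      ultimately have "1 \<in> q" using rs(3) add_subgroup_add [OF sg] by metis
      then show False using q by blast
    qed
  qed
qed

lemma subring_poly_ring: "subring (poly_ring m :: 'a::comm_ring_1 mpoly set)"
  unfolding subring_def add_subgroup_def
proof (intro conjI ballI)
  fix p q :: "'a mpoly" assume pq: "p \<in> poly_ring m" "q \<in> poly_ring m"
  show "p - q \<in> poly_ring m"
    using pq keys_minus_subset [of p q] unfolding poly_ring_def by blast
  show "p * q \<in> poly_ring m"
    unfolding poly_ring_def
  proof safe
    fix t x assume "t \<in> keys (p * q)" "x \<in> keys t"
    then obtain u v where uv: "t = u + v" "u \<in> keys p" "v \<in> keys q"
      using keys_mult by blast
    then have "x \<in> keys u \<union> keys v"
      using \<open>x \<in> keys t\<close> Poly_Mapping.keys_add [of u v] by blast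
    moreover have "keys u \<subseteq> {1..m}" "keys v \<subseteq> {1..m}"
      using uv pq unfolding poly_ring_def by blast+
    ultimately show "x \<in> {1..m}" by blast
  qed
qed (auto simp: poly_ring_def)

lemmas R_subgroup = subring_subgroup [OF subring_poly_ring]
lemmas R_1 = subring_1 [OF subring_poly_ring]
lemmas R_mult = subring_mult [OF subring_poly_ring]
lemmas ideal_subgroup = is_ideal_subgroup [OF subring_poly_ring]
lemmas R_ideal = is_ideal_self [OF subring_poly_ring]

lemma cst_in_poly_ring [simp]: "cst c \<in> poly_ring m"
  by (auto simp: poly_ring_def cst_def split: if_splits)

lemma xpow_in_poly_ring: "xpow t \<in> (poly_ring m :: 'a::comm_ring_1 mpoly set) \<longleftrightarrow> keys t \<subseteq> {1..m}"
  by (simp add: poly_ring_def)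

lemma Var_in_poly_ring: "i \<in> {1..m} \<Longrightarrow> Var i \<in> poly_ring m"
  by (simp add: Var_xpow xpow_in_poly_ring)

subsection \<open>Linear algebra\<close>

text \<open>Gaussian elimination by columns: the pivot row \<open>i0\<close> clears column
  \<open>j0\<close>, and its own coefficient \<open>- s\<close> is chosen afterwards so that the
  relation also holds there.\<close>

lemma exists_dependency:
  fixes a :: "'i \<Rightarrow> 'j \<Rightarrow> 'a::field"
  assumes "finite J" "finite I" "card J < card I"
  shows "\<exists>c. (\<exists>i\<in>I. c i \<noteq> 0) \<and> (\<forall>j\<in>J. (\<Sum>i\<in>I. c i * a i j) = 0)"
  using assms
proof (induction J arbitrary: I a rule: finite_induct)
  case empty
  then have "I \<noteq> {}" by auto
  then show ?case by (auto intro!: exI [of _ "\<lambda>_. 1"])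
next
  case (insert j0 J)
  show ?case
  proof (cases "\<forall>i\<in>I. a i j0 = 0")
    case True
    have "card J < card I" using insert by auto
    then obtain c where "\<exists>i\<in>I. c i \<noteq> 0" "\<forall>j\<in>J. (\<Sum>i\<in>I. c i * a i j) = 0"
      using insert.IH [of I a] insert.prems by blast
    then show ?thesis using True by (intro exI [of _ c]) simp
  next
    case False
    then obtain i0 where i0: "i0 \<in> I" "a i0 j0 \<noteq> 0" by blast
    define a' where "a' = (\<lambda>i j. a i j - a i j0 / a i0 j0 * a i0 j)"
    have "card J < card (I - {i0})" using insert i0 by auto
    then obtain c where c: "\<exists>i\<in>I - {i0}. c i \<noteq> 0" "\<forall>j\<in>J. (\<Sum>i\<in>I - {i0}. c i * a' i j) = 0"
      using insert.IH [of "I - {i0}" a'] insert by blast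
    define s where "s = (\<Sum>i\<in>I - {i0}. c i * a i j0 / a i0 j0)"
    define c' where "c' = c(i0 := - s)"
    have *: "(\<Sum>i\<in>I. c' i * a i j) = (\<Sum>i\<in>I - {i0}. c i * a' i j)" for j
    proof -
      have "(\<Sum>i\<in>I. c' i * a i j) = (\<Sum>i\<in>I - {i0}. c' i * a i j) + c' i0 * a i0 j"
        using sum.remove [OF insert.prems(1) i0(1), of "\<lambda>i. c' i * a i j"] by (simp add: add.commute)
      also have "(\<Sum>i\<in>I - {i0}. c' i * a i j) = (\<Sum>i\<in>I - {i0}. c i * a i j)"
        by (rule sum.cong) (auto simp: c'_def)
      also have "c' i0 * a i0 j = - (\<Sum>i\<in>I - {i0}. c i * (a i j0 / a i0 j0 * a i0 j))"
        by (simp add: c'_def s_def sum_distrib_right mult.assoc)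
      finally show ?thesis by (simp add: a'_def right_diff_distrib sum_subtractf)
    qed
    have "(\<Sum>i\<in>I - {i0}. c i * a' i j0) = 0" using i0 by (simp add: a'_def)
    then have "\<forall>j\<in>insert j0 J. (\<Sum>i\<in>I. c' i * a i j) = 0" using * c by auto
    moreover have "\<exists>i\<in>I. c' i \<noteq> 0" using c by (auto simp: c'_def)
    ultimately show ?thesis by blast
  qed
qed

definition polyfun :: "('a::field \<Rightarrow> 'a) \<Rightarrow> bool" where
  "polyfun f \<longleftrightarrow> (\<exists>P. \<forall>c. f c = poly P c)"

lemma polyfun_mult_diff:
  assumes "polyfun f" "polyfun g" "polyfun h" "polyfun k"
  shows "polyfun (\<lambda>c. f c * g c - h c * k c)"
proof -
  obtain F G H K where "\<forall>c. f c = poly F c" "\<forall>c. g c = poly G c"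
    "\<forall>c. h c = poly H c" "\<forall>c. k c = poly K c"
    using assms by (auto simp: polyfun_def)
  then show ?thesis unfolding polyfun_def by (auto intro!: exI [of _ "F * G - H * K"])
qed

text \<open>For finite \<open>I\<close> this says dually that the columns indexed by
  \<open>X\<close> span the coordinate space on \<open>I\<close>; in this form spanning is an open
  condition in a parameter.\<close>

definition rows_indep :: "'i set \<Rightarrow> 'x set \<Rightarrow> ('i \<Rightarrow> 'x \<Rightarrow> 'a::field) \<Rightarrow> bool" where
  "rows_indep I X a \<longleftrightarrow> (\<forall>q. (\<forall>x\<in>X. (\<Sum>i\<in>I. q i * a i x) = 0) \<longrightarrow> (\<forall>i\<in>I. q i = 0))"

text \<open>Semicontinuity of the rank, by elimination instead of minors. Each pivot is a polynomial
  in the parameter that is nonzero at \<open>c0\<close>, so it excludes only finitely many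
  values.\<close>

lemma rows_indep_cofinite:
  fixes a :: "'i \<Rightarrow> 'x \<Rightarrow> 'a::field \<Rightarrow> 'a"
  assumes "finite I" "\<And>i x. polyfun (a i x)" "rows_indep I X (\<lambda>i x. a i x c0)"
  shows "finite {c. \<not> rows_indep I X (\<lambda>i x. a i x c)}"
  using assms
proof (induction I arbitrary: a rule: finite_induct)
  case empty
  then show ?case by (simp add: rows_indep_def)
next
  case (insert i0 I)
  have "\<exists>x\<in>X. a i0 x c0 \<noteq> 0"
  proof (rule ccontr)
    assume "\<not> ?thesis"
    then have z: "\<And>x. x \<in> X \<Longrightarrow> a i0 x c0 = 0" by blast
    define q :: "'i \<Rightarrow> 'a" where "q = (\<lambda>i. if i = i0 then 1 else 0)"
    have "(\<Sum>i\<in>insert i0 I. q i * a i x c0) = 0" if "x \<in> X" for x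
      by (rule sum.neutral) (simp add: q_def z [OF that])
    then have "q i0 = 0" using insert.prems(2) unfolding rows_indep_def by blast
    then show False by (simp add: q_def)
  qed
  then obtain x0 where x0: "x0 \<in> X" "a i0 x0 c0 \<noteq> 0" by blast
  \<comment> \<open>Cross multiplication instead of division keeps the entries polynomial in
    \<open>c\<close>.\<close>
  define a' where "a' = (\<lambda>i x c. a i0 x0 c * a i x c - a i x0 c * a i0 x c)"
  have sum': "(\<Sum>i\<in>I. q i * a' i x c) =
      a i0 x0 c * (\<Sum>i\<in>I. q i * a i x c) - (\<Sum>i\<in>I. q i * a i x0 c) * a i0 x c" for q x c
    by (simp add: a'_def right_diff_distrib sum_subtractf sum_distrib_left sum_distrib_right
        mult_ac)
  have "rows_indep I X (\<lambda>i x. a' i x c0)"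
    unfolding rows_indep_def
  proof (intro allI impI ballI)
    fix q i assume q: "\<forall>x\<in>X. (\<Sum>i\<in>I. q i * a' i x c0) = 0" and i: "i \<in> I"
    define q' where "q' = (\<lambda>i. if i = i0 then - (\<Sum>i\<in>I. q i * a i x0 c0) else q i * a i0 x0 c0)"
    have "(\<Sum>i\<in>insert i0 I. q' i * a i x c0) = 0" if "x \<in> X" for x
    proof -
      have "(\<Sum>i\<in>I. q' i * a i x c0) = a i0 x0 c0 * (\<Sum>i\<in>I. q i * a i x c0)"
        using insert.hyps by (auto simp: q'_def sum_distrib_left mult_ac intro!: sum.cong)
      then have "(\<Sum>i\<in>insert i0 I. q' i * a i x c0) = (\<Sum>i\<in>I. q i * a' i x c0)"
        using insert.hyps by (simp add: sum' q'_def)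
      then show ?thesis using q that by simp
    qed
    then have "q' i = 0" using insert.prems(2) i unfolding rows_indep_def by blast
    then show "q i = 0" using i insert.hyps x0 by (auto simp: q'_def split: if_splits)
  qed
  moreover have "polyfun (a' i x)" for i x
    unfolding a'_def by (intro polyfun_mult_diff insert.prems)
  ultimately have fin: "finite {c. \<not> rows_indep I X (\<lambda>i x. a' i x c)}"
    using insert.IH by blast
  obtain P where P: "\<forall>c. a i0 x0 c = poly P c"
    using insert.prems(1) unfolding polyfun_def by blast
  then have "P \<noteq> 0" using x0 by auto
  then have fin2: "finite {c. a i0 x0 c = 0}" using P poly_roots_finite [of P] by simp
  have "rows_indep (insert i0 I) X (\<lambda>i x. a i x c)"
    if c: "rows_indep I X (\<lambda>i x. a' i x c)" "a i0 x0 c \<noteq> 0" for c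
    unfolding rows_indep_def
  proof (intro allI impI)
    fix q assume q: "\<forall>x\<in>X. (\<Sum>i\<in>insert i0 I. q i * a i x c) = 0"
    then have q2: "(\<Sum>i\<in>I. q i * a i x c) = - q i0 * a i0 x c" if "x \<in> X" for x
      using insert.hyps that by (simp add: eq_neg_iff_add_eq_0 add.commute)
    have "\<forall>x\<in>X. (\<Sum>i\<in>I. q i * a' i x c) = 0"
      using q2 x0 by (simp add: sum' mult_ac)
    then have *: "\<forall>i\<in>I. q i = 0" using c(1) unfolding rows_indep_def by blast
    then have "q i0 * a i0 x0 c = 0" using q2 [OF x0(1)] by simp
    then show "\<forall>i\<in>insert i0 I. q i = 0" using * c by simp
  qed
  then have "{c. \<not> rows_indep (insert i0 I) X (\<lambda>i x. a i x c)} \<subseteq>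
      {c. \<not> rows_indep I X (\<lambda>i x. a' i x c)} \<union> {c. a i0 x0 c = 0}" by blast
  then show ?case using fin fin2 finite_subset by blast
qed

text \<open>Nakayama's lemma together with the existence of a linear form vanishing on a proper
  subspace of a vector space over the residue field, for submodules of a free module.\<close>

lemma submodule_dichotomy:
  fixes R :: "'b::comm_ring_1 set" and B :: "(nat \<Rightarrow> 'b) set"
  assumes R: "subring R" and q: "is_ideal R q" "1 \<notin> q"
    and prime: "\<And>x y. x \<in> R \<Longrightarrow> y \<in> R \<Longrightarrow> x * y \<in> q \<Longrightarrow> x \<in> q \<or> y \<in> q"
    and "\<And>b i. b \<in> B \<Longrightarrow> b i \<in> R"
    and "\<And>b b' r r'. b \<in> B \<Longrightarrow> b' \<in> B \<Longrightarrow> r \<in> R \<Longrightarrow> r' \<in> R \<Longrightarrow> (\<lambda>i. r * b i + r' * b' i) \<in> B"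
  shows "(\<exists>u\<in>R - q. \<forall>i<l. \<exists>b\<in>B. \<forall>j<l. b j = (if j = i then u else 0)) \<or>
    (\<exists>t. (\<forall>i<l. t i \<in> R) \<and> (\<exists>i<l. t i \<notin> q) \<and> (\<forall>b\<in>B. (\<Sum>i<l. t i * b i) \<in> q))"
  using assms(5,6)
proof (induction l arbitrary: B)
  case 0
  then show ?case using q subring_1 [OF R] by auto
next
  case (Suc l)
  note sR = subring_subgroup [OF R]
  have m1: "- 1 \<in> R" using add_subgroup_uminus [OF sR subring_1 [OF R]] .
  show ?case
  proof (cases "\<exists>b\<in>B. b l \<notin> q")
    case False
    then have "\<forall>b\<in>B. (\<Sum>i<Suc l. (if i = l then 1 else 0) * b i) \<in> q"
      by (simp add: lessThan_Suc)
    then show ?thesis using q subring_1 [OF R] add_subgroup_0 [OF sR]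
      by (intro disjI2 exI [of _ "\<lambda>i. if i = l then 1 else 0"]) auto
  next
    case True
    then obtain b where b: "b \<in> B" "b l \<notin> q" by blast
    define B' where "B' = {b \<in> B. b l = 0}"
    have B': "b i \<in> R" if "b \<in> B'" for b i using Suc.prems(1) that by (auto simp: B'_def)
    have B'2: "(\<lambda>i. r * b i + r' * b' i) \<in> B'"
      if "b \<in> B'" "b' \<in> B'" "r \<in> R" "r' \<in> R" for b b' r r'
      using Suc.prems(2) that by (auto simp: B'_def)
    \<comment> \<open>Clears the last coordinate of \<open>b'\<close> by means of \<open>b\<close>,
      whose last coordinate is a unit at \<open>q\<close>.\<close>
    have proj: "(\<lambda>i. b l * b' i + (- b' l) * b i) \<in> B'" if "b' \<in> B" for b'
    proof -
      have "(\<lambda>i. b l * b' i + (- b' l) * b i) \<in> B"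
        using Suc.prems(2) [OF that b(1)] Suc.prems(1) that b(1) add_subgroup_uminus [OF sR] by blast
      then show ?thesis by (simp add: B'_def mult.commute)
    qed
    have "(\<exists>u\<in>R - q. \<forall>i<l. \<exists>b\<in>B'. \<forall>j<l. b j = (if j = i then u else 0)) \<or>
      (\<exists>t. (\<forall>i<l. t i \<in> R) \<and> (\<exists>i<l. t i \<notin> q) \<and> (\<forall>b\<in>B'. (\<Sum>i<l. t i * b i) \<in> q))"
      by (rule Suc.IH) (use B' B'2 in blast)+
    then show ?thesis
    proof
      assume "\<exists>u\<in>R - q. \<forall>i<l. \<exists>b\<in>B'. \<forall>j<l. b j = (if j = i then u else 0)"
      then obtain u where u: "u \<in> R" "u \<notin> q"
        and "\<forall>i<l. \<exists>b\<in>B'. \<forall>j<l. b j = (if j = i then u else 0)" by blast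
      then obtain e where e: "\<And>i. i < l \<Longrightarrow> e i \<in> B'"
        "\<And>i j. i < l \<Longrightarrow> j < l \<Longrightarrow> e i j = (if j = i then u else 0)" by metis
      have el: "e i l = 0" "e i \<in> B" if "i < l" for i using e(1) [OF that] by (auto simp: B'_def)
      note clos = Suc.prems
      \<comment> \<open>For \<open>k = l\<close> the multiples of the \<open>e i\<close> have
        cleared the first \<open>l\<close> coordinates of \<open>u\<close> times \<open>b\<close>,
        leaving \<open>u * b l\<close> in the last one.\<close>
      have clB: "(\<lambda>j. u * b j - (\<Sum>i<k. b i * e i j)) \<in> B" if "k \<le> l" for k
        using that
      proof (induction k)
        case 0
        show ?case using clos(2) [OF b(1) b(1) u(1) add_subgroup_0 [OF sR]] by simp
      next
        case (Suc k)
        have "(\<lambda>j. 1 * (u * b j - (\<Sum>i<k. b i * e i j)) + (- b k) * e k j) \<in> B"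
        proof (rule clos(2))
          show "(\<lambda>j. u * b j - (\<Sum>i<k. b i * e i j)) \<in> B" using Suc by simp
          show "e k \<in> B" using el Suc by simp
          show "1 \<in> R" using subring_1 [OF R] .
          show "- b k \<in> R" using clos(1) b add_subgroup_uminus [OF sR] by blast
        qed
        then show ?case by (simp add: algebra_simps)
      qed
      have ul: "u * b l \<in> R" "u * b l \<notin> q"
        using u b Suc.prems(1) [OF b(1)] prime subring_mult [OF R] by blast+
      have "\<exists>b'\<in>B. \<forall>j<Suc l. b' j = (if j = i then u * b l else 0)" if i: "i < Suc l" for i
      proof (cases "i = l")
        case True
        have "u * b j - (\<Sum>i<l. b i * e i j) = (if j = l then u * b l else 0)" if "j < Suc l" for j
        proof (cases "j = l")
          case True
          then show ?thesis using el by simp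
        next
          case False
          then have "j < l" using that by simp
          then have "(\<Sum>i<l. b i * e i j) = (\<Sum>i<l. if i = j then b j * u else 0)"
            using e(2) by (intro sum.cong) auto
          then show ?thesis using False \<open>j < l\<close> by (simp add: mult.commute)
        qed
        then show ?thesis using True by (intro bexI [OF _ clB [of l]]) auto
      next
        case False
        then have "i < l" using i by simp
        moreover have "(\<lambda>j. b l * e i j + 0 * e i j) \<in> B"
          using Suc.prems(2) [OF el(2) [OF \<open>i < l\<close>] el(2) [OF \<open>i < l\<close>] Suc.prems(1) [OF b(1)]
            add_subgroup_0 [OF sR]] .
        moreover have "b l * e i j + 0 * e i j = (if j = i then u * b l else 0)" if "j < Suc l" for j
        proof (cases "j = l")
          case True
          then show ?thesis using el(1) [OF \<open>i < l\<close>] \<open>i < l\<close> by simp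
        next
          case False
          then have "j < l" using that by simp
          then show ?thesis using e(2) [OF \<open>i < l\<close> \<open>j < l\<close>] by (simp add: mult.commute)
        qed
        ultimately show ?thesis by (intro bexI [of _ "\<lambda>j. b l * e i j + 0 * e i j"]) blast+
      qed
      then show ?thesis using ul by blast
    next
      assume "\<exists>t. (\<forall>i<l. t i \<in> R) \<and> (\<exists>i<l. t i \<notin> q) \<and> (\<forall>b\<in>B'. (\<Sum>i<l. t i * b i) \<in> q)"
      then obtain t i0 where t: "\<And>i. i < l \<Longrightarrow> t i \<in> R" "i0 < l" "t i0 \<notin> q"
        "\<And>b. b \<in> B' \<Longrightarrow> (\<Sum>i<l. t i * b i) \<in> q" by blast
      \<comment> \<open>The last coefficient is chosen so that \<open>t'\<close> vanishes on
        \<open>b\<close>; by \<open>proj\<close>, its values on \<open>B\<close> are then values of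
        \<open>t\<close> on \<open>B'\<close>.\<close>
      define t' where "t' = (\<lambda>i. if i < l then b l * t i else - (\<Sum>i<l. t i * b i))"
      have "t' i \<in> R" for i
        unfolding t'_def using t Suc.prems(1) [OF b(1)]
        by (auto intro!: add_subgroup_uminus [OF sR] add_subgroup_sum [OF sR] subring_mult [OF R])
      moreover have "t' i0 \<notin> q"
        using prime [of "b l" "t i0"] t b Suc.prems(1) [OF b(1)] by (auto simp: t'_def)
      moreover have "(\<Sum>i<Suc l. t' i * b' i) \<in> q" if "b' \<in> B" for b'
      proof -
        have "(\<Sum>i<Suc l. t' i * b' i) =
            (\<Sum>i<l. b l * t i * b' i) - (\<Sum>i<l. t i * b i) * b' l"
          by (simp add: t'_def lessThan_Suc)
        also have "\<dots> = (\<Sum>i<l. t i * (b l * b' i + (- b' l) * b i))"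
          by (simp add: algebra_simps sum.distrib sum_distrib_left sum_subtractf)
        finally show ?thesis using t(4) [OF proj [OF that]] by simp
      qed
      ultimately show ?thesis using t(2) by (intro disjI2) (metis less_Suc_eq)
    qed
  qed
qed

text \<open>Applies the dichotomy to the coefficient vectors \<open>b\<close> whose combination of
  the \<open>f i\<close> lies in \<open>X\<close>. Either \<open>X\<close> contains all
  \<open>f i\<close> locally at \<open>q\<close>, or a linear form that is nonzero modulo
  \<open>q\<close> kills these vectors; they include all relations among the \<open>f i\<close>, so
  the \<open>f i\<close> need not be independent.\<close>

lemma ideal_dichotomy:
  fixes R X :: "'b::comm_ring_1 set" and f :: "nat \<Rightarrow> 'b"
  assumes R: "subring R" and q: "is_ideal R q" "1 \<notin> q"
    and prime: "\<And>x y. x \<in> R \<Longrightarrow> y \<in> R \<Longrightarrow> x * y \<in> q \<Longrightarrow> x \<in> q \<or> y \<in> q"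
    and X: "is_ideal R X"
  obtains u where "u \<in> R" "u \<notin> q" "\<And>i. i < l \<Longrightarrow> u * f i \<in> X"
  | t i where "\<And>i. i < l \<Longrightarrow> t i \<in> R" "i < l" "t i \<notin> q"
    "\<And>b. (\<And>i. b i \<in> R) \<Longrightarrow> (\<Sum>i<l. b i * f i) \<in> X \<Longrightarrow> (\<Sum>i<l. t i * b i) \<in> q"
proof -
  note sX = is_ideal_subgroup [OF R X] and sR = subring_subgroup [OF R]
  define B where "B = {b. (\<forall>i. b i \<in> R) \<and> (\<Sum>i<l. b i * f i) \<in> X}"
  have "(\<exists>u\<in>R - q. \<forall>i<l. \<exists>b\<in>B. \<forall>j<l. b j = (if j = i then u else 0)) \<or>
    (\<exists>t. (\<forall>i<l. t i \<in> R) \<and> (\<exists>i<l. t i \<notin> q) \<and> (\<forall>b\<in>B. (\<Sum>i<l. t i * b i) \<in> q))"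
  proof (rule submodule_dichotomy [OF R q prime])
    show "b i \<in> R" if "b \<in> B" for b i using that by (simp add: B_def)
    fix b b' :: "nat \<Rightarrow> 'b" and r r' :: 'b
    assume *: "b \<in> B" "b' \<in> B" "r \<in> R" "r' \<in> R"
    have "(\<Sum>i<l. (r * b i + r' * b' i) * f i) = r * (\<Sum>i<l. b i * f i) + r' * (\<Sum>i<l. b' i * f i)"
      by (simp add: sum_distrib_left distrib_right sum.distrib mult.assoc)
    also have "\<dots> \<in> X"
      using * by (intro add_subgroup_add [OF sX] is_ideal_mult [OF X]) (auto simp: B_def)
    finally show "(\<lambda>i. r * b i + r' * b' i) \<in> B"
      using * by (auto simp: B_def intro!: add_subgroup_add [OF sR] subring_mult [OF R])
  qed
  then show thesis
  proof
    assume "\<exists>u\<in>R - q. \<forall>i<l. \<exists>b\<in>B. \<forall>j<l. b j = (if j = i then u else 0)"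
    then obtain u where u: "u \<in> R" "u \<notin> q"
      "\<And>i. i < l \<Longrightarrow> \<exists>b\<in>B. \<forall>j<l. b j = (if j = i then u else 0)" by blast
    have "u * f i \<in> X" if i: "i < l" for i
    proof -
      obtain b where b: "b \<in> B" "\<forall>j<l. b j = (if j = i then u else 0)" using u(3) [OF i] by blast
      have "(\<Sum>j<l. b j * f j) = (\<Sum>j<l. if j = i then u * f i else 0)"
        using b(2) by (intro sum.cong) auto
      then show ?thesis using b(1) i by (simp add: B_def)
    qed
    then show thesis using that(1) u(1,2) by blast
  next
    assume "\<exists>t. (\<forall>i<l. t i \<in> R) \<and> (\<exists>i<l. t i \<notin> q) \<and> (\<forall>b\<in>B. (\<Sum>i<l. t i * b i) \<in> q)"
    then obtain t i where "\<And>i. i < l \<Longrightarrow> t i \<in> R" "i < l" "t i \<notin> q"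
      "\<And>b. b \<in> B \<Longrightarrow> (\<Sum>i<l. t i * b i) \<in> q" by blast
    then show thesis using that(2) [of t i] by (simp add: B_def)
  qed
qed

subsection \<open>Multi-indices and homogeneous forms\<close>

text \<open>Vanishing from \<open>l\<close> on makes equality of exponents equality of functions,
  and the set finite.\<close>

definition mi :: "nat \<Rightarrow> nat \<Rightarrow> (nat \<Rightarrow> nat) set" where
  "mi l N = {\<alpha>. (\<forall>i\<ge>l. \<alpha> i = 0) \<and> (\<Sum>i<l. \<alpha> i) = N}"

definition pw :: "nat \<Rightarrow> (nat \<Rightarrow> 'b::comm_ring_1) \<Rightarrow> (nat \<Rightarrow> nat) \<Rightarrow> 'b" where
  "pw l g \<alpha> = (\<Prod>i<l. g i ^ \<alpha> i)"

lemma finite_bounded_funs: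
  fixes l N :: nat
  shows "finite {\<alpha>. (\<forall>i\<ge>l. \<alpha> i = (0::nat)) \<and> (\<forall>i<l. \<alpha> i \<le> N)}"
proof (rule finite_subset)
  show "finite {\<alpha>. \<forall>i. (i \<in> {..<l} \<longrightarrow> \<alpha> i \<in> {..N}) \<and> (i \<notin> {..<l} \<longrightarrow> \<alpha> i = 0)}"
    by (rule finite_set_of_finite_funs) simp_all
  show "{\<alpha>. (\<forall>i\<ge>l. \<alpha> i = 0) \<and> (\<forall>i<l. \<alpha> i \<le> N)} \<subseteq>
      {\<alpha>. \<forall>i. (i \<in> {..<l} \<longrightarrow> \<alpha> i \<in> {..N}) \<and> (i \<notin> {..<l} \<longrightarrow> \<alpha> i = 0)}"
    by (rule Collect_mono) (simp only: lessThan_iff atMost_iff not_less, blast)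
qed

lemma finite_mi [simp]: "finite (mi l N)"
proof (rule finite_subset [OF _ finite_bounded_funs])
  show "mi l N \<subseteq> {\<alpha>. (\<forall>i\<ge>l. \<alpha> i = (0::nat)) \<and> (\<forall>i<l. \<alpha> i \<le> N)}"
    by (auto simp: mi_def intro!: member_le_sum)
qed

lemma mi_add: "\<alpha> \<in> mi l N \<Longrightarrow> \<beta> \<in> mi l M \<Longrightarrow> (\<lambda>i. \<alpha> i + \<beta> i) \<in> mi l (N + M)"
  by (auto simp: mi_def sum.distrib)

lemma pw_add: "pw l g (\<lambda>i. \<alpha> i + \<beta> i) = pw l g \<alpha> * pw l g \<beta>"
  by (simp add: pw_def power_add prod.distrib)

lemma pw_zero [simp]: "pw l g (\<lambda>_. 0) = 1"
  by (simp add: pw_def)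

lemma pw_unit: "i < l \<Longrightarrow> pw l g (\<lambda>j. if j = i then 1 else 0) = g i"
  unfolding pw_def by (subst prod.remove [of _ i]) (auto intro!: prod.neutral)

lemma mi_unit: "i < l \<Longrightarrow> (\<lambda>j. if j = i then 1 else 0) \<in> mi l 1"
  by (auto simp: mi_def)

lemma mi_0: "mi l 0 = {\<lambda>_. 0}"
  by (auto simp: mi_def fun_eq_iff) (metis lessThan_iff not_le)

text \<open>\<open>form R l g \<tau> N y z\<close> says that \<open>y = P(g)\<close> and \<open>z = P(\<tau>)\<close> for a form \<open>P\<close> of degree
  \<open>N\<close> in \<open>l\<close> variables with coefficients in \<open>R\<close>.\<close>

inductive form for R :: "'b::comm_ring_1 set" and l :: nat and g t :: "nat \<Rightarrow> 'b" where
  form_monomial: "c \<in> R \<Longrightarrow> \<alpha> \<in> mi l N \<Longrightarrow> form R l g t N (c * pw l g \<alpha>) (c * pw l t \<alpha>)"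
| form_add: "form R l g t N y z \<Longrightarrow> form R l g t N y' z' \<Longrightarrow> form R l g t N (y + y') (z + z')"

lemma form_scale:
  assumes "subring R" "form R l g t N y z" "r \<in> R"
  shows "form R l g t N (r * y) (r * z)"
  using assms(2)
proof induction
  case (form_monomial c \<alpha> N)
  then show ?case
    using form.form_monomial [of "r * c" R \<alpha> l N g t] assms subring_mult
    by (auto simp: mult.assoc)
qed (simp add: distrib_left form.form_add)

lemma form_mult:
  assumes R: "subring R" and "form R l g t N y z" "form R l g t M y' z'"
  shows "form R l g t (N + M) (y * y') (z * z')"
  using assms(2)
proof induction
  case (form_monomial c \<alpha> N)
  note 1 = this
  show ?case using assms(3)
  proof induction
    case (form_monomial d \<beta> M)
    then show ?case
      using form.form_monomial [of "c * d" R "\<lambda>i. \<alpha> i + \<beta> i" l "N + M" g t] 1 mi_add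
        subring_mult [OF R] by (auto simp: pw_add mult_ac)
  qed (simp add: distrib_left form.form_add)
qed (simp add: distrib_right form.form_add)

lemma form_linear:
  assumes R: "subring R" and "0 < l" "\<And>i. i < l \<Longrightarrow> b i \<in> R"
  shows "form R l g t 1 (\<Sum>i<l. b i * g i) (\<Sum>i<l. b i * t i)"
proof -
  have *: "form R l g t 1 (c * g i) (c * t i)" if "i < l" "c \<in> R" for i c
    using form_monomial [of c R _ l 1 g t, OF that(2) mi_unit [OF that(1)]] that pw_unit by metis
  have "form R l g t 1 (\<Sum>i<k. b i * g i) (\<Sum>i<k. b i * t i)" if "k \<le> l" for k
    using that
  proof (induction k)
    case 0
    \<comment> \<open>The inductive definition has no rule for the zero form; 0 is written as 0
      times one of the \<open>g i\<close>, whence \<open>0 < l\<close>.\<close>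
    show ?case
      using * [OF assms(2) add_subgroup_0 [OF subring_subgroup [OF R]]] by simp
  next
    case (Suc k)
    then show ?case using * [of k] assms(3) by (simp add: form_add)
  qed
  then show ?thesis by simp
qed

lemma form_normal:
  assumes R: "subring R" and "form R l g t N y z"
  shows "\<exists>c. (\<forall>\<alpha>. c \<alpha> \<in> R) \<and> y = (\<Sum>\<alpha>\<in>mi l N. c \<alpha> * pw l g \<alpha>) \<and>
    z = (\<Sum>\<alpha>\<in>mi l N. c \<alpha> * pw l t \<alpha>)"
  using assms(2)
proof induction
  case (form_monomial c \<alpha> N)
  have "(\<Sum>\<beta>\<in>mi l N. (if \<beta> = \<alpha> then c else 0) * pw l h \<beta>) = c * pw l h \<alpha>" for h
    using form_monomial by (subst sum.remove [of _ \<alpha>]) (auto intro!: sum.neutral)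
  then show ?case
    using form_monomial add_subgroup_0 [OF subring_subgroup [OF R]]
    by (intro exI [of _ "\<lambda>\<beta>. if \<beta> = \<alpha> then c else 0"]) auto
next
  case (form_add N y z y' z')
  then obtain c c' where "\<forall>\<alpha>. c \<alpha> \<in> R" "y = (\<Sum>\<alpha>\<in>mi l N. c \<alpha> * pw l g \<alpha>)"
    "z = (\<Sum>\<alpha>\<in>mi l N. c \<alpha> * pw l t \<alpha>)" "\<forall>\<alpha>. c' \<alpha> \<in> R" "y' = (\<Sum>\<alpha>\<in>mi l N. c' \<alpha> * pw l g \<alpha>)"
    "z' = (\<Sum>\<alpha>\<in>mi l N. c' \<alpha> * pw l t \<alpha>)" by blast
  then show ?case
    using add_subgroup_add [OF subring_subgroup [OF R]]
    by (intro exI [of _ "\<lambda>\<alpha>. c \<alpha> + c' \<alpha>"]) (auto simp: distrib_right sum.distrib)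
qed

text \<open>The determinant trick, carried out by elimination so that no determinants are needed.\<close>

lemma form_elimination:
  fixes e :: "'w \<Rightarrow> 'b::comm_ring_1"
  assumes R: "subring R" and q: "is_ideal R q" "1 \<notin> q"
    and prime: "\<And>x y. x \<in> R \<Longrightarrow> y \<in> R \<Longrightarrow> x * y \<in> q \<Longrightarrow> x \<in> q \<or> y \<in> q"
    and "finite W"
    and "\<And>a b. form R l g t N (Y a b) (Z a b)" "\<And>a b. Z a b \<in> R"
    and "\<And>a. a \<in> W \<Longrightarrow> Z a a \<notin> q" "\<And>a b. a \<in> W \<Longrightarrow> b \<in> W \<Longrightarrow> a \<noteq> b \<Longrightarrow> Z a b \<in> q"
    and "\<And>a. a \<in> W \<Longrightarrow> (\<Sum>b\<in>W. Y a b * e b) = 0"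
  shows "\<exists>M y z. form R l g t M y z \<and> z \<in> R - q \<and> (\<forall>a\<in>W. y * e a = 0)"
  using assms(5-)
proof (induction W arbitrary: N Y Z rule: finite_induct)
  case empty
  have "form R l g t 0 (1 * pw l g (\<lambda>_. 0)) (1 * pw l t (\<lambda>_. 0))"
    by (rule form_monomial) (auto simp: subring_1 [OF R] mi_0)
  then have "form R l g t 0 1 1" by simp
  then show ?case using q subring_1 [OF R] by blast
next
  case (insert w W)
  note sq = is_ideal_subgroup [OF R q(1)] and sR = subring_subgroup [OF R]
  \<comment> \<open>One elimination step with pivot \<open>Y w w\<close>. Both products have degree
    \<open>N + N\<close>, so the entries remain forms of equal degree, and evaluation at
    \<open>t\<close> still gives diagonal entries outside \<open>q\<close> and all others
    inside.\<close>
  define Y' where "Y' = (\<lambda>a b. Y w w * Y a b + (- 1) * (Y a w * Y w b))"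
  define Z' where "Z' = (\<lambda>a b. Z w w * Z a b + (- 1) * (Z a w * Z w b))"
  have m1: "- 1 \<in> R" using add_subgroup_uminus [OF sR subring_1 [OF R]] .
  have "\<exists>M y z. form R l g t M y z \<and> z \<in> R - q \<and> (\<forall>a\<in>W. y * e a = 0)"
  proof (rule insert.IH [where N = "N + N" and Y = Y' and Z = Z'])
    show "form R l g t (N + N) (Y' a b) (Z' a b)" for a b
      unfolding Y'_def Z'_def
      by (intro form_add form_scale form_mult R m1 insert.prems)
    show ZR: "Z' a b \<in> R" for a b
      unfolding Z'_def
      by (intro add_subgroup_add [OF sR] subring_mult [OF R] m1 insert.prems)
    have aux: "(- 1) * (Z a w * Z w b) \<in> q" if "a \<in> W" for a b
    proof -
      have "Z a w \<in> q" using insert.prems(4) [of a w] insert.hyps that by blast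
      then have "Z w b * Z a w \<in> q" using is_ideal_mult [OF q(1)] insert.prems(2) by blast
      then show ?thesis using is_ideal_mult [OF q(1) m1] by (simp add: mult.commute)
    qed
    show "Z' a a \<notin> q" if "a \<in> W" for a
    proof
      assume "Z' a a \<in> q"
      then have "Z w w * Z a a \<in> q"
        using add_subgroup_diff [OF sq _ aux [OF that, of a]] by (force simp: Z'_def)
      then show False using prime insert.prems(2,3) that by blast
    qed
    show "Z' a b \<in> q" if "a \<in> W" "b \<in> W" "a \<noteq> b" for a b
      unfolding Z'_def
      using add_subgroup_add [OF sq is_ideal_mult [OF q(1) insert.prems(2) insert.prems(4)] aux]
        that by blast
    show "(\<Sum>b\<in>W. Y' a b * e b) = 0" if "a \<in> W" for a
    proof -
      have "(\<Sum>b\<in>W. Y a b * e b) = - (Y a w * e w)" "(\<Sum>b\<in>W. Y w b * e b) = - (Y w w * e w)"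
        using insert.prems(5) [of a] insert.prems(5) [of w] that insert.hyps
        by (simp_all add: add_eq_0_iff)
      then have "Y w w * (\<Sum>b\<in>W. Y a b * e b) - Y a w * (\<Sum>b\<in>W. Y w b * e b) = 0"
        by (simp add: mult_ac)
      then show ?thesis
        by (simp add: Y'_def algebra_simps sum_distrib_left sum_subtractf)
    qed
  qed
  then obtain M y z where yz: "form R l g t M y z" "z \<in> R" "z \<notin> q" "\<forall>a\<in>W. y * e a = 0" by blast
  \<comment> \<open>The extra factor \<open>Y w w\<close> is what row \<open>w\<close> offers: this
    row expresses \<open>Y w w * e w\<close> by the \<open>e b\<close> with \<open>b\<close> in
    \<open>W\<close>, which \<open>y\<close> already kills.\<close>
  have "form R l g t (M + N) (y * Y w w) (z * Z w w)"
    using form_mult [OF R yz(1)] insert.prems(1) by blast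
  moreover have "z * Z w w \<in> R" "z * Z w w \<notin> q"
    using subring_mult [OF R yz(2) insert.prems(2)] prime [OF yz(2) insert.prems(2)] yz(3)
      insert.prems(3) [of w] by auto
  moreover have "y * Y w w * e a = 0" if "a \<in> insert w W" for a
  proof (cases "a = w")
    case True
    have "Y w w * e w = - (\<Sum>b\<in>W. Y w b * e b)"
      using insert.prems(5) [of w] insert.hyps by (simp add: add_eq_0_iff2)
    then have "y * Y w w * e w = - (\<Sum>b\<in>W. Y w b * (y * e b))"
      by (simp add: mult.assoc sum_distrib_left) (simp add: mult_ac)
    then show ?thesis using yz(4) True by simp
  next
    case False
    then have "Y w w * (y * e a) = 0" using yz(4) that by simp
    then show ?thesis by (simp add: mult_ac)
  qed
  ultimately show ?case by blast
qed

text \<open>A nonzero polynomial over an infinite field is nonzero somewhere. Exponents are only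
  required to be separated by their first \<open>l\<close> values, because they will be extensional
  functions, which do not vanish beyond \<open>l\<close>.\<close>

lemma exists_nonvanishing_point:
  fixes c :: "(nat \<Rightarrow> nat) \<Rightarrow> 'a::field"
  assumes inf: "infinite (UNIV :: 'a set)" and "finite S"
    and "\<And>\<alpha> \<beta>. \<alpha> \<in> S \<Longrightarrow> \<beta> \<in> S \<Longrightarrow> (\<forall>i<l. \<alpha> i = \<beta> i) \<Longrightarrow> \<alpha> = \<beta>"
    and "\<exists>\<alpha>\<in>S. c \<alpha> \<noteq> 0"
  shows "\<exists>a. (\<Sum>\<alpha>\<in>S. c \<alpha> * pw l a \<alpha>) \<noteq> 0"
  using assms(2-)
proof (induction l arbitrary: S)
  case 0
  then obtain \<alpha> where "\<alpha> \<in> S" "c \<alpha> \<noteq> 0" by blast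
  then have "S = {\<alpha>}" using 0 by blast
  then show ?case using \<open>c \<alpha> \<noteq> 0\<close> by (simp add: pw_def)
next
  case (Suc l)
  then obtain \<alpha>0 where \<alpha>0: "\<alpha>0 \<in> S" "c \<alpha>0 \<noteq> 0" by blast
  \<comment> \<open>These terms make up one coefficient of the polynomial in the last
    variable.\<close>
  define S' where "S' = {\<alpha> \<in> S. \<alpha> l = \<alpha>0 l}"
  have "\<exists>a. (\<Sum>\<alpha>\<in>S'. c \<alpha> * pw l a \<alpha>) \<noteq> 0"
  proof (rule Suc.IH)
    show "finite S'" using Suc.prems by (simp add: S'_def)
    show "\<exists>\<alpha>\<in>S'. c \<alpha> \<noteq> 0" using \<alpha>0 by (auto simp: S'_def)
    show "\<alpha> = \<beta>" if "\<alpha> \<in> S'" "\<beta> \<in> S'" "\<forall>i<l. \<alpha> i = \<beta> i" for \<alpha> \<beta>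
      using that Suc.prems(2) [of \<alpha> \<beta>] by (auto simp: S'_def less_Suc_eq)
  qed
  then obtain a where a: "(\<Sum>\<alpha>\<in>S'. c \<alpha> * pw l a \<alpha>) \<noteq> 0" by blast
  define Q where "Q = (\<Sum>\<alpha>\<in>S. Polynomial.monom (c \<alpha> * pw l a \<alpha>) (\<alpha> l))"
  have "coeff Q (\<alpha>0 l) = (\<Sum>\<alpha>\<in>S. if \<alpha> \<in> S' then c \<alpha> * pw l a \<alpha> else 0)"
    unfolding Q_def coeff_sum coeff_monom by (rule sum.cong) (auto simp: S'_def)
  also have "\<dots> = (\<Sum>\<alpha>\<in>S'. c \<alpha> * pw l a \<alpha>)"
    using Suc.prems(1) by (subst sum.mono_neutral_cong_right [of S S']) (auto simp: S'_def)
  finally have "Q \<noteq> 0" using a by auto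
  then have "finite {z. poly Q z = 0}" by (rule poly_roots_finite)
  then obtain z where z: "poly Q z \<noteq> 0" using inf by (metis (mono_tags) UNIV_eq_I mem_Collect_eq)
  have "(\<Sum>\<alpha>\<in>S. c \<alpha> * pw (Suc l) (a(l := z)) \<alpha>) = poly Q z"
    by (auto simp: Q_def poly_sum poly_monom pw_def lessThan_Suc mult_ac intro!: sum.cong)
  then show ?case using z by metis
qed

subsection \<open>Monomials as products of pairs of variables\<close>

lemma exists_greatest:
  fixes f :: "'x \<Rightarrow> nat"
  assumes "P k" "\<And>y. P y \<Longrightarrow> f y \<le> b"
  obtains x where "P x" "\<And>y. P y \<Longrightarrow> f y \<le> f x"
  using ex_has_greatest_nat [of P k f "Suc b"] assms by (auto simp: less_Suc_eq_le)

definition wsum :: "(nat \<Rightarrow> nat) \<Rightarrow> (nat \<Rightarrow>\<^sub>0 nat) \<Rightarrow> nat" where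
  "wsum f t = (\<Sum>i\<in>keys t. f i * lookup t i)"

lemma wsum_add: "wsum f (s + t) = wsum f s + wsum f t"
  unfolding wsum_def by (rule setsum_keys_plus_distrib) (simp_all add: distrib_left)

lemma wsum_0 [simp]: "wsum f 0 = 0"
  by (simp add: wsum_def)

lemma wsum_single [simp]: "wsum f (single i k) = f i * k"
  by (simp add: wsum_def)

lemma wsum_sum: "wsum f (\<Sum>i\<in>I. t i) = (\<Sum>i\<in>I. wsum f (t i))"
  by (induction I rule: infinite_finite_induct) (simp_all add: wsum_add)

abbreviation tdeg :: "(nat \<Rightarrow>\<^sub>0 nat) \<Rightarrow> nat" where
  "tdeg \<equiv> wsum (\<lambda>_. Suc 0)"

definition pm :: "nat \<times> nat \<Rightarrow> (nat \<Rightarrow>\<^sub>0 nat)" where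
  "pm v = single (fst v) 1 + single (snd v) 1"

definition msum :: "(nat \<times> nat) multiset \<Rightarrow> (nat \<Rightarrow>\<^sub>0 nat)" where
  "msum X = (\<Sum>v\<in>#X. pm v)"

lemma msum_simps [simp]: "msum {#} = 0" "msum (add_mset v X) = pm v + msum X"
  "msum (X + Y) = msum X + msum Y"
  by (simp_all add: msum_def)

lemma wsum_pm: "wsum f (pm v) = f (fst v) + f (snd v)"
  by (simp add: pm_def wsum_add)

lemma tdeg_msum [simp]: "tdeg (msum X) = 2 * size X"
  by (induction X) (simp_all add: wsum_add wsum_pm)

lemma keys_add_nat: "keys (s + t :: nat \<Rightarrow>\<^sub>0 nat) = keys s \<union> keys t"
  by (auto simp: in_keys_iff lookup_add)

lemma keys_pm: "keys (pm v) = {fst v, snd v}"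
  by (auto simp: pm_def keys_add_nat)

lemma keys_msum: "keys (msum X) = (\<Union>v\<in>set_mset X. {fst v, snd v})"
  by (induction X) (auto simp: keys_add_nat keys_pm)

text \<open>The straightening potential: the squared length grows in total when two pairs are
  nested, and it is constant along diagonals.\<close>

definition Q1 :: "nat \<times> nat \<Rightarrow> nat" where
  "Q1 v = (snd v - fst v)\<^sup>2"

definition Q :: "(nat \<times> nat) multiset \<Rightarrow> nat" where
  "Q X = (\<Sum>v\<in>#X. Q1 v)"

lemma Q_simps [simp]: "Q {#} = 0" "Q (add_mset v X) = Q1 v + Q X" "Q (X + Y) = Q X + Q Y"
  by (simp_all add: Q_def)

definition outer :: "nat \<times> nat \<Rightarrow> nat \<times> nat \<Rightarrow> bool" where
  "outer u v \<longleftrightarrow> fst u \<le> fst v \<and> snd v \<le> snd u"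

definition souter :: "nat \<times> nat \<Rightarrow> nat \<times> nat \<Rightarrow> bool" where
  "souter u v \<longleftrightarrow> fst u < fst v \<and> snd v < snd u"

definition chain :: "(nat \<times> nat) set \<Rightarrow> bool" where
  "chain X \<longleftrightarrow> (\<forall>u\<in>X. \<forall>v\<in>X. outer u v \<or> outer v u)"

lemma chain_subset: "chain X \<Longrightarrow> Y \<subseteq> X \<Longrightarrow> chain Y"
  by (auto simp: chain_def)

text \<open>A longest pair is outermost: a pair around it is no longer than it, hence equal to
  it.\<close>

lemma chain_top:
  assumes "chain (set_mset X)" "X \<noteq> {#}" "\<And>v. v \<in># X \<Longrightarrow> fst v \<le> snd v"
  obtains v where "v \<in># X" "\<And>u. u \<in># X \<Longrightarrow> outer v u"
proof -
  define D where "D = (\<lambda>v :: nat \<times> nat. snd v - fst v)"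
  obtain v where v: "v \<in># X" "\<And>u. u \<in># X \<Longrightarrow> D u \<le> D v"
  proof -
    have "Max (D ` set_mset X) \<in> D ` set_mset X" using assms(2) by (intro Max_in) auto
    then obtain v where "v \<in># X" "D v = Max (D ` set_mset X)" by auto
    then show thesis by (intro that [of v]) auto
  qed
  have "outer v u" if "u \<in># X" for u
  proof (cases "outer v u")
    case False
    then have "outer u v" using assms(1) v that by (auto simp: chain_def)
    then show ?thesis
      using v(2) [OF that] assms(3) [OF that] assms(3) [OF v(1)]
      by (auto simp: outer_def D_def)
  qed simp
  then show thesis using that v by blast
qed

text \<open>The outermost pair of a chain consists of the smallest and the largest index in the
  monomial, so it is determined by the product; remove it and induct.\<close>

lemma chain_representation_unique:
  assumes "chain (set_mset X)" "chain (set_mset Y)" "msum X = msum Y"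
    and "\<And>v. v \<in># X \<Longrightarrow> fst v \<le> snd v" "\<And>v. v \<in># Y \<Longrightarrow> fst v \<le> snd v"
  shows "X = Y"
  using assms
proof (induction "size X" arbitrary: X Y)
  case 0
  then have "tdeg (msum Y) = 0" by (metis tdeg_msum mult_0_right)
  then show ?case using 0 by simp
next
  case (Suc k)
  have sz: "size X = size Y"
    using arg_cong [OF Suc.prems(3), of tdeg] unfolding tdeg_msum by simp
  then have ne: "X \<noteq> {#}" "Y \<noteq> {#}" using Suc by auto
  obtain v where v: "v \<in># X" "\<And>u. u \<in># X \<Longrightarrow> outer v u"
    using chain_top [OF Suc.prems(1) ne(1) Suc.prems(4)] by blast
  obtain w where w: "w \<in># Y" "\<And>u. u \<in># Y \<Longrightarrow> outer w u"
    using chain_top [OF Suc.prems(2) ne(2) Suc.prems(5)] by blast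
  have bd: "fst v \<le> x \<and> x \<le> snd v"
    if "\<And>u. u \<in># X \<Longrightarrow> outer v u" "\<And>u. u \<in># X \<Longrightarrow> fst u \<le> snd u" "x \<in> keys (msum X)" for v x X
    using that unfolding keys_msum outer_def by fastforce
  have "fst v \<in> keys (msum Y)" "snd v \<in> keys (msum Y)"
    using v(1) Suc.prems(3) [symmetric] by (auto simp: keys_msum)
  moreover have "fst w \<in> keys (msum X)" "snd w \<in> keys (msum X)"
    using w(1) Suc.prems(3) by (auto simp: keys_msum)
  ultimately have "v = w"
    using bd [OF v(2) Suc.prems(4)] bd [OF w(2) Suc.prems(5)]
    by (metis le_antisym prod.expand)
  obtain X' Y' where XY: "X = add_mset v X'" "Y = add_mset v Y'"
    using v(1) w(1) \<open>v = w\<close> by (metis mset_add)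
  have "X' = Y'"
  proof (rule Suc.hyps(1))
    show "k = size X'" using Suc.hyps(2) XY by simp
    show "chain (set_mset X')" "chain (set_mset Y')"
      using Suc.prems(1,2) XY by (auto intro: chain_subset)
    show "msum X' = msum Y'" using Suc.prems(3) XY by simp
    show "fst v \<le> snd v" if "v \<in># X'" for v using Suc.prems(4) XY that by simp
    show "fst v \<le> snd v" if "v \<in># Y'" for v using Suc.prems(5) XY that by simp
  qed
  then show ?case using XY by simp
qed

subsection \<open>Shifted Ferrers shapes\<close>

locale spec_ferrers =
  fixes n m :: nat and lam :: "nat \<Rightarrow> nat"
  assumes n_pos: "1 \<le> n"
    and lam_mono: "\<And>i j. 1 \<le> i \<Longrightarrow> i \<le> j \<Longrightarrow> j \<le> n \<Longrightarrow> lam j \<le> lam i"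
    and lam_1: "lam 1 = m"
    and lam_n: "n \<le> lam n"
begin

definition shape :: "(nat \<times> nat) set" where
  "shape = {v. 1 \<le> fst v \<and> fst v \<le> n \<and> fst v \<le> snd v \<and> snd v \<le> lam (fst v)}"

lemma lam_le_m: "1 \<le> i \<Longrightarrow> i \<le> n \<Longrightarrow> lam i \<le> m"
  using lam_mono [of 1 i] lam_1 by simp

lemma n_le_lam: "1 \<le> i \<Longrightarrow> i \<le> n \<Longrightarrow> n \<le> lam i"
  using lam_mono [of i n] lam_n by simp

lemma n_le_m: "n \<le> m"
  using n_le_lam [of 1] lam_1 n_pos by simp

lemma shape_bounds: "v \<in> shape \<Longrightarrow> 1 \<le> fst v \<and> fst v \<le> snd v \<and> snd v \<le> m"
  using lam_le_m [of "fst v"] by (auto simp: shape_def)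

lemma finite_shape [simp]: "finite shape"
proof (rule finite_subset)
  show "shape \<subseteq> {0..m} \<times> {0..m}" using shape_bounds by (force simp: subset_iff)
qed simp

lemma shape_up: "(k, l) \<in> shape \<Longrightarrow> 1 \<le> i \<Longrightarrow> i \<le> k \<Longrightarrow> i \<le> j \<Longrightarrow> j \<le> l \<Longrightarrow> (i, j) \<in> shape"
  using lam_mono [of i k] by (auto simp: shape_def)

text \<open>Of two incomparable pairs with \<open>i < k\<close> and \<open>j < l\<close>, the outer
  indices form \<open>(i, l)\<close>, and \<open>k\<close>, \<open>j\<close> form the inner pair in
  increasing order. Both stay in the shape because \<open>(k, l)\<close> is in it and earlier rows
  reach at least as far.\<close>

lemma straighten:
  assumes "u \<in> shape" "v \<in> shape" "\<not> outer u v" "\<not> outer v u"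
  shows "\<exists>u'\<in>shape. \<exists>v'\<in>shape. pm u' + pm v' = pm u + pm v \<and> Q1 u + Q1 v < Q1 u' + Q1 v'"
proof -
  have main: "\<exists>u'\<in>shape. \<exists>v'\<in>shape. pm u' + pm v' = pm (i, j) + pm (k, l) \<and>
      Q1 (i, j) + Q1 (k, l) < Q1 u' + Q1 v'"
    if sh: "(i, j) \<in> shape" "(k, l) \<in> shape" and lt: "i < k" "j < l" for i j k l
  proof (cases "k \<le> j")
    case True
    obtain a b c where abc: "k = i + a" "j = k + b" "l = j + c"
      using lt True by (metis le_iff_add less_imp_le)
    have pos: "a > 0" "c > 0" using lt abc by auto
    have "(i, l) \<in> shape" using shape_up [OF sh(2), of i l] sh lt by (auto simp: shape_def)
    moreover have "(k, j) \<in> shape" using shape_up [OF sh(2), of k j] sh lt True by (auto simp: shape_def)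
    moreover have "pm (i, l) + pm (k, j) = pm (i, j) + pm (k, l)" by (simp add: pm_def add_ac)
    moreover have "Q1 (i, j) + Q1 (k, l) < Q1 (i, l) + Q1 (k, j)"
      using pos by (simp add: Q1_def abc power2_eq_square algebra_simps)
    ultimately show ?thesis by blast
  next
    case False
    obtain a b c where abc: "j = i + a" "k = j + b" "l = k + c"
      using sh False unfolding shape_def by (auto simp: le_iff_add dest: less_imp_le)
        (metis le_iff_add less_imp_le not_le)
    have pos: "b > 0" using False abc by auto
    have "(i, l) \<in> shape" using shape_up [OF sh(2), of i l] sh lt by (auto simp: shape_def)
    moreover have "(j, k) \<in> shape"
      using shape_up [OF sh(2), of j k] sh False by (auto simp: shape_def)
    moreover have "pm (i, l) + pm (j, k) = pm (i, j) + pm (k, l)" by (simp add: pm_def add_ac)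
    moreover have "Q1 (i, j) + Q1 (k, l) < Q1 (i, l) + Q1 (j, k)"
      using pos by (simp add: Q1_def abc power2_eq_square algebra_simps)
    ultimately show ?thesis by blast
  qed
  obtain i j k l where uv: "u = (i, j)" "v = (k, l)" by fastforce
  consider "i < k" "j < l" | "k < i" "l < j" using assms uv by (force simp: outer_def)
  then show ?thesis
  proof cases
    case 1
    then show ?thesis using main [of i j k l] assms uv by simp
  next
    case 2
    then show ?thesis using main [of k l i j] assms uv by (simp add: add.commute)
  qed
qed

section \<open>Monomials of the fiber ring and their representations of maximal potential\<close>

definition Mon :: "nat \<Rightarrow> (nat \<Rightarrow>\<^sub>0 nat) set" where
  "Mon s = {msum X | X. size X = s \<and> set_mset X \<subseteq> shape}"

lemma MonI: "size X = s \<Longrightarrow> set_mset X \<subseteq> shape \<Longrightarrow> msum X \<in> Mon s"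
  by (auto simp: Mon_def)

lemma Mon_0 [simp]: "Mon 0 = {0}"
  by (auto simp: Mon_def)

lemma Mon_Suc: "Mon (Suc s) = (\<lambda>(v, t). pm v + t) ` (shape \<times> Mon s)"
proof (intro equalityI subsetI)
  fix t assume "t \<in> Mon (Suc s)"
  then obtain X where X: "t = msum X" "size X = Suc s" "set_mset X \<subseteq> shape" by (auto simp: Mon_def)
  then obtain v Y where "X = add_mset v Y" by (metis size_eq_Suc_imp_eq_union)
  then show "t \<in> (\<lambda>(v, t). pm v + t) ` (shape \<times> Mon s)"
    using X by (auto intro!: rev_image_eqI [of "(v, msum Y)"] MonI)
next
  fix t assume "t \<in> (\<lambda>(v, t). pm v + t) ` (shape \<times> Mon s)"
  then obtain v X where "v \<in> shape" "size X = s" "set_mset X \<subseteq> shape" "t = pm v + msum X"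
    by (auto simp: Mon_def)
  then show "t \<in> Mon (Suc s)" using MonI [of "add_mset v X" "Suc s"] by simp
qed

lemma Mon_SucE:
  assumes "u \<in> Mon (Suc s)"
  obtains v t where "v \<in> shape" "t \<in> Mon s" "u = pm v + t"
  using assms unfolding Mon_Suc by auto

lemma Mon_SucI: "v \<in> shape \<Longrightarrow> t \<in> Mon s \<Longrightarrow> pm v + t \<in> Mon (Suc s)"
  unfolding Mon_Suc by auto

lemma Mon_add: "s \<in> Mon k \<Longrightarrow> t \<in> Mon l \<Longrightarrow> s + t \<in> Mon (k + l)"
proof -
  assume "s \<in> Mon k" "t \<in> Mon l"
  then obtain X Y where "s = msum X" "size X = k" "set_mset X \<subseteq> shape"
    "t = msum Y" "size Y = l" "set_mset Y \<subseteq> shape" by (auto simp: Mon_def)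
  then show ?thesis using MonI [of "X + Y" "k + l"] by simp
qed

lemma pm_in_Mon: "v \<in> shape \<Longrightarrow> pm v \<in> Mon (Suc 0)"
  using MonI [of "{#v#}" "Suc 0"] by simp

lemma finite_Mon [simp]: "finite (Mon s)"
  by (induction s) (simp_all add: Mon_Suc)

lemma Mon_tdeg: "t \<in> Mon s \<Longrightarrow> tdeg t = 2 * s"
  by (auto simp: Mon_def)

lemma Mon_keys: "t \<in> Mon s \<Longrightarrow> keys t \<subseteq> {1..m}"
proof -
  assume "t \<in> Mon s"
  then obtain X where "t = msum X" "set_mset X \<subseteq> shape" by (auto simp: Mon_def)
  then show ?thesis using shape_bounds by (fastforce simp: keys_msum)
qed

text \<open>Maximality of \<open>Q\<close> replaces a rewriting process: such a representation
  cannot be straightened further, hence is a chain.\<close>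

definition opt :: "(nat \<times> nat) multiset \<Rightarrow> bool" where
  "opt X \<longleftrightarrow> set_mset X \<subseteq> shape \<and>
    (\<forall>Y. set_mset Y \<subseteq> shape \<longrightarrow> msum Y = msum X \<longrightarrow> Q Y \<le> Q X)"

lemma optD: "opt X \<Longrightarrow> set_mset Y \<subseteq> shape \<Longrightarrow> msum Y = msum X \<Longrightarrow> Q Y \<le> Q X"
  by (simp add: opt_def)

lemma Q_bound: "set_mset X \<subseteq> shape \<Longrightarrow> Q X \<le> size X * m\<^sup>2"
proof (induction X)
  case (add v X)
  then have "snd v \<le> m" using shape_bounds by auto
  then have "Q1 v \<le> m\<^sup>2" by (auto simp: Q1_def intro!: power_mono)
  then show ?case using add by simp
qed simp

lemma exists_opt:
  assumes "set_mset X \<subseteq> shape"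
  obtains Y where "opt Y" "msum Y = msum X" "size Y = size X"
proof -
  define P where "P = (\<lambda>Y. set_mset Y \<subseteq> shape \<and> msum Y = msum X)"
  have sz: "size Y = size X" if "P Y" for Y
    using that arg_cong [of "msum Y" "msum X" tdeg] unfolding P_def tdeg_msum by simp
  have bd: "Q Y \<le> size X * m\<^sup>2" if "P Y" for Y using that sz Q_bound by (metis P_def)
  have "P X" using assms by (simp add: P_def)
  then obtain Y where Y: "P Y" "\<And>Z. P Z \<Longrightarrow> Q Z \<le> Q Y"
    using exists_greatest [where P = P and f = Q, OF _ bd] by blast
  show thesis using that [of Y] Y sz by (auto simp: opt_def P_def)
qed

lemma opt_chain:
  assumes "opt X"
  shows "chain (set_mset X)"
proof (rule ccontr)
  assume "\<not> ?thesis"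
  then obtain u v where uv: "u \<in># X" "v \<in># X" "\<not> outer u v" "\<not> outer v u"
    by (auto simp: chain_def)
  then have "u \<noteq> v" by (auto simp: outer_def)
  then obtain Z where Z: "X = add_mset u (add_mset v Z)"
    using uv by (metis insert_noteq_member mset_add)
  have sh: "u \<in> shape" "v \<in> shape" "set_mset Z \<subseteq> shape" using assms Z by (auto simp: opt_def)
  obtain u' v' where *: "u' \<in> shape" "v' \<in> shape" "pm u' + pm v' = pm u + pm v"
    "Q1 u + Q1 v < Q1 u' + Q1 v'"
    using straighten [OF sh(1,2) uv(3,4)] by blast
  have "Q (add_mset u' (add_mset v' Z)) \<le> Q X"
    by (rule optD [OF assms]) (use sh * Z in \<open>auto simp: add.assoc [symmetric]\<close>)
  then show False using * Z by simp
qed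

section \<open>Basic chains and generation by the diagonal sums\<close>

definition basic :: "(nat \<times> nat) set \<Rightarrow> bool" where
  "basic b \<longleftrightarrow> b \<subseteq> shape \<and> (\<forall>v\<in>b. 2 \<le> fst v) \<and> (\<forall>u\<in>b. \<forall>v\<in>b. u \<noteq> v \<longrightarrow> souter u v \<or> souter v u)"

lemma basic_chain: "basic b \<Longrightarrow> chain b"
  unfolding basic_def chain_def souter_def outer_def by (metis less_imp_le order_refl)

lemma basic_finite: "basic b \<Longrightarrow> finite b"
  using finite_subset [OF _ finite_shape] by (simp add: basic_def)

definition bmon :: "(nat \<times> nat) set \<Rightarrow> (nat \<Rightarrow>\<^sub>0 nat)" where
  "bmon b = msum (mset_set b)"

lemma bmon_in_Mon: "basic b \<Longrightarrow> bmon b \<in> Mon (card b)"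
  unfolding bmon_def by (rule MonI) (auto simp: basic_finite, auto simp: basic_def)

text \<open>A chain that is not basic contains a pair which can be moved along its diagonal, inside
  the chain, in one direction only.\<close>

lemma not_basic:
  assumes X: "set_mset X \<subseteq> shape" "chain (set_mset X)" and nb: "\<And>b. basic b \<Longrightarrow> X \<noteq> mset_set b"
  obtains v X' where "X = add_mset v X'"
    "fst v = 1 \<or> (\<exists>u\<in>#X'. fst u = fst v \<and> snd v \<le> snd u \<or> snd u = snd v \<and> fst v \<le> fst u)"
proof (cases "\<exists>v\<in>#X. fst v = 1 \<or> (\<exists>u\<in>#X - {#v#}. fst u = fst v \<and> snd v \<le> snd u \<or>
    snd u = snd v \<and> fst v \<le> fst u)")
  case True
  then obtain v where "v \<in># X" "fst v = 1 \<or> (\<exists>u\<in>#X - {#v#}. fst u = fst v \<and> snd v \<le> snd u \<or>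
    snd u = snd v \<and> fst v \<le> fst u)" by blast
  then show thesis by (intro that [of v "X - {#v#}"]) auto
next
  case False
  have count: "count X v \<le> 1" for v
  proof (rule ccontr)
    assume c: "\<not> count X v \<le> 1"
    then have "v \<in># X - {#v#}" "v \<in># X" by (auto simp: in_diff_count count_inI intro: count_inI)
    then show False using False by blast
  qed
  have "basic (set_mset X)"
    unfolding basic_def
  proof (intro conjI ballI impI)
    show "set_mset X \<subseteq> shape" by fact
    show "2 \<le> fst v" if "v \<in># X" for v
    proof -
      have "fst v \<noteq> 1" "1 \<le> fst v" using False that X(1) shape_bounds [of v] by auto
      then show ?thesis by simp
    qed
    fix u v assume uv: "u \<in># X" "v \<in># X" "u \<noteq> v"
    then have mem: "u \<in># X - {#v#}" "v \<in># X - {#u#}" by (simp_all add: in_diff_count)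
    have F: "\<not> (fst u = fst v \<and> snd v \<le> snd u) \<and> \<not> (snd u = snd v \<and> fst v \<le> fst u)"
      if "v \<in># X" "u \<in># X - {#v#}" for u v
      using False that by blast
    have "\<not> (fst u = fst v \<and> snd v \<le> snd u)" "\<not> (snd u = snd v \<and> fst v \<le> fst u)"
      "\<not> (fst v = fst u \<and> snd u \<le> snd v)" "\<not> (snd v = snd u \<and> fst u \<le> fst v)"
      using F [OF uv(2) mem(1)] F [OF uv(1) mem(2)] by blast+
    moreover have "outer u v \<or> outer v u" using X(2) uv by (auto simp: chain_def)
    ultimately show "souter u v \<or> souter v u" unfolding outer_def souter_def by linarith
  qed
  moreover have "X = mset_set (set_mset X)"
  proof (rule multiset_eqI)
    fix v show "count X v = count (mset_set (set_mset X)) v"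
      using count [of v] by (cases "v \<in># X") (auto simp: count_mset_set' not_in_iff
          simp flip: count_greater_zero_iff)
  qed
  ultimately show thesis using nb by blast
qed

definition diag :: "nat \<Rightarrow> (nat \<times> nat) set" where
  "diag d = {v \<in> shape. snd v = fst v + d}"

lemma diagI: "v \<in> shape \<Longrightarrow> v \<in> diag (snd v - fst v)"
  using shape_bounds [of v] by (simp add: diag_def)

lemma shape_diff_less: "v \<in> shape \<Longrightarrow> snd v - fst v < m"
  using shape_bounds [of v] by auto

lemma finite_diag [simp]: "finite (diag d)"
  by (simp add: diag_def)

definition theta :: "nat \<Rightarrow> 'a::comm_ring_1 mpoly" where
  "theta d = (\<Sum>v\<in>diag d. xpow (pm v))"

text \<open>Solve \<open>theta d * xpow (msum X')\<close> for the summand belonging to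
  \<open>v\<close>, where \<open>X\<close> is a counterexample with \<open>K\<close> maximal.
  Another point \<open>v'\<close> of the diagonal gives the same \<open>Q\<close>, so its monomial
  either has a better representation, or the new multiset is again a chain and \<open>v'\<close>
  lies in a later row, which raises the index sum. Both exceed the maximum, so the other summands
  lie in \<open>U\<close>.\<close>

lemma theta_step:
  fixes U :: "'a::comm_ring_1 mpoly set"
  assumes U: "add_subgroup U"
    and theta: "\<And>d t. d < m \<Longrightarrow> t \<in> Mon s \<Longrightarrow> theta d * xpow t \<in> U"
    and basic: "\<And>b. basic b \<Longrightarrow> card b = Suc s \<Longrightarrow> xpow (bmon b) \<in> U"
    and t: "t \<in> Mon (Suc s)"
  shows "xpow t \<in> U"
proof (rule ccontr)
  assume tU: "xpow t \<notin> U"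
  define w where "w = wsum (\<lambda>i. i)"
  \<comment> \<open>\<open>C\<close> exceeds every index sum that occurs, so \<open>K\<close>
    compares by \<open>Q\<close> first and by \<open>w\<close> second.\<close>
  define C where "C = 2 * m * Suc s + 1"
  define K where "K = (\<lambda>X. Q X * C + w (msum X))"
  define P where "P = (\<lambda>X. opt X \<and> size X = Suc s \<and> xpow (msum X) \<notin> U)"
  have w_bound: "w (msum X) \<le> 2 * m * size X" if "set_mset X \<subseteq> shape" for X
    using that
  proof (induction X)
    case (add v X)
    then show ?case using shape_bounds [of v] by (simp add: w_def wsum_add wsum_pm)
  qed (simp add: w_def)
  have K_bound: "K X \<le> (Suc s * m\<^sup>2) * C + 2 * m * Suc s" if "P X" for X
    unfolding K_def
    using that Q_bound [of X] w_bound [of X] by (intro add_mono mult_right_mono) (auto simp: P_def opt_def)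
  obtain X0 where "size X0 = Suc s" "set_mset X0 \<subseteq> shape" "t = msum X0"
    using t by (auto simp: Mon_def)
  then obtain X1 where "P X1" using exists_opt [of X0] tU by (metis P_def)
  then obtain X where X: "P X" and max: "\<And>Y. P Y \<Longrightarrow> K Y \<le> K X"
    using exists_greatest [where P = P and f = K, OF _ K_bound] by blast
  have Xopt: "opt X" and Xs: "size X = Suc s" and XU: "xpow (msum X) \<notin> U"
    and Xsh: "set_mset X \<subseteq> shape" using X by (auto simp: P_def opt_def)
  have nb: "X \<noteq> mset_set b" if "basic b" for b
    using that basic [of b] Xs XU by (auto simp: bmon_def)
  obtain v X' where v: "X = add_mset v X'"
    and mv: "fst v = 1 \<or> (\<exists>u\<in>#X'. fst u = fst v \<and> snd v \<le> snd u \<or> snd u = snd v \<and> fst v \<le> fst u)"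
    using not_basic [OF Xsh opt_chain [OF Xopt] nb] .
  have vsh: "v \<in> shape" and X'sh: "set_mset X' \<subseteq> shape" using Xsh v by auto
  define d where "d = snd v - fst v"
  have vd: "v \<in> diag d" "d < m" using diagI [OF vsh] shape_diff_less [OF vsh] by (simp_all add: d_def)
  have other: "xpow (pm v' + msum X') \<in> U" if v': "v' \<in> diag d" "v' \<noteq> v" for v'
  proof (rule ccontr)
    assume nU: "xpow (pm v' + msum X') \<notin> U"
    have v'sh: "v' \<in> shape" and v'd: "snd v' = fst v' + d" "snd v = fst v + d"
      using v' vd by (auto simp: diag_def)
    then have Q1: "Q1 v' = Q1 v" by (simp add: Q1_def)
    have sh: "set_mset (add_mset v' X') \<subseteq> shape" using v'sh X'sh by simp
    obtain Y where Y: "opt Y" "msum Y = msum (add_mset v' X')" "size Y = size (add_mset v' X')"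
      using exists_opt [OF sh] .
    then have "P Y" using nU Xs v by (simp add: P_def)
    then have KY: "K Y \<le> K X" by (rule max)
    have "Q (add_mset v' X') \<le> Q Y" using optD [OF Y(1) sh] Y(2) by simp
    then have QY: "Q X \<le> Q Y" using Q1 v by simp
    have "w (msum X) < C" using w_bound [OF Xsh] Xs by (simp add: C_def)
    then have "Q Y * C < Q X * C + C" using KY by (simp add: K_def)
    then have "Q Y * C < (Q X + 1) * C" by (simp add: algebra_simps)
    then have "Q Y < Q X + 1" using mult_less_cancel2 by blast
    then have eq: "Q Y = Q X" using QY by simp
    have "opt (add_mset v' X')"
      unfolding opt_def using sh optD [OF Y(1)] Y(2) eq Q1 v by auto
    then have ch: "chain (set_mset (add_mset v' X'))" by (rule opt_chain)
    \<comment> \<open>An earlier row is excluded: either \<open>v\<close> is already in row 1, or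
      the pair \<open>u\<close> sharing its row or column would no longer be nested with
      \<open>v'\<close>.\<close>
    have "fst v < fst v'"
    proof (rule ccontr)
      assume "\<not> fst v < fst v'"
      moreover have "fst v' \<noteq> fst v" using v' v'd by (metis prod.expand)
      ultimately have lt: "fst v' < fst v" by simp
      then have "fst v \<noteq> 1" using shape_bounds [OF v'sh] by simp
      then obtain u where u: "u \<in># X'" "fst u = fst v \<and> snd v \<le> snd u \<or> snd u = snd v \<and> fst v \<le> fst u"
        using mv by blast
      then have "outer u v' \<or> outer v' u" using ch by (auto simp: chain_def)
      then show False using u lt v'd by (auto simp: outer_def)
    qed
    then have "w (msum X) < w (msum Y)"
      using Y(2) v v'd by (simp add: w_def wsum_add wsum_pm)
    then show False using KY eq by (simp add: K_def)
  qed
  have X'Mon: "msum X' \<in> Mon s" using MonI [OF _ X'sh] Xs v by simp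
  have "theta d * xpow (msum X') = (\<Sum>v'\<in>diag d. xpow (pm v' + msum X'))"
    by (simp add: theta_def sum_distrib_right xpow_add)
  also have "\<dots> = xpow (msum X) + (\<Sum>v'\<in>diag d - {v}. xpow (pm v' + msum X'))"
    using vd v by (simp add: sum.remove)
  finally have "xpow (msum X) = theta d * xpow (msum X') - (\<Sum>v'\<in>diag d - {v}. xpow (pm v' + msum X'))"
    by (metis add_diff_cancel_right')
  also have "\<dots> \<in> U"
    using theta [OF vd(2) X'Mon] other by (intro add_subgroup_diff [OF U] add_subgroup_sum [OF U]) auto
  finally show False using XU by simp
qed

text \<open>Index set for the products theta^e b of degree \<open>s\<close>; the bound on
  \<open>card b\<close> is needed because \<open>s - card b\<close> is truncated.\<close>

definition IX :: "nat \<Rightarrow> ((nat \<times> nat) set \<times> (nat \<Rightarrow> nat)) set" where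
  "IX s = {(b, e). basic b \<and> card b \<le> s \<and> e \<in> mi m (s - card b)}"

lemma finite_IX [simp]: "finite (IX s)"
proof (rule finite_subset)
  show "IX s \<subseteq> Pow shape \<times> (\<Union>k\<le>s. mi m k)"
    by (auto simp: IX_def basic_def intro!: bexI [of _ "s - card _"])
qed simp

lemma theta_span:
  fixes U :: "'a::comm_ring_1 mpoly set"
  assumes "add_subgroup U"
    and "\<And>b e. (b, e) \<in> IX s \<Longrightarrow> pw m theta e * xpow (bmon b) \<in> U"
    and "t \<in> Mon s"
  shows "xpow t \<in> U"
  using assms
proof (induction s arbitrary: U t)
  case 0
  have "basic {}" by (simp add: basic_def)
  then have "pw m theta (\<lambda>_. 0) * xpow (bmon {}) \<in> U"
    by (intro 0) (simp add: IX_def mi_0)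
  then show ?case using 0 by (simp add: bmon_def)
next
  case (Suc s)
  show ?case
  proof (rule theta_step [OF Suc.prems(1) _ _ Suc.prems(3)])
    fix b assume b: "basic b" "card b = Suc s"
    then have "pw m theta (\<lambda>_. 0) * xpow (bmon b) \<in> U"
      by (intro Suc.prems) (simp add: IX_def mi_0)
    then show "xpow (bmon b) \<in> U" by simp
  next
    fix d t' assume d: "d < m" and t': "t' \<in> Mon s"
    \<comment> \<open>Dividing \<open>U\<close> by \<open>theta d\<close> lets the induction
      hypothesis absorb this factor into the exponent.\<close>
    define U' where "U' = {p. theta d * p \<in> U}"
    have "xpow t' \<in> U'"
    proof (rule Suc.IH [OF _ _ t'])
      show "add_subgroup U'"
        using Suc.prems(1) by (auto simp: U'_def add_subgroup_def right_diff_distrib)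
      fix b e assume be: "(b, e) \<in> IX s"
      then have "(b, \<lambda>j. (if j = d then 1 else 0) + e j) \<in> IX (Suc s)"
        using mi_add [OF mi_unit [OF d], of e "s - card b"] by (auto simp: IX_def Suc_diff_le)
      from Suc.prems(2) [OF this] show "pw m theta e * xpow (bmon b) \<in> U'"
        by (simp add: U'_def pw_add pw_unit [OF d] mult.assoc)
    qed
    then show "theta d * xpow t' \<in> U" by (simp add: U'_def)
  qed
qed

end

subsection \<open>Counting monomials along diagonals\<close>

context spec_ferrers
begin

text \<open>Among the maximal chains through \<open>b\<close> there is one meeting every diagonal in the
  smallest possible row; \<open>pt b d\<close> is its point on the diagonal \<open>d\<close>.\<close>

definition row :: "(nat \<times> nat) set \<Rightarrow> nat \<Rightarrow> nat" where
  "row b d = Max (insert 1 ((\<lambda>v. if snd v - fst v < d then snd v - d else fst v) ` b))"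

definition pt :: "(nat \<times> nat) set \<Rightarrow> nat \<Rightarrow> nat \<times> nat" where
  "pt b d = (row b d, row b d + d)"

text \<open>The meaning of the bounds: the path point on diagonal \<open>d\<close> must enclose
  every \<open>v\<close> of smaller difference, so its column is at least \<open>snd v\<close>;
  every other \<open>v\<close> must enclose it, so its row is at least \<open>fst v\<close>.\<close>

lemma row_le_iff:
  "finite b \<Longrightarrow> row b d \<le> x \<longleftrightarrow>
    1 \<le> x \<and> (\<forall>v\<in>b. (if snd v - fst v < d then snd v - d else fst v) \<le> x)"
  unfolding row_def by (subst Max_le_iff) auto

lemma row_less_iff:
  "finite b \<Longrightarrow> row b d < x \<longleftrightarrow>
    1 < x \<and> (\<forall>v\<in>b. (if snd v - fst v < d then snd v - d else fst v) < x)"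
  unfolding row_def by (subst Max_less_iff) auto

lemma row_ge:
  "finite b \<Longrightarrow> v \<in> b \<Longrightarrow> (if snd v - fst v < d then snd v - d else fst v) \<le> row b d"
  unfolding row_def by (intro Max_ge) auto

lemma row_ge1: "finite b \<Longrightarrow> 1 \<le> row b d"
  unfolding row_def by (intro Max_ge) auto

lemma row_cases:
  assumes "finite b"
  shows "row b d = 1 \<or> (\<exists>v\<in>b. row b d = (if snd v - fst v < d then snd v - d else fst v))"
proof -
  have "row b d \<in> insert 1 ((\<lambda>v. if snd v - fst v < d then snd v - d else fst v) ` b)"
    unfolding row_def using assms by (intro Max_in) auto
  then show ?thesis by blast
qed

lemma row_antimono:
  assumes b: "finite b" "b \<subseteq> shape" and d: "d \<le> d'"
  shows "row b d' \<le> row b d" "row b d + d \<le> row b d' + d'"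
proof -
  show "row b d' \<le> row b d"
    unfolding row_le_iff [OF b(1)]
  proof (intro conjI ballI row_ge1 b)
    fix v assume v: "v \<in> b"
    then have "fst v \<le> snd v" using b(2) shape_bounds by blast
    then show "(if snd v - fst v < d' then snd v - d' else fst v) \<le> row b d"
      using row_ge [OF b(1) v, of d] d by (auto split: if_splits)
  qed
  have "row b d \<le> row b d' + (d' - d)"
    unfolding row_le_iff [OF b(1)]
  proof (intro conjI ballI)
    show "1 \<le> row b d' + (d' - d)" using row_ge1 [OF b(1), of d'] by simp
    fix v assume v: "v \<in> b"
    then have "fst v \<le> snd v" using b(2) shape_bounds by blast
    then show "(if snd v - fst v < d then snd v - d else fst v) \<le> row b d' + (d' - d)"
      using row_ge [OF b(1) v, of d'] d by (auto split: if_splits)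
  qed
  then show "row b d + d \<le> row b d' + d'" using d by simp
qed

lemma pt_in_shape:
  assumes b: "finite b" "b \<subseteq> shape" and d: "d < m"
  shows "pt b d \<in> shape"
  using row_cases [OF b(1), of d]
proof
  assume "row b d = 1"
  then show ?thesis using d n_pos lam_1 by (simp add: pt_def shape_def)
next
  assume "\<exists>v\<in>b. row b d = (if snd v - fst v < d then snd v - d else fst v)"
  then obtain v where v: "v \<in> b" "row b d = (if snd v - fst v < d then snd v - d else fst v)" by blast
  have sh: "(fst v, snd v) \<in> shape" using v b by auto
  show ?thesis
    unfolding pt_def
    by (rule shape_up [OF sh])
      (use v row_ge1 [OF b(1), of d] shape_bounds [OF sh] in \<open>auto split: if_splits\<close>)
qed

lemma row_eq:
  assumes b: "finite b" "b \<subseteq> shape" "chain b" and u: "u \<in> b"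
  shows "pt b (snd u - fst u) = u"
proof -
  have fu: "fst u \<le> snd u" using u b shape_bounds by blast
  have "row b (snd u - fst u) \<le> fst u"
    unfolding row_le_iff [OF b(1)]
  proof (intro conjI ballI)
    show "1 \<le> fst u" using u b shape_bounds by blast
    fix v assume v: "v \<in> b"
    then have "fst v \<le> snd v" "outer u v \<or> outer v u"
      using b u shape_bounds unfolding chain_def by blast+
    then show "(if snd v - fst v < snd u - fst u then snd v - (snd u - fst u) else fst v) \<le> fst u"
      using fu by (auto simp: outer_def)
  qed
  moreover have "fst u \<le> row b (snd u - fst u)" using row_ge [OF b(1) u, of "snd u - fst u"] by simp
  ultimately show ?thesis using fu by (simp add: pt_def prod_eq_iff)
qed

lemma subset_range_pt: "finite b \<Longrightarrow> b \<subseteq> shape \<Longrightarrow> chain b \<Longrightarrow> b \<subseteq> range (pt b)"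
  using row_eq by (metis rangeI subsetI)

lemma chain_range_pt:
  assumes "finite b" "b \<subseteq> shape"
  shows "chain (range (pt b))"
  unfolding chain_def
proof (intro ballI)
  fix u v assume "u \<in> range (pt b)" "v \<in> range (pt b)"
  then obtain d d' where uv: "u = pt b d" "v = pt b d'" by blast
  consider "d \<le> d'" | "d' \<le> d" by linarith
  then show "outer u v \<or> outer v u"
    using row_antimono [OF assms, of d d'] row_antimono [OF assms, of d' d]
    by cases (auto simp: outer_def pt_def uv)
qed

text \<open>Points of the path impose no bound that \<open>b\<close> does not impose already, so the
  path can be read off from any set between \<open>b\<close> and the path.\<close>

lemma row_between:
  assumes b: "finite b" "b \<subseteq> shape" and X: "b \<subseteq> X" "X \<subseteq> range (pt b)" "finite X"
  shows "row X d = row b d"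
proof (rule antisym)
  show "row b d \<le> row X d"
    unfolding row_le_iff [OF b(1)]
    using row_ge1 [OF X(3)] row_ge [OF X(3)] X(1) by blast
  show "row X d \<le> row b d"
    unfolding row_le_iff [OF X(3)]
  proof (intro conjI ballI row_ge1 b)
    fix v assume "v \<in> X"
    then obtain e where "v = pt b e" using X(2) by blast
    then show "(if snd v - fst v < d then snd v - d else fst v) \<le> row b d"
      using row_antimono [OF b, of e d] row_antimono [OF b, of d e] by (auto simp: pt_def)
  qed
qed

text \<open>Every element of a basic chain is a corner of its path: by strict nesting the path has
  left its column on all shorter diagonals and its row on all longer ones. The element of
  \<open>b'\<close> that attains the path at \<open>u\<close> lies in the row or column of
  \<open>u\<close> and on the common path, hence is \<open>u\<close>.\<close>

lemma basic_row_subset: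
  assumes b: "basic b" and b': "basic b'" and eq: "row b = row b'"
  shows "b \<subseteq> b'"
proof
  fix u assume u: "u \<in> b"
  show "u \<in> b'"
  proof (rule ccontr)
    assume nu: "u \<notin> b'"
    note fin = basic_finite [OF b] basic_finite [OF b']
    have sh: "b \<subseteq> shape" "b' \<subseteq> shape" using b b' by (auto simp: basic_def)
    obtain k l where kl: "u = (k, l)" by fastforce
    define d where "d = l - k"
    have k: "2 \<le> k" and l: "l = k + d"
      using b u kl shape_bounds [of u] by (auto simp: basic_def d_def)
    have pu: "row b d = k" using row_eq [OF fin(1) sh(1) basic_chain [OF b] u] kl
      by (simp add: pt_def d_def)
    then have "row b' d \<noteq> 1" using eq k by simp
    then obtain v where v: "v \<in> b'" "k = (if snd v - fst v < d then snd v - d else fst v)"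
      using row_cases [OF fin(2), of d] pu eq by auto
    define e where "e = snd v - fst v"
    have vs: "snd v = fst v + e" using v sh shape_bounds [of v] by (auto simp: e_def)
    have "pt b' e = v" using row_eq [OF fin(2) sh(2) basic_chain [OF b'] v(1)] by (simp add: e_def)
    then have rv: "row b e = fst v" using eq by (auto simp: pt_def)
    have so: "w = u \<or> souter w u \<or> souter u w" "fst w \<le> snd w" if "w \<in> b" for w
      using that b u sh shape_bounds by (auto simp: basic_def)
    consider "e < d" | "e = d" | "d < e" by linarith
    then show False
    proof cases
      case 1
      have "k = fst v + e - d" using v(2) vs 1 by simp
      then have sv: "fst v + e = l" using k l by simp
      have "row b e < l - e"
        unfolding row_less_iff [OF fin(1)]
      proof (intro conjI ballI)
        show "1 < l - e" using k l 1 by simp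
        fix w assume "w \<in> b"
        then show "(if snd w - fst w < e then snd w - e else fst w) < l - e"
          using so [of w] kl l k 1 by (auto simp: souter_def)
      qed
      then show False using rv sv by simp
    next
      case 2
      then have "k = fst v" using v(2) vs by simp
      then have "v = u" using vs kl l 2 by (simp add: prod_eq_iff)
      then show False using v nu by simp
    next
      case 3
      then have sv: "fst v = k" using v(2) vs by simp
      have "row b e < k"
        unfolding row_less_iff [OF fin(1)]
      proof (intro conjI ballI)
        show "1 < k" using k by simp
        fix w assume "w \<in> b"
        then show "(if snd w - fst w < e then snd w - e else fst w) < k"
          using so [of w] kl l k 3 by (auto simp: souter_def)
      qed
      then show False using rv sv by simp
    qed
  qed
qed

text \<open>Each factor \<open>theta d\<close> is represented by its one pair lying on the path of
  \<open>b\<close>.\<close>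

definition IXmset :: "(nat \<times> nat) set \<times> (nat \<Rightarrow> nat) \<Rightarrow> (nat \<times> nat) multiset" where
  "IXmset be = mset_set (fst be) + (\<Sum>d<m. replicate_mset (snd be d) (pt (fst be) d))"

lemma set_IXmset:
  "finite b \<Longrightarrow> set_mset (IXmset (b, e)) \<subseteq> b \<union> pt b ` {..<m}"
  by (auto simp: IXmset_def set_mset_sum split: if_splits)

lemma count_IXmset:
  assumes "finite b" "d < m"
  shows "count (IXmset (b, e)) (pt b d) = (if pt b d \<in> b then 1 else 0) + e d"
proof -
  have "(\<Sum>d'<m. count (replicate_mset (e d') (pt b d')) (pt b d)) = (\<Sum>d'<m. if d' = d then e d else 0)"
    by (rule sum.cong) (auto simp: pt_def)
  then show ?thesis using assms by (simp add: IXmset_def count_sum count_mset_set')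
qed

lemma msum_IXmset_in_Mon: "x \<in> IX s \<Longrightarrow> msum (IXmset x) \<in> Mon s"
proof -
  assume "x \<in> IX s"
  then obtain b e where x: "x = (b, e)" "basic b" "card b \<le> s" "e \<in> mi m (s - card b)"
    by (auto simp: IX_def)
  then have b: "finite b" "b \<subseteq> shape" using basic_finite by (auto simp: basic_def)
  have "set_mset (IXmset x) \<subseteq> shape"
    using set_IXmset [OF b(1), of e] pt_in_shape [OF b] b(2) x(1) by blast
  moreover have "size (IXmset x) = s"
    using x by (simp add: IXmset_def mi_def)
  ultimately show ?thesis by (intro MonI)
qed

text \<open>The monomial determines the chain, the chain its path, the corners of the path give
  \<open>b\<close>, and the multiplicities on the path give \<open>e\<close>.\<close>

lemma inj_IXmset: "inj_on (\<lambda>x. msum (IXmset x)) (IX s)"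
proof (rule inj_onI)
  fix x y assume "x \<in> IX s" "y \<in> IX s" and eq: "msum (IXmset x) = msum (IXmset y)"
  then obtain b e b' e' where x: "x = (b, e)" "basic b" "e \<in> mi m (s - card b)"
    and y: "y = (b', e')" "basic b'" "e' \<in> mi m (s - card b')"
    by (auto simp: IX_def)
  have facts: "set_mset (IXmset (b, e)) \<subseteq> shape" "set_mset (IXmset (b, e)) \<subseteq> range (pt b)"
    "chain (set_mset (IXmset (b, e)))" "row (set_mset (IXmset (b, e))) = row b"
    if b: "basic b" for b e
  proof -
    have fb: "finite b" "b \<subseteq> shape" "chain b"
      using b basic_finite basic_chain by (auto simp: basic_def)
    show "set_mset (IXmset (b, e)) \<subseteq> shape"
      using set_IXmset [OF fb(1), of e] pt_in_shape [OF fb(1,2)] fb(2) by blast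
    show *: "set_mset (IXmset (b, e)) \<subseteq> range (pt b)"
      using set_IXmset [OF fb(1), of e] subset_range_pt [OF fb] by blast
    then show "chain (set_mset (IXmset (b, e)))"
      using chain_range_pt [OF fb(1,2)] chain_subset by blast
    have "b \<subseteq> set_mset (IXmset (b, e))" using fb(1) by (auto simp: IXmset_def)
    then show "row (set_mset (IXmset (b, e))) = row b"
      using row_between [OF fb(1,2) _ *] by (simp add: fun_eq_iff)
  qed
  have "IXmset x = IXmset y"
    unfolding x(1) y(1)
  proof (rule chain_representation_unique)
    show "fst v \<le> snd v" if "v \<in># IXmset (b, e)" for v
      using that facts(1) [OF x(2)] shape_bounds by blast
    show "fst v \<le> snd v" if "v \<in># IXmset (b', e')" for v
      using that facts(1) [OF y(2)] shape_bounds by blast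
  qed (use facts(3) x(2) y(2) eq x(1) y(1) in auto)
  then have "row b = row b'" using facts(4) x y by metis
  then have bb: "b = b'" using basic_row_subset x(2) y(2) by (metis subset_antisym)
  have "e d = e' d" for d
  proof (cases "d < m")
    case True
    then show ?thesis
      using count_IXmset [OF basic_finite [OF x(2)] True, of e]
        count_IXmset [OF basic_finite [OF x(2)] True, of e'] \<open>IXmset x = IXmset y\<close> x(1) y(1) bb by simp
  next
    case False
    then show ?thesis using x(3) y(3) by (simp add: mi_def)
  qed
  then show "x = y" using x(1) y(1) bb by auto
qed

text \<open>The index of \<open>b0\<close> with exponent 0 is missing on the left, and
  \<open>IX s\<close> injects into \<open>Mon s\<close>. Hence the products with some factor
  \<open>theta d\<close> are too few to span degree \<open>s\<close>.\<close>

lemma card_IX_less: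
  assumes "basic b0" "card b0 = s"
  shows "card {x \<in> IX s. card (fst x) < s} < card (Mon s)"
proof -
  have "(b0, \<lambda>_. 0) \<in> IX s" using assms by (simp add: IX_def mi_0)
  then have "{x \<in> IX s. card (fst x) < s} \<subset> IX s" using assms by force
  then have "card {x \<in> IX s. card (fst x) < s} < card (IX s)" by (intro psubset_card_mono) auto
  also have "card (IX s) = card ((\<lambda>x. msum (IXmset x)) ` IX s)"
    using inj_IXmset by (simp add: card_image)
  also have "\<dots> \<le> card (Mon s)"
    using msum_IXmset_in_Mon by (intro card_mono) auto
  finally show ?thesis .
qed

section \<open>The maximal length of a basic chain\<close>

lemma basic_card_less_n:
  assumes b: "basic b"
  shows "card b \<le> n - 1"
proof -
  have "u = v" if "u \<in> b" "v \<in> b" "fst u = fst v" for u v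
    using b that unfolding basic_def souter_def by (metis less_irrefl)
  then have "inj_on fst b" by (rule inj_onI)
  then have "card b = card (fst ` b)" by (simp add: card_image)
  also have "\<dots> \<le> card {2..n}"
  proof (rule card_mono)
    show "fst ` b \<subseteq> {2..n}" using b by (fastforce simp: basic_def shape_def)
  qed simp
  finally show ?thesis by simp
qed

text \<open>Rows 2, ..., i - 1 contribute at most i - 2 pairs. The pairs from row i on have their
  ends in {i..lam i}, and these ends are distinct except that one pair may be of the form (x, x); so
  twice their number is at most lam i - i + 2.\<close>

lemma basic_card_le:
  assumes b: "basic b" and i: "2 \<le> i" "i \<le> n"
  shows "card b \<le> (lam i + i) div 2 - 1"
proof -
  note fin = basic_finite [OF b]
  have so: "souter u v \<or> souter v u" if "u \<in> b" "v \<in> b" "u \<noteq> v" for u v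
    using b that by (auto simp: basic_def)
  have sh: "b \<subseteq> shape" using b by (simp add: basic_def)
  have inj: "inj_on fst b" "inj_on snd b"
    using so by (force simp: inj_on_def souter_def)+
  define b1 where "b1 = {v \<in> b. fst v < i}"
  define b2 where "b2 = {v \<in> b. i \<le> fst v}"
  have b12: "b = b1 \<union> b2" "b1 \<inter> b2 = {}" "finite b1" "finite b2" "b1 \<subseteq> b" "b2 \<subseteq> b"
    using fin by (auto simp: b1_def b2_def)
  have "card b1 = card (fst ` b1)"
    using inj(1) b12 by (metis card_image inj_on_subset)
  also have "\<dots> \<le> card {2..<i}"
  proof (rule card_mono)
    show "fst ` b1 \<subseteq> {2..<i}" using b by (fastforce simp: basic_def b1_def)
  qed simp
  finally have c1: "card b1 \<le> i - 2" by simp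
  have "\<exists>x. fst ` b2 \<inter> snd ` b2 \<subseteq> {x}"
  proof -
    have diag: "u = v \<and> fst u = snd u" if "u \<in> b2" "v \<in> b2" "fst u = snd v" for u v
      using so [of u v] that sh shape_bounds [of u] shape_bounds [of v] b12
      by (force simp: souter_def)
    have "fst u = fst v" if "u \<in> b2" "v \<in> b2" "fst u = snd u" "fst v = snd v" for u v
      using so [of u v] that sh shape_bounds [of u] shape_bounds [of v] b12
      by (force simp: souter_def)
    then have "y = z" if "y \<in> fst ` b2 \<inter> snd ` b2" "z \<in> fst ` b2 \<inter> snd ` b2" for y z
      using that diag by (metis (no_types, lifting) IntE imageE)
    then show ?thesis by (metis insertI1 subsetI)
  qed
  then obtain x where "fst ` b2 \<inter> snd ` b2 \<subseteq> {x}" by blast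
  then have "card (fst ` b2 \<inter> snd ` b2) \<le> 1" using card_mono [of "{x}"] by fastforce
  moreover have "card (fst ` b2) = card b2" "card (snd ` b2) = card b2"
    using inj b12 by (metis card_image inj_on_subset)+
  moreover have "card (fst ` b2) + card (snd ` b2) =
      card (fst ` b2 \<union> snd ` b2) + card (fst ` b2 \<inter> snd ` b2)"
    using b12 by (intro card_Un_Int) auto
  moreover have "card (fst ` b2 \<union> snd ` b2) \<le> card {i..lam i}"
  proof (rule card_mono)
    have "i \<le> fst v \<and> fst v \<le> snd v \<and> snd v \<le> lam i" if "v \<in> b2" for v
      using that sh lam_mono [of i "fst v"] i by (auto simp: b2_def shape_def)
    then show "fst ` b2 \<union> snd ` b2 \<subseteq> {i..lam i}" by fastforce
  qed simp
  ultimately have "2 * card b2 \<le> lam i + 2 - i" using n_le_lam [of i] i by simp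
  moreover have "card b = card b1 + card b2" using b12 by (metis card_Un_disjoint)
  ultimately show ?thesis using c1 i n_le_lam [of i] by linarith
qed

lemma exists_basic:
  assumes c: "c \<le> n - 1" "\<And>i. 2 \<le> i \<Longrightarrow> i \<le> n \<Longrightarrow> c \<le> (lam i + i) div 2 - 1"
  obtains b where "basic b" "card b = c"
proof -
  \<comment> \<open>One pair in each of the rows 2, ..., c + 1, nested around
    \<open>(c + 1, c + 1)\<close>; the hypothesis for row \<open>a + 1\<close> says precisely that
    \<open>2 * c + 1 - a\<close> does not exceed \<open>lam (a + 1)\<close>.\<close>
  define f where "f = (\<lambda>a. (a + 1, 2 * c + 1 - a))"
  have "f a \<in> shape" if a: "a \<in> {1..c}" for a
  proof -
    have "c \<le> (lam (a + 1) + (a + 1)) div 2 - 1" 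
    proof (rule c(2))
      show "2 \<le> a + 1" "a + 1 \<le> n" using a c(1) by auto
    qed
    then show ?thesis using a c(1) by (auto simp: f_def shape_def)
  qed
  moreover have "souter (f a) (f a') \<or> souter (f a') (f a)"
    if "a \<in> {1..c}" "a' \<in> {1..c}" "f a \<noteq> f a'" for a a'
    using that by (cases "a < a'") (auto simp: f_def souter_def)
  ultimately have "basic (f ` {1..c})" by (auto simp: basic_def f_def)
  moreover have "card (f ` {1..c}) = c" by (subst card_image) (auto simp: inj_on_def f_def)
  ultimately show thesis using that by blast
qed

end

subsection \<open>Homogeneous components\<close>

definition hc :: "nat \<Rightarrow> 'a::comm_ring_1 mpoly \<Rightarrow> 'a mpoly" where
  "hc N p = (\<Sum>t\<in>{t \<in> keys p. tdeg t = N}. cst (lookup p t) * xpow t)"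

lemma lookup_hc: "lookup (hc N p) t = (if tdeg t = N then lookup p t else 0)"
proof -
  have "lookup (hc N p) t = (\<Sum>u\<in>{u \<in> keys p. tdeg u = N}. if u = t then lookup p t else 0)"
    unfolding hc_def lookup_sum by (rule sum.cong) (simp_all add: lookup_xpow)
  then show ?thesis by (auto simp: in_keys_iff)
qed

lemma hc_diff: "hc N (p - q) = hc N p - hc N q"
  by (rule poly_mapping_eqI) (simp add: lookup_hc lookup_minus)

lemma hc_add: "hc N (p + q) = hc N p + hc N q"
  by (rule poly_mapping_eqI) (simp add: lookup_hc lookup_add)

lemma hc_0 [simp]: "hc N 0 = 0"
  by (rule poly_mapping_eqI) (simp add: lookup_hc)

lemma hc_sum: "hc N (\<Sum>i\<in>I. p i) = (\<Sum>i\<in>I. hc N (p i))"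
  by (induction I rule: infinite_finite_induct) (simp_all add: hc_add)

lemma hc_cst_mult: "hc N (cst c * p) = cst c * hc N p"
  by (rule poly_mapping_eqI) (simp add: lookup_hc)

lemma hc_id: "(\<And>t. t \<in> keys p \<Longrightarrow> tdeg t = N) \<Longrightarrow> hc N p = p"
  by (rule poly_mapping_eqI) (auto simp: lookup_hc in_keys_iff)

lemma hc_eq_0: "(\<And>t. t \<in> keys p \<Longrightarrow> tdeg t \<noteq> N) \<Longrightarrow> hc N p = 0"
  by (rule poly_mapping_eqI) (auto simp: lookup_hc in_keys_iff)

lemma keys_hc: "keys (hc N p) = {t \<in> keys p. tdeg t = N}"
  by (auto simp: in_keys_iff lookup_hc split: if_splits)

lemma hc_xpow: "hc N (xpow t) = (if tdeg t = N then xpow t else 0)"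
  by (rule poly_mapping_eqI) (simp add: lookup_hc lookup_xpow)

lemma hc_mult_xpow: "hc (N + tdeg t) (p * xpow t) = hc N p * xpow t"
proof -
  have *: "hc (N + tdeg t) (q * xpow t) = hc N q * xpow t" if "q = cst c * xpow u" for q c u
    by (simp add: that hc_cst_mult hc_xpow mult.assoc xpow_add [symmetric] wsum_add)
  show ?thesis
    by (subst (1 2) mpoly_expand_keys [of p]) (simp add: sum_distrib_right hc_sum *)
qed

lemma tdeg_eq_0: "tdeg t = 0 \<longleftrightarrow> t = 0"
proof
  assume "tdeg t = 0"
  then have "\<forall>i\<in>keys t. lookup t i = 0" by (simp add: wsum_def)
  then show "t = 0" by (intro poly_mapping_eqI) (metis in_keys_iff lookup_zero)
qed simp

text \<open>Non-constant terms of \<open>r\<close> raise the degree. Therefore a linear condition on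
  the lowest component is stable under multiplication by the ring, and cuts an ideal out of an
  ideal.\<close>

lemma hc_mult_low:
  fixes r p :: "'a::comm_ring_1 mpoly"
  assumes "\<And>t. t \<in> keys p \<Longrightarrow> N \<le> tdeg t"
  shows "hc N (r * p) = cst (lookup r 0) * hc N p"
proof -
  define r' where "r' = r - cst (lookup r 0)"
  have nz: "0 \<notin> keys r'"
    by (simp add: r'_def in_keys_iff lookup_minus cst_def)
  have "hc N (r' * p) = 0"
  proof (rule hc_eq_0)
    fix t assume "t \<in> keys (r' * p)"
    then obtain u v where uv: "t = u + v" "u \<in> keys r'" "v \<in> keys p" using keys_mult by blast
    then have "u \<noteq> 0" using nz by metis
    then have "tdeg u > 0" using tdeg_eq_0 by (metis gr0I)
    then show "tdeg t \<noteq> N" using uv assms [of v] by (simp add: wsum_add)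
  qed
  moreover have "r * p = r' * p + cst (lookup r 0) * p" by (simp add: r'_def algebra_simps)
  ultimately show ?thesis by (simp add: hc_add hc_cst_mult)
qed

subsection \<open>Powers and reductions of the ideal\<close>

context spec_ferrers
begin

abbreviation R :: "'a::comm_ring_1 mpoly set" where
  "R \<equiv> poly_ring m"

abbreviation I :: "'a::comm_ring_1 mpoly set" where
  "I \<equiv> spec_ferrers_ideal m n lam (\<lambda>i. int i - 1)"

text \<open>For an ideal J this is J I^r, and for the whole ring it is I^r, in a form from which
  coefficients can be extracted.\<close>

definition MI :: "'a::comm_ring_1 mpoly set \<Rightarrow> nat \<Rightarrow> 'a mpoly set" where
  "MI S r = {\<Sum>t\<in>Mon r. c t * xpow t | c. \<forall>t. c t \<in> S}"

lemma MI_lincombs: "MI S r = lincombs S xpow (Mon r)"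
  by (simp add: MI_def lincombs_def)

lemma MI_subgroup: "add_subgroup S \<Longrightarrow> add_subgroup (MI S r)"
  unfolding MI_lincombs by (rule lincombs_subgroup)

lemma MI_mono: "S \<subseteq> S' \<Longrightarrow> MI S r \<subseteq> MI S' r"
  unfolding MI_def by blast

lemma MI_I: "add_subgroup S \<Longrightarrow> a \<in> S \<Longrightarrow> t \<in> Mon r \<Longrightarrow> a * xpow t \<in> MI S r"
  unfolding MI_lincombs by (rule lincombs_member) simp_all

lemma xpow_in_R: "t \<in> Mon r \<Longrightarrow> xpow t \<in> R"
  using Mon_keys by (simp add: xpow_in_poly_ring)

lemma MI_ideal: "is_ideal R J \<Longrightarrow> is_ideal R (MI J r)"
  unfolding MI_lincombs using xpow_in_R by (intro lincombs_ideal [OF subring_poly_ring])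

lemma xpow_in_MI_R: "t \<in> Mon r \<Longrightarrow> xpow t \<in> MI R r"
  using MI_I [OF R_subgroup R_1] by simp

lemma MI_R_least:
  fixes X :: "'a::comm_ring_1 mpoly set"
  assumes "is_ideal R X" "\<And>t. t \<in> Mon r \<Longrightarrow> xpow t \<in> X"
  shows "MI R r \<subseteq> X"
proof
  fix x :: "'a mpoly" assume "x \<in> MI R r"
  then obtain c where "x = (\<Sum>t\<in>Mon r. c t * xpow t)" "\<forall>t. c t \<in> R" by (auto simp: MI_def)
  then show "x \<in> X"
    using add_subgroup_sum [OF ideal_subgroup [OF assms(1)], of "Mon r"]
      is_ideal_mult [OF assms(1)] assms(2) by simp
qed

lemma ideal_mult_MI:
  fixes J :: "'a::comm_ring_1 mpoly set"
  assumes J: "is_ideal R J"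
  shows "ideal_mult R J (MI R r) = MI J r"
  unfolding ideal_mult_def
proof (rule ideal_gen_eqI)
  show "is_ideal R (MI J r)" by (rule MI_ideal [OF J])
  show "{a * b |a b. a \<in> J \<and> b \<in> MI R r} \<subseteq> MI J r"
  proof safe
    fix a b :: "'a mpoly" assume a: "a \<in> J" and "b \<in> MI R r"
    then obtain c where c: "b = (\<Sum>t\<in>Mon r. c t * xpow t)" "\<forall>t. c t \<in> R" by (auto simp: MI_def)
    have "a * b = (\<Sum>t\<in>Mon r. (c t * a) * xpow t)" by (simp add: c sum_distrib_left mult_ac)
    moreover have "\<forall>t. c t * a \<in> J" using c a is_ideal_mult [OF J] by blast
    ultimately show "a * b \<in> MI J r" by (auto simp: MI_def)
  qed
  fix X assume X: "is_ideal R X" and "{a * b |a b. a \<in> J \<and> b \<in> MI R r} \<subseteq> X"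
  then have "a * xpow t \<in> X" if "a \<in> J" "t \<in> Mon r" for a t
    using that xpow_in_MI_R by blast
  then show "MI J r \<subseteq> X"
    by (auto simp: MI_def intro!: add_subgroup_sum [OF ideal_subgroup [OF X]])
qed

lemma I_eq_MI: "I = (MI R (Suc 0) :: 'a::comm_ring_1 mpoly set)"
  unfolding spec_ferrers_ideal_def
proof (rule ideal_gen_eqI)
  have gens: "{Var i * Var j |i j. 1 \<le> i \<and> i \<le> n \<and> int i - 1 < int j \<and> j \<le> lam i} =
      (xpow ` Mon (Suc 0) :: 'a mpoly set)"
  proof -
    have "Mon (Suc 0) = pm ` shape" unfolding Mon_Suc by force
    then have "(xpow ` Mon (Suc 0) :: 'a mpoly set) = (\<lambda>v. Var (fst v) * Var (snd v)) ` shape"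
      by (simp add: image_image pm_def xpow_add Var_xpow)
    also have "\<dots> = {Var i * Var j |i j. 1 \<le> i \<and> i \<le> n \<and> int i - 1 < int j \<and> j \<le> lam i}"
    proof (intro equalityI subsetI)
      fix x assume "x \<in> (\<lambda>v. Var (fst v) * Var (snd v)) ` shape"
      then obtain v where "v \<in> shape" "x = Var (fst v) * Var (snd v)" by blast
      then show "x \<in> {Var i * Var j |i j. 1 \<le> i \<and> i \<le> n \<and> int i - 1 < int j \<and> j \<le> lam i}"
        by (intro CollectI exI [of _ "fst v"] exI [of _ "snd v"]) (auto simp: shape_def)
    next
      fix x assume "x \<in> {Var i * Var j |i j. 1 \<le> i \<and> i \<le> n \<and> int i - 1 < int j \<and> j \<le> lam i}"
      then obtain i j where "x = Var i * Var j" "(i, j) \<in> shape" by (auto simp: shape_def)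
      then show "x \<in> (\<lambda>v. Var (fst v) * Var (snd v)) ` shape" by force
    qed
    finally show ?thesis by simp
  qed
  show "is_ideal R (MI R (Suc 0))" by (rule MI_ideal [OF R_ideal])
  show "{Var i * Var j |i j. 1 \<le> i \<and> i \<le> n \<and> int i - 1 < int j \<and> j \<le> lam i} \<subseteq>
      (MI R (Suc 0) :: 'a mpoly set)"
    unfolding gens using xpow_in_MI_R by blast
  show "(MI R (Suc 0) :: 'a mpoly set) \<subseteq> X" if "is_ideal R X"
    "{Var i * Var j |i j. 1 \<le> i \<and> i \<le> n \<and> int i - 1 < int j \<and> j \<le> lam i} \<subseteq> X" for X
    using that unfolding gens by (intro MI_R_least) auto
qed

lemma I_ideal: "is_ideal R I"
  unfolding I_eq_MI by (rule MI_ideal [OF R_ideal])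

lemma xpow_mult_MI:
  assumes S: "add_subgroup S" and v: "v \<in> shape" and x: "x \<in> MI S r"
  shows "xpow (pm v) * x \<in> MI S (Suc r)"
proof -
  obtain c where c: "x = (\<Sum>t\<in>Mon r. c t * xpow t)" "\<forall>t. c t \<in> S" using x by (auto simp: MI_def)
  have "xpow (pm v) * x = (\<Sum>t\<in>Mon r. c t * xpow (pm v + t))"
    by (simp add: c sum_distrib_left xpow_add mult_ac)
  also have "\<dots> \<in> MI S (Suc r)"
    using c v by (intro add_subgroup_sum [OF MI_subgroup [OF S]] MI_I [OF S] Mon_SucI) auto
  finally show ?thesis .
qed

lemma MI_I_eq: "MI I r = (MI R (Suc r) :: 'a::comm_ring_1 mpoly set)"
proof
  show "(MI R (Suc r) :: 'a mpoly set) \<subseteq> MI I r"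
  proof (rule MI_R_least [OF MI_ideal [OF I_ideal]])
    fix u assume "u \<in> Mon (Suc r)"
    then obtain v t where u: "v \<in> shape" "t \<in> Mon r" "u = pm v + t" by (rule Mon_SucE)
    have "xpow (pm v) * xpow t \<in> MI I r"
      using xpow_in_MI_R [OF pm_in_Mon [OF u(1)]] u(2) unfolding I_eq_MI
      by (intro MI_I MI_subgroup R_subgroup)
    then show "xpow u \<in> MI I r" by (simp add: u(3) xpow_add)
  qed
  show "MI I r \<subseteq> (MI R (Suc r) :: 'a mpoly set)"
  proof
    fix x :: "'a mpoly" assume "x \<in> MI I r"
    then obtain c where c: "x = (\<Sum>t\<in>Mon r. c t * xpow t)" "\<forall>t. c t \<in> I" by (auto simp: MI_def)
    have "c t * xpow t \<in> MI R (Suc r)" if t: "t \<in> Mon r" for t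
    proof -
      have "c t \<in> MI R (Suc 0)" using c(2) I_eq_MI by blast
      then obtain d where d: "c t = (\<Sum>u\<in>Mon (Suc 0). d u * xpow u)" "\<forall>u. d u \<in> R" by (auto simp: MI_def)
      have "c t * xpow t = (\<Sum>u\<in>Mon (Suc 0). d u * xpow (u + t))"
        by (simp add: d sum_distrib_right xpow_add mult.assoc)
      also have "\<dots> \<in> MI R (Suc r)"
      proof (rule add_subgroup_sum [OF MI_subgroup [OF R_subgroup]])
        fix u assume "u \<in> Mon (Suc 0)"
        then have "u + t \<in> Mon (Suc r)" using Mon_add [of u "Suc 0" t r] t by simp
        then show "d u * xpow (u + t) \<in> MI R (Suc r)"
          using d(2) by (intro MI_I R_subgroup) auto
      qed
      finally show ?thesis .
    qed
    then show "x \<in> MI R (Suc r)"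
      unfolding c(1) by (intro add_subgroup_sum [OF MI_subgroup [OF R_subgroup]])
  qed
qed

lemma ideal_pow_eq_MI: "ideal_pow R I r = (MI R r :: 'a::comm_ring_1 mpoly set)"
proof (induction r)
  case 0
  have "x \<in> MI R 0" if "x \<in> R" for x :: "'a mpoly"
    using MI_I [OF R_subgroup that, of 0 0] by simp
  then show ?case by (auto simp: MI_def)
next
  case (Suc r)
  then show ?case by (simp add: ideal_mult_MI [OF I_ideal] MI_I_eq)
qed

lemma reduction_eq_iff:
  fixes J :: "'a::comm_ring_1 mpoly set"
  assumes "is_ideal R J"
  shows "ideal_pow R I (r + 1) = ideal_mult R J (ideal_pow R I r) \<longleftrightarrow> MI R (Suc r) = MI J r"
  unfolding ideal_pow_eq_MI ideal_mult_MI [OF assms] by simp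

lemma is_reduction_iff:
  fixes J :: "'a::comm_ring_1 mpoly set"
  shows "is_reduction R J I \<longleftrightarrow> is_ideal R J \<and> J \<subseteq> I \<and> (\<exists>r. MI R (Suc r) = MI J r)"
  unfolding is_reduction_def using reduction_eq_iff [of J] by meson

lemma reduction_number_wrt_eq:
  fixes J :: "'a::comm_ring_1 mpoly set"
  assumes "is_ideal R J"
  shows "reduction_number_wrt R J I = (LEAST r. MI R (Suc r) = MI J r)"
  unfolding reduction_number_wrt_def reduction_eq_iff [OF assms] ..

lemma MI_subset_power: "J \<subseteq> I \<Longrightarrow> MI J r \<subseteq> MI R (Suc r)"
  using MI_mono MI_I_eq by blast

lemma reduction_Suc:
  fixes J :: "'a::comm_ring_1 mpoly set"
  assumes J: "is_ideal R J" "J \<subseteq> I" and eq: "MI R (Suc r) = MI J r"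
  shows "MI R (Suc (Suc r)) = MI J (Suc r)"
proof
  show "MI R (Suc (Suc r)) \<subseteq> MI J (Suc r)"
  proof (rule MI_R_least [OF MI_ideal [OF J(1)]])
    fix u assume "u \<in> Mon (Suc (Suc r))"
    then obtain v t where u: "v \<in> shape" "t \<in> Mon (Suc r)" "u = pm v + t" by (rule Mon_SucE)
    then have "xpow t \<in> MI J r" using eq xpow_in_MI_R by blast
    then show "xpow u \<in> MI J (Suc r)"
      using xpow_mult_MI [OF ideal_subgroup [OF J(1)] u(1)] u(3)
      by (simp add: xpow_add)
  qed
qed (rule MI_subset_power [OF J(2)])

lemma reduction_mono:
  fixes J :: "'a::comm_ring_1 mpoly set"
  assumes J: "is_ideal R J" "J \<subseteq> I" and eq: "MI R (Suc r) = MI J r" and "r \<le> k"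
  shows "MI R (Suc k) = MI J k"
  using assms(4)
proof (induction k rule: dec_induct)
  case (step k)
  then show ?case using reduction_Suc [OF J] by blast
qed (rule eq)

lemma MI_R_keys:
  assumes "p \<in> MI R r" "t \<in> keys p"
  obtains u y where "u \<in> Mon r" "t = u + y" "keys y \<subseteq> {1..m}"
proof -
  obtain c where c: "p = (\<Sum>u\<in>Mon r. c u * xpow u)" "\<forall>u. c u \<in> R" using assms by (auto simp: MI_def)
  have "keys p \<subseteq> (\<Union>u\<in>Mon r. (\<lambda>y. y + u) ` keys (c u))"
    unfolding c(1) by (rule keys_sum_subset) (use keys_xpow_mult in blast)
  then obtain u y where "u \<in> Mon r" "y \<in> keys (c u)" "t = y + u" using assms(2) by blast
  then show thesis using that [of u y] c(2) by (auto simp: poly_ring_def add.commute)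
qed

lemma I_keys_tdeg: "p \<in> I \<Longrightarrow> t \<in> keys p \<Longrightarrow> 2 \<le> tdeg t"
  unfolding I_eq_MI by (erule (1) MI_R_keys) (simp add: wsum_add Mon_tdeg)

lemma keys_hc_I: "p \<in> I \<Longrightarrow> keys (hc 2 p) \<subseteq> Mon (Suc 0)"
proof
  fix t assume p: "p \<in> I" and "t \<in> keys (hc 2 p)"
  then have t: "t \<in> keys p" "tdeg t = 2" by (auto simp: keys_hc)
  obtain u y where "u \<in> Mon (Suc 0)" "t = u + y"
    using MI_R_keys [OF _ t(1)] p unfolding I_eq_MI by metis
  then show "t \<in> Mon (Suc 0)"
    using t(2) Mon_tdeg [of u 1] tdeg_eq_0 [of y] by (simp add: wsum_add)
qed

text \<open>In the fiber ring \<open>F = \<Oplus> span (Mon s)\<close> this says that \<open>F\<^sub>s\<^sub>+\<^sub>1 = V F\<^sub>s\<close>.\<close>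

definition covers :: "'a::comm_ring_1 mpoly set \<Rightarrow> nat \<Rightarrow> bool" where
  "covers V s \<longleftrightarrow> (\<forall>U. add_subgroup U \<longrightarrow> (\<forall>v\<in>V. \<forall>t\<in>Mon s. v * xpow t \<in> U) \<longrightarrow>
    (\<forall>u\<in>Mon (Suc s). xpow u \<in> U))"

lemma coversD:
  "covers V s \<Longrightarrow> add_subgroup U \<Longrightarrow> (\<And>v t. v \<in> V \<Longrightarrow> t \<in> Mon s \<Longrightarrow> v * xpow t \<in> U) \<Longrightarrow>
    u \<in> Mon (Suc s) \<Longrightarrow> xpow u \<in> U"
  unfolding covers_def by blast

lemma covers_Suc:
  assumes "covers V s"
  shows "covers V (Suc s)"
  unfolding covers_def
proof (intro allI impI ballI)
  fix U u assume U: "add_subgroup U" and VU: "\<forall>v\<in>V. \<forall>t\<in>Mon (Suc s). v * xpow t \<in> U"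
    and "u \<in> Mon (Suc (Suc s))"
  then obtain w t where u: "w \<in> shape" "t \<in> Mon (Suc s)" "u = pm w + t" using Mon_SucE by blast
  define U' where "U' = {p. xpow (pm w) * p \<in> U}"
  have "xpow t \<in> U'"
  proof (rule coversD [OF assms _ _ u(2)])
    show "add_subgroup U'" using U by (auto simp: U'_def add_subgroup_def right_diff_distrib)
    fix v t assume vt: "v \<in> V" "t \<in> Mon s"
    have "pm w + t \<in> Mon (Suc s)" using Mon_SucI u(1) vt(2) .
    then have "v * xpow (pm w + t) \<in> U" using VU vt(1) by blast
    then show "v * xpow t \<in> U'" by (simp add: U'_def xpow_add mult_ac)
  qed
  then show "xpow u \<in> U" by (simp add: U'_def u(3) xpow_add)
qed

lemma covers_mono:
  assumes "s \<le> k" "covers V s"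
  shows "covers V k"
  using assms by (induction k rule: dec_induct) (blast intro: covers_Suc)+

text \<open>All monomials in \<open>Mon r\<close> have degree 2r, so the component of degree 2r + 2
  of an equation in J I^r sees only the degree-two part of \<open>J\<close>. This handles
  inhomogeneous \<open>J\<close>.\<close>

lemma reduction_covers:
  fixes J :: "'a::comm_ring_1 mpoly set"
  assumes eq: "MI R (Suc r) = MI J r"
  shows "covers (hc 2 ` J) r"
  unfolding covers_def
proof (intro allI impI ballI)
  fix U u assume U: "add_subgroup U" "\<forall>v\<in>hc 2 ` J. \<forall>t\<in>Mon r. v * xpow t \<in> U" and u: "u \<in> Mon (Suc r)"
  then have "xpow u \<in> MI J r" using xpow_in_MI_R eq by blast
  then obtain c where c: "xpow u = (\<Sum>t\<in>Mon r. c t * xpow t)" "\<forall>t. c t \<in> J" by (auto simp: MI_def)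
  have "xpow u = hc (2 + 2 * r) (xpow u)" using Mon_tdeg [OF u] by (intro hc_id [symmetric]) simp
  also have "\<dots> = (\<Sum>t\<in>Mon r. hc (2 + tdeg t) (c t * xpow t))"
    unfolding c(1) hc_sum by (rule sum.cong) (simp_all add: Mon_tdeg)
  also have "\<dots> = (\<Sum>t\<in>Mon r. hc 2 (c t) * xpow t)"
    by (simp only: hc_mult_xpow)
  also have "\<dots> \<in> U" using U c by (intro add_subgroup_sum [OF U(1)]) auto
  finally show "xpow u \<in> U" .
qed

lemma keys_mult_Mon:
  assumes "keys p \<subseteq> Mon a" "keys q \<subseteq> Mon b"
  shows "keys (p * q) \<subseteq> Mon (a + b)"
proof
  fix t assume "t \<in> keys (p * q)"
  then obtain u v where "t = u + v" "u \<in> keys p" "v \<in> keys q" using keys_mult by blast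
  then show "t \<in> Mon (a + b)" using Mon_add assms by blast
qed

lemma keys_power_Mon: "keys p \<subseteq> Mon (Suc 0) \<Longrightarrow> keys (p ^ k) \<subseteq> Mon k"
proof (induction k)
  case (Suc k)
  then show ?case using keys_mult_Mon [of p 1 "p ^ k" k] by simp
qed simp

lemma keys_pw_Mon:
  fixes g :: "nat \<Rightarrow> 'a::comm_ring_1 mpoly"
  assumes "\<And>i. i < l \<Longrightarrow> keys (g i) \<subseteq> Mon (Suc 0)"
  shows "keys (pw l g \<alpha>) \<subseteq> Mon (\<Sum>i<l. \<alpha> i)"
  using assms
proof (induction l)
  case (Suc l)
  then have "keys (pw l g \<alpha>) \<subseteq> Mon (\<Sum>i<l. \<alpha> i)" by simp
  moreover have "keys (g l ^ \<alpha> l) \<subseteq> Mon (\<alpha> l)" using Suc.prems by (intro keys_power_Mon) simp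
  ultimately have "keys (pw l g \<alpha> * g l ^ \<alpha> l) \<subseteq> Mon ((\<Sum>i<l. \<alpha> i) + \<alpha> l)"
    by (rule keys_mult_Mon)
  then show ?case by (simp add: pw_def)
qed (simp add: pw_def)

lemma keys_theta: "keys (theta d) \<subseteq> Mon (Suc 0)"
  unfolding theta_def
proof (rule keys_sum_subset)
  fix v assume "v \<in> diag d"
  then show "keys (xpow (pm v)) \<subseteq> Mon (Suc 0)" using pm_in_Mon [of v] by (simp add: diag_def)
qed

end

subsection \<open>Pencils of quadrics\<close>

text \<open>One univariate polynomial with \<open>mpoly\<close> coefficients, evaluated at
  constants, so that products of families are again families.\<close>

definition polyfam :: "('a::comm_ring_1 \<Rightarrow> 'a mpoly) \<Rightarrow> bool" where
  "polyfam p \<longleftrightarrow> (\<exists>P. \<forall>c. p c = poly P (cst c))"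

lemma polyfam_const: "polyfam (\<lambda>_. p)"
  unfolding polyfam_def by (rule exI [of _ "[:p:]"]) simp

lemma polyfam_cst: "polyfam cst"
  unfolding polyfam_def by (rule exI [of _ "[:0, 1:]"]) simp

lemma polyfam_add: "polyfam p \<Longrightarrow> polyfam q \<Longrightarrow> polyfam (\<lambda>c. p c + q c)"
  unfolding polyfam_def by (metis poly_add)

lemma polyfam_diff: "polyfam p \<Longrightarrow> polyfam q \<Longrightarrow> polyfam (\<lambda>c. p c - q c)"
  unfolding polyfam_def by (metis poly_diff)

lemma polyfam_mult: "polyfam p \<Longrightarrow> polyfam q \<Longrightarrow> polyfam (\<lambda>c. p c * q c)"
  unfolding polyfam_def by (metis poly_mult)

lemma polyfam_power: "polyfam p \<Longrightarrow> polyfam (\<lambda>c. p c ^ k)"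
  by (induction k) (simp_all add: polyfam_const polyfam_mult)

lemma polyfam_pw:
  assumes "\<And>i. i < l \<Longrightarrow> polyfam (w i)"
  shows "polyfam (\<lambda>c. pw l (\<lambda>i. w i c) \<alpha>)"
  using assms unfolding pw_def
  by (induction l) (simp_all add: polyfam_const polyfam_mult polyfam_power)

lemma polyfam_lookup:
  assumes "polyfam p"
  shows "polyfun (\<lambda>c. lookup (p c) t)"
proof -
  obtain P where P: "p = (\<lambda>c. poly P (cst c))" using assms by (auto simp: polyfam_def)
  have "\<exists>Q. \<forall>c. lookup (poly P (cst c)) t = poly Q c"
  proof (induction P)
    case 0
    show ?case by (rule exI [of _ 0]) simp
  next
    case (pCons a P)
    then obtain Q where "\<forall>c. lookup (poly P (cst c)) t = poly Q c" by blast
    then show ?case by (intro exI [of _ "pCons (lookup a t) Q"]) (simp add: lookup_add)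
  qed
  then show ?thesis unfolding P polyfun_def .
qed

text \<open>Testing a spanning statement on kernels of functionals \<open>q\<close> turns it into
  independence of the rows of a coefficient matrix.\<close>

lemma subgroup_lookup_kernel:
  "add_subgroup {p :: 'a::comm_ring_1 mpoly. (\<Sum>u\<in>Z. q u * lookup p u) = 0}"
  by (simp add: add_subgroup_def lookup_minus right_diff_distrib sum_subtractf)

lemma lookup_kernel_cst_sum:
  fixes f :: "'i \<Rightarrow> 'a::comm_ring_1 mpoly"
  shows "(\<Sum>u\<in>Z. q u * lookup (\<Sum>i\<in>I. cst (a i) * f i) u) =
    (\<Sum>i\<in>I. a i * (\<Sum>u\<in>Z. q u * lookup (f i) u))"
proof -
  have "(\<Sum>u\<in>Z. q u * lookup (\<Sum>i\<in>I. cst (a i) * f i) u) =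
      (\<Sum>u\<in>Z. \<Sum>i\<in>I. a i * (q u * lookup (f i) u))"
    by (simp add: lookup_sum sum_distrib_left mult.left_commute)
  also have "\<dots> = (\<Sum>i\<in>I. \<Sum>u\<in>Z. a i * (q u * lookup (f i) u))" by (rule sum.swap)
  finally show ?thesis by (simp add: sum_distrib_left)
qed

context spec_ferrers
begin

lemma IX_theta_mult:
  assumes "(b, e) \<in> IX s" "d < m"
  shows "(b, \<lambda>j. (if j = d then 1 else 0) + e j) \<in> {x \<in> IX (Suc s). card (fst x) < Suc s}"
  using assms mi_add [OF mi_unit [OF assms(2)], of e "s - card b"]
  by (auto simp: IX_def Suc_diff_le)

text \<open>For \<open>v = theta\<close> this holds because the elements \<open>theta\<^sup>e b\<close> with \<open>e \<noteq> 0\<close> are too few. In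
  general one passes to a general member of the pencil joining \<open>theta\<close> and \<open>v\<close>, for which the
  spanning property of \<open>theta\<close> and the assumed one of \<open>v\<close> hold simultaneously.\<close>

lemma not_covers:
  fixes v :: "nat \<Rightarrow> 'a::field mpoly"
  assumes inf: "infinite (UNIV :: 'a set)"
    and b0: "basic b0" "card b0 = Suc s"
    and v: "\<And>d. d < m \<Longrightarrow> keys (v d) \<subseteq> Mon (Suc 0)"
    and V: "V \<subseteq> {\<Sum>d<m. cst (a d) * v d |a. True}"
  shows "\<not> covers V s"
proof
  assume cov: "covers V s"
  define w where "w = (\<lambda>d c. cst (1 - c) * theta d + cst c * v d)"
  have w_fam: "polyfam (w d)" for d
    unfolding w_def cst_diff
    by (intro polyfam_add polyfam_mult polyfam_diff polyfam_const polyfam_cst)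
  have w_keys: "keys (w d c) \<subseteq> Mon (Suc 0)" if "d < m" for d c
    using keys_add [of "cst (1 - c) * theta d" "cst c * v d"] keys_cst_mult [of "1 - c" "theta d"]
      keys_cst_mult [of c "v d"] keys_theta [of d] v [OF that] unfolding w_def by blast
  have w0: "w d 0 = theta d" and w1: "w d 1 = v d" for d by (simp_all add: w_def)
  \<comment> \<open>Columns of \<open>A\<close> are the products theta^e b deformed along the
    pencil, columns of \<open>B\<close> the products of \<open>w d\<close> with monomials. In degree
    \<open>s\<close> those of \<open>A\<close> span at \<open>c = 0\<close>, and in degree
    \<open>s + 1\<close> those of \<open>B\<close> span at \<open>c = 1\<close>; hence both do for a
    common \<open>c\<close>.\<close>
  define A where "A = (\<lambda>t x c. lookup (pw m (\<lambda>d. w d c) (snd x) * xpow (bmon (fst x))) t)"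
  define B where "B = (\<lambda>u x c. lookup (w (fst x) c * xpow (snd x)) u)"
  have A0: "rows_indep (Mon s) (IX s) (\<lambda>t x. A t x 0)"
    unfolding rows_indep_def
  proof (intro allI impI ballI)
    fix q t assume q: "\<forall>x\<in>IX s. (\<Sum>t\<in>Mon s. q t * A t x 0) = 0" and t: "t \<in> Mon s"
    have "xpow t \<in> {p. (\<Sum>u\<in>Mon s. q u * lookup p u) = 0}"
      using q by (intro theta_span [OF subgroup_lookup_kernel _ t]) (auto simp: A_def w0)
    then have "(\<Sum>u\<in>Mon s. if u = t then q u else 0) = 0"
      by (simp add: lookup_xpow eq_commute [of t] if_distrib [of "\<lambda>x. _ * x"] cong: if_cong)
    then show "q t = 0" using t by simp
  qed
  have B1: "rows_indep (Mon (Suc s)) ({..<m} \<times> Mon s) (\<lambda>u x. B u x 1)"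
    unfolding rows_indep_def
  proof (intro allI impI ballI)
    fix q u assume q: "\<forall>x\<in>{..<m} \<times> Mon s. (\<Sum>u\<in>Mon (Suc s). q u * B u x 1) = 0"
      and u: "u \<in> Mon (Suc s)"
    have "xpow u \<in> {p. (\<Sum>u\<in>Mon (Suc s). q u * lookup p u) = 0}"
    proof (rule coversD [OF cov subgroup_lookup_kernel _ u])
      fix x t assume "x \<in> V" and t: "t \<in> Mon s"
      then obtain a where x: "x = (\<Sum>d<m. cst (a d) * v d)" using V by blast
      have "x * xpow t = (\<Sum>d<m. cst (a d) * (v d * xpow t))"
        by (simp add: x sum_distrib_right mult.assoc)
      moreover have "(\<Sum>u\<in>Mon (Suc s). q u * lookup (v d * xpow t) u) = 0" if "d < m" for d
        using q that t by (auto simp: B_def w1)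
      ultimately show "x * xpow t \<in> {p. (\<Sum>u\<in>Mon (Suc s). q u * lookup p u) = 0}"
        by (simp add: lookup_kernel_cst_sum)
    qed
    then have "(\<Sum>x\<in>Mon (Suc s). if x = u then q x else 0) = 0"
      by (simp add: lookup_xpow eq_commute [of u] if_distrib [of "\<lambda>x. _ * x"] cong: if_cong)
    then show "q u = 0" using u by simp
  qed
  have "finite {c. \<not> rows_indep (Mon s) (IX s) (\<lambda>t x. A t x c)}"
  proof (rule rows_indep_cofinite [where a = A, OF _ _ A0])
    show "polyfun (A t x)" for t x
      unfolding A_def by (intro polyfam_lookup polyfam_mult polyfam_const polyfam_pw w_fam)
  qed simp
  moreover have "finite {c. \<not> rows_indep (Mon (Suc s)) ({..<m} \<times> Mon s) (\<lambda>u x. B u x c)}"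
  proof (rule rows_indep_cofinite [where a = B, OF _ _ B1])
    show "polyfun (B u x)" for u x
      unfolding B_def by (intro polyfam_lookup polyfam_mult polyfam_const w_fam)
  qed simp
  ultimately have "finite ({c. \<not> rows_indep (Mon s) (IX s) (\<lambda>t x. A t x c)} \<union>
      {c. \<not> rows_indep (Mon (Suc s)) ({..<m} \<times> Mon s) (\<lambda>u x. B u x c)})" by simp
  then obtain c where "c \<notin> {c. \<not> rows_indep (Mon s) (IX s) (\<lambda>t x. A t x c)} \<union>
      {c. \<not> rows_indep (Mon (Suc s)) ({..<m} \<times> Mon s) (\<lambda>u x. B u x c)}"
    using inf ex_new_if_finite by blast
  then have cA: "rows_indep (Mon s) (IX s) (\<lambda>t x. A t x c)"
    and cB: "rows_indep (Mon (Suc s)) ({..<m} \<times> Mon s) (\<lambda>u x. B u x c)" by auto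
  \<comment> \<open>In degree \<open>s + 1\<close> the products with some factor \<open>w d\<close>
    are too few, so a nonzero functional \<open>q\<close> kills them all.\<close>
  have "finite {x \<in> IX (Suc s). card (fst x) < Suc s}" by simp
  from exists_dependency [OF this finite_Mon card_IX_less [OF b0], of "\<lambda>u x. A u x c"]
  obtain q where q: "\<exists>u\<in>Mon (Suc s). q u \<noteq> 0"
    "\<And>x. x \<in> {x \<in> IX (Suc s). card (fst x) < Suc s} \<Longrightarrow> (\<Sum>u\<in>Mon (Suc s). q u * A u x c) = 0"
    by blast
  \<comment> \<open>The functional on degree \<open>s\<close> induced by \<open>q\<close> through
    multiplication by \<open>w d\<close>. It vanishes on the columns of \<open>A\<close>, which
    span, so it is zero, and \<open>q\<close> kills all columns of \<open>B\<close>.\<close>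
  define qd where "qd = (\<lambda>d t. \<Sum>u\<in>Mon (Suc s). q u * B u (d, t) c)"
  have "qd d t = 0" if d: "d < m" and t: "t \<in> Mon s" for d t
  proof -
    have "(\<Sum>t\<in>Mon s. qd d t * A t x c) = 0" if xI: "x \<in> IX s" for x
    proof -
      obtain b e where be: "x = (b, e)" "(b, e) \<in> IX s" using xI by (metis surj_pair)
      define p where "p = pw m (\<lambda>d. w d c) e * xpow (bmon b)"
      have "keys (pw m (\<lambda>d. w d c) e) \<subseteq> Mon (\<Sum>i<m. e i)" by (rule keys_pw_Mon [OF w_keys])
      moreover have "keys (xpow (bmon b) :: 'a mpoly) \<subseteq> Mon (card b)"
        using be bmon_in_Mon by (auto simp: IX_def)
      moreover have "(\<Sum>i<m. e i) + card b = s" using be by (auto simp: IX_def mi_def)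
      ultimately have "keys p \<subseteq> Mon s" unfolding p_def using keys_mult_Mon by metis
      then have p: "p = (\<Sum>t\<in>Mon s. cst (lookup p t) * xpow t)" by (intro mpoly_expand) auto
      have "w d c * p = (\<Sum>t\<in>Mon s. cst (lookup p t) * (w d c * xpow t))"
        by (subst p) (simp add: sum_distrib_left mult.left_commute)
      then have "(\<Sum>u\<in>Mon (Suc s). q u * lookup (w d c * p) u) =
          (\<Sum>t\<in>Mon s. lookup p t * qd d t)"
        by (simp add: lookup_kernel_cst_sum qd_def B_def)
      moreover have "(\<Sum>u\<in>Mon (Suc s). q u * lookup (w d c * p) u) = 0"
        using q(2) [OF IX_theta_mult [OF be(2) d]]
        by (simp add: A_def pw_add pw_unit [OF d] p_def mult.assoc)
      ultimately show ?thesis by (simp add: A_def be(1) p_def mult.commute)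
    qed
    then show ?thesis using cA t unfolding rows_indep_def by blast
  qed
  then have "\<forall>x\<in>{..<m} \<times> Mon s. (\<Sum>u\<in>Mon (Suc s). q u * B u x c) = 0"
    by (auto simp: qd_def)
  then show False using cB q(1) unfolding rows_indep_def by blast
qed

end

subsection \<open>The degree two part of a minimal reduction\<close>

text \<open>Take a maximal independent subset of \<open>V\<close>. If it is small, zeros pad it to
  \<open>k\<close> elements, whence \<open>insert 0 V\<close>; otherwise the values of a linear
  functional can be prescribed on \<open>k + 1\<close> of its elements.\<close>

lemma span_or_functionals:
  fixes V :: "'a::field mpoly set"
  shows "(\<exists>v. (\<forall>i<k. v i \<in> insert 0 V) \<and> V \<subseteq> {\<Sum>i<k. cst (a i) * v i |a. True}) \<or>
    (\<exists>v. (\<forall>i<Suc k. v i \<in> V) \<and> (\<forall>a. \<exists>l :: 'a mpoly \<Rightarrow> 'a.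
      (\<forall>x y. l (x + y) = l x + l y) \<and> (\<forall>c x. l (cst c * x) = c * l x) \<and> (\<forall>i<Suc k. l (v i) = a i)))"
proof -
  interpret vs: vector_space "\<lambda>(c :: 'a) (p :: 'a mpoly). cst c * p"
    by unfold_locales (simp_all add: distrib_left distrib_right cst_add cst_mult mult.assoc)
  interpret vp: vector_space_pair "\<lambda>(c :: 'a) (p :: 'a mpoly). cst c * p" "(*) :: 'a \<Rightarrow> 'a \<Rightarrow> 'a"
    by unfold_locales (simp_all add: distrib_left distrib_right mult.assoc)
  obtain B where B: "B \<subseteq> V" "vs.independent B" "V \<subseteq> vs.span B"
    by (rule vs.maximal_independent_subset)
  show ?thesis
  proof (cases "finite B \<and> card B \<le> k")
    case True
    then obtain f where f: "bij_betw f {..<card B} B"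
      by (metis atLeast0LessThan ex_bij_betw_nat_finite)
    define v where "v = (\<lambda>i. if i < card B then f i else 0)"
    have "V \<subseteq> {\<Sum>i<k. cst (a i) * v i |a. True}"
    proof
      fix x assume "x \<in> V"
      then obtain u where u: "x = (\<Sum>b\<in>B. cst (u b) * b)"
        using B(3) vs.span_finite True by (auto simp: image_iff)
      also have "\<dots> = (\<Sum>i<card B. cst (u (f i)) * f i)"
        using sum.reindex_bij_betw [OF f, of "\<lambda>b. cst (u b) * b"] by simp
      also have "\<dots> = (\<Sum>i<k. cst (u (f i)) * v i)"
        using True by (intro sum.mono_neutral_cong_left) (auto simp: v_def)
      finally show "x \<in> {\<Sum>i<k. cst (a i) * v i |a. True}"
        by (intro CollectI exI [of _ "\<lambda>i. u (f i)"]) simp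
    qed
    moreover have "\<forall>i<k. v i \<in> insert 0 V"
      using f B(1) by (auto simp: v_def bij_betw_def)
    ultimately show ?thesis by blast
  next
    case False
    then obtain B' where B': "B' \<subseteq> B" "finite B'" "card B' = Suc k"
      by (metis infinite_arbitrarily_large not_less_eq_eq obtain_subset_with_card_n)
    obtain f where f: "bij_betw f {..<Suc k} B'"
      using B' by (metis atLeast0LessThan ex_bij_betw_nat_finite)
    have ind: "vs.independent B'" using vs.independent_mono [OF B(2) B'(1)] .
    have "\<exists>l. (\<forall>x y. l (x + y) = l x + l y) \<and> (\<forall>c x. l (cst c * x) = c * l x) \<and>
        (\<forall>i<Suc k. l (f i) = a i)" for a :: "nat \<Rightarrow> 'a"
    proof -
      define h where "h = (\<lambda>x. a (the_inv_into {..<Suc k} f x))"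
      obtain l where l: "Vector_Spaces.linear (\<lambda>c p. cst c * p) (*) l" "\<forall>x\<in>B'. l x = h x"
        using vp.linear_independent_extend [OF ind, of h] by blast
      have "l (f i) = a i" if "i < Suc k" for i
        using l(2) f that the_inv_into_f_f [of f "{..<Suc k}" i] by (auto simp: bij_betw_def h_def)
      then show ?thesis using l(1) unfolding Vector_Spaces.linear_iff by blast
    qed
    moreover have "\<forall>i<Suc k. f i \<in> V" using f B'(1) B(1) by (auto simp: bij_betw_def)
    ultimately show ?thesis by blast
  qed
qed

context spec_ferrers
begin

lemma card_bounded_exponents:
  "finite {u :: nat \<Rightarrow>\<^sub>0 nat. keys u \<subseteq> {1..m} \<and> (\<forall>i. lookup u i \<le> N)}"
  "card {u :: nat \<Rightarrow>\<^sub>0 nat. keys u \<subseteq> {1..m} \<and> (\<forall>i. lookup u i \<le> N)} \<le> (N + 1) ^ m"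
proof -
  define Z where "Z = {u :: nat \<Rightarrow>\<^sub>0 nat. keys u \<subseteq> {1..m} \<and> (\<forall>i. lookup u i \<le> N)}"
  define h where "h = (\<lambda>u :: nat \<Rightarrow>\<^sub>0 nat. restrict (lookup u) {1..m})"
  have inj: "inj_on h Z"
  proof (rule inj_onI)
    fix u u' assume u: "u \<in> Z" "u' \<in> Z" and eq: "h u = h u'"
    have "lookup u i = lookup u' i" for i
    proof (cases "i \<in> {1..m}")
      case True
      then show ?thesis using fun_cong [OF eq, of i] by (simp add: h_def)
    next
      case False
      then show ?thesis using u unfolding Z_def by (metis (mono_tags) in_keys_iff mem_Collect_eq subsetD)
    qed
    then show "u = u'" by (rule poly_mapping_eqI)
  qed
  have sub: "h ` Z \<subseteq> PiE {1..m} (\<lambda>_. {..N})" by (auto simp: h_def Z_def)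
  have fin: "finite (PiE {1..m} (\<lambda>_. {..N}))" by (intro finite_PiE) auto
  show "finite {u :: nat \<Rightarrow>\<^sub>0 nat. keys u \<subseteq> {1..m} \<and> (\<forall>i. lookup u i \<le> N)}"
    using inj_on_finite [OF inj sub fin] by (simp add: Z_def)
  have "card Z \<le> card (PiE {1..m} (\<lambda>_. {..N}))" by (rule card_inj_on_le [OF inj sub fin])
  then show "card {u :: nat \<Rightarrow>\<^sub>0 nat. keys u \<subseteq> {1..m} \<and> (\<forall>i. lookup u i \<le> N)} \<le> (N + 1) ^ m"
    by (simp add: Z_def card_PiE)
qed

lemma lookup_le_tdeg: "lookup u i \<le> tdeg u"
proof (cases "i \<in> keys u")
  case True
  then show ?thesis by (auto simp: wsum_def intro: member_le_sum)
qed (simp add: in_keys_iff)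

text \<open>There are more products than monomials: exponents up to \<open>A\<close> in
  \<open>Suc m\<close> quadrics give (A + 1)^(m + 1) products, while at most A (A + 1)^m monomials
  in \<open>m\<close> variables are available to them.\<close>

lemma quadrics_dependent:
  fixes v :: "nat \<Rightarrow> 'a::field mpoly"
  assumes v: "\<And>i. i < Suc m \<Longrightarrow> keys (v i) \<subseteq> Mon (Suc 0)"
  shows "\<exists>D S c. 0 < D \<and> finite S \<and> (\<forall>\<alpha>\<in>S. (\<Sum>i<Suc m. \<alpha> i) = D) \<and>
    (\<forall>\<alpha>\<in>S. \<forall>\<beta>\<in>S. (\<forall>i<Suc m. \<alpha> i = \<beta> i) \<longrightarrow> \<alpha> = \<beta>) \<and>
    (\<exists>\<alpha>\<in>S. c \<alpha> \<noteq> 0) \<and> (\<Sum>\<alpha>\<in>S. cst (c \<alpha>) * pw (Suc m) v \<alpha>) = 0"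
proof -
  \<comment> \<open>This value turns the bound (2 (m + 1) (A + 1))^m for the number of monomials
    into A (A + 1)^m.\<close>
  define A where "A = (2 * Suc m) ^ m"
  define S where "S = PiE {..<Suc m} (\<lambda>_. {..A})"
  define N where "N = 2 * (Suc m * A)"
  define Z where "Z = {u :: nat \<Rightarrow>\<^sub>0 nat. keys u \<subseteq> {1..m} \<and> (\<forall>i. lookup u i \<le> N)}"
  have finS: "finite S" unfolding S_def by (intro finite_PiE) auto
  have "card Z \<le> (N + 1) ^ m" unfolding Z_def by (rule card_bounded_exponents)
  also have "\<dots> \<le> (2 * Suc m * (A + 1)) ^ m" by (rule power_mono) (auto simp: N_def)
  also have "\<dots> = (2 * Suc m) ^ m * (A + 1) ^ m" by (rule power_mult_distrib)
  also have "\<dots> = A * (A + 1) ^ m" by (simp only: A_def)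
  also have "\<dots> < (A + 1) * (A + 1) ^ m" by simp
  also have "\<dots> = card S" by (simp add: S_def card_PiE)
  finally have card: "card Z < card S" .
  have keys: "keys (pw (Suc m) v \<alpha>) \<subseteq> Mon (\<Sum>i<Suc m. \<alpha> i)" for \<alpha> by (rule keys_pw_Mon [OF v])
  have keysZ: "keys (pw (Suc m) v \<alpha>) \<subseteq> Z" if \<alpha>: "\<alpha> \<in> S" for \<alpha>
  proof
    fix u assume "u \<in> keys (pw (Suc m) v \<alpha>)"
    then have u: "u \<in> Mon (\<Sum>i<Suc m. \<alpha> i)" using keys by blast
    have "(\<Sum>i<Suc m. \<alpha> i) \<le> (\<Sum>i<Suc m. A)"
      using \<alpha> unfolding S_def by (intro sum_mono) (metis PiE_mem atMost_iff)
    then have "2 * (\<Sum>i<Suc m. \<alpha> i) \<le> N" by (simp add: N_def)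
    then have "tdeg u \<le> N" using Mon_tdeg [OF u] by simp
    then show "u \<in> Z" using Mon_keys [OF u] lookup_le_tdeg [of u] le_trans unfolding Z_def by blast
  qed
  have "finite Z" unfolding Z_def by (rule card_bounded_exponents)
  from exists_dependency [OF this finS card, of "\<lambda>\<alpha>. lookup (pw (Suc m) v \<alpha>)"]
  obtain c where c: "\<exists>\<alpha>\<in>S. c \<alpha> \<noteq> 0" "\<And>u. u \<in> Z \<Longrightarrow> (\<Sum>\<alpha>\<in>S. c \<alpha> * lookup (pw (Suc m) v \<alpha>) u) = 0"
    by blast
  have c0: "(\<Sum>\<alpha>\<in>S. c \<alpha> * lookup (pw (Suc m) v \<alpha>) u) = 0" for u
  proof (cases "u \<in> Z")
    case False
    then have "\<forall>\<alpha>\<in>S. lookup (pw (Suc m) v \<alpha>) u = 0" using keysZ by (meson in_keys_iff subsetD)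
    then show ?thesis by simp
  qed (rule c(2))
  obtain \<alpha>0 where \<alpha>0: "\<alpha>0 \<in> S" "c \<alpha>0 \<noteq> 0" using c(1) by blast
  \<comment> \<open>The products are homogeneous, so the terms of the same total exponent as
    \<open>\<alpha>0\<close> are a relation by themselves.\<close>
  define D where "D = (\<Sum>i<Suc m. \<alpha>0 i)"
  define SD where "SD = {\<alpha> \<in> S. (\<Sum>i<Suc m. \<alpha> i) = D}"
  have zero: "(\<Sum>\<alpha>\<in>SD. cst (c \<alpha>) * pw (Suc m) v \<alpha>) = 0"
  proof (rule poly_mapping_eqI)
    fix u
    have off: "lookup (pw (Suc m) v \<alpha>) u = 0" if "tdeg u \<noteq> 2 * (\<Sum>i<Suc m. \<alpha> i)" for \<alpha>
      using keys [of \<alpha>] Mon_tdeg that by (metis in_keys_iff subsetD)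
    have "(\<Sum>\<alpha>\<in>SD. c \<alpha> * lookup (pw (Suc m) v \<alpha>) u) = 0"
    proof (cases "tdeg u = 2 * D")
      case True
      have "(\<Sum>\<alpha>\<in>SD. c \<alpha> * lookup (pw (Suc m) v \<alpha>) u) = (\<Sum>\<alpha>\<in>S. c \<alpha> * lookup (pw (Suc m) v \<alpha>) u)"
      proof (rule sum.mono_neutral_left [OF finS])
        show "SD \<subseteq> S" by (auto simp: SD_def)
        show "\<forall>\<alpha>\<in>S - SD. c \<alpha> * lookup (pw (Suc m) v \<alpha>) u = 0"
        proof
          fix \<alpha> assume "\<alpha> \<in> S - SD"
          then have "tdeg u \<noteq> 2 * (\<Sum>i<Suc m. \<alpha> i)" using True by (auto simp: SD_def simp del: sum.lessThan_Suc)
          then show "c \<alpha> * lookup (pw (Suc m) v \<alpha>) u = 0" using off by simp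
        qed
      qed
      then show ?thesis using c0 by simp
    next
      case False
      then show ?thesis by (intro sum.neutral) (simp add: SD_def off del: sum.lessThan_Suc)
    qed
    then show "lookup (\<Sum>\<alpha>\<in>SD. cst (c \<alpha>) * pw (Suc m) v \<alpha>) u = lookup 0 u"
      by (simp add: lookup_sum)
  qed
  have inj: "\<alpha> = \<beta>" if "\<alpha> \<in> SD" "\<beta> \<in> SD" "\<forall>i<Suc m. \<alpha> i = \<beta> i" for \<alpha> \<beta>
    using that unfolding SD_def S_def by (intro PiE_ext) auto
  have "D \<noteq> 0"
  proof
    assume "D = 0"
    then have triv: "\<forall>i<Suc m. \<alpha> i = 0" if "\<alpha> \<in> SD" for \<alpha>
      using that unfolding SD_def by (simp del: sum.lessThan_Suc)
    have "\<alpha>0 \<in> SD" using \<alpha>0 by (simp add: SD_def D_def)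
    then have "SD = {\<alpha>0}" using inj triv by (metis (no_types, lifting) equalityI insertI1 singletonD subsetI)
    moreover have "pw (Suc m) v \<alpha>0 = 1" using triv [OF \<open>\<alpha>0 \<in> SD\<close>] by (simp add: pw_def)
    ultimately have "cst (c \<alpha>0) = 0" using zero by simp
    then have "lookup (cst (c \<alpha>0)) 0 = 0" by simp
    then show False using \<alpha>0 by (simp add: cst_def)
  qed
  moreover have "\<exists>\<alpha>\<in>SD. c \<alpha> \<noteq> 0" using \<alpha>0 by (auto simp: SD_def D_def)
  moreover have "finite SD" "\<forall>\<alpha>\<in>SD. (\<Sum>i<Suc m. \<alpha> i) = D" using finS by (simp_all add: SD_def)
  ultimately show ?thesis using zero inj by (intro exI [of _ D] exI [of _ SD] exI [of _ c]) blast
qed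

end

lemma pw_decrease:
  assumes "i < l" "0 < \<alpha> i"
  shows "pw l g \<alpha> = g i * pw l g (\<alpha>(i := \<alpha> i - 1))"
    "(\<Sum>j<l. \<alpha> j) = Suc (\<Sum>j<l. (\<alpha>(i := \<alpha> i - 1)) j)"
proof -
  define \<beta> where "\<beta> = \<alpha>(i := \<alpha> i - 1)"
  have \<alpha>: "\<alpha> = (\<lambda>j. (if j = i then 1 else 0) + \<beta> j)" using assms(2) by (auto simp: \<beta>_def)
  have "pw l g \<alpha> = g i * pw l g \<beta>" by (subst \<alpha>) (simp only: pw_add pw_unit [OF assms(1)])
  then show "pw l g \<alpha> = g i * pw l g (\<alpha>(i := \<alpha> i - 1))" by (simp add: \<beta>_def)
  have "(\<Sum>j<l. \<alpha> j) = Suc (\<Sum>j<l. \<beta> j)"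
    by (subst \<alpha>) (use assms(1) in \<open>simp add: sum.distrib\<close>)
  then show "(\<Sum>j<l. \<alpha> j) = Suc (\<Sum>j<l. (\<alpha>(i := \<alpha> i - 1)) j)" by (simp add: \<beta>_def)
qed

context spec_ferrers
begin

text \<open>A relation of degree \<open>D\<close> among the \<open>v i\<close>, not vanishing at \<open>a\<close>, shows that \<open>w\<^sup>D\<close> lies in
  the ideal generated by the hyperplane \<open>l = 0\<close>, where \<open>l w = 1\<close>.\<close>

lemma covers_hyperplane:
  fixes V :: "'a::field mpoly set" and l :: "'a mpoly \<Rightarrow> 'a"
  assumes V: "\<And>x y. x \<in> V \<Longrightarrow> y \<in> V \<Longrightarrow> x - y \<in> V" "\<And>x c. x \<in> V \<Longrightarrow> cst c * x \<in> V"
    "\<And>x. x \<in> V \<Longrightarrow> keys x \<subseteq> Mon (Suc 0)"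
    and l: "\<And>x y. l (x + y) = l x + l y" "\<And>c x. l (cst c * x) = c * l x"
    and cov: "covers V r"
    and v: "\<And>i. i < p \<Longrightarrow> v i \<in> V" "\<And>i. i < p \<Longrightarrow> l (v i) = a i"
    and D: "0 < D" "finite S" "\<And>\<alpha>. \<alpha> \<in> S \<Longrightarrow> (\<Sum>i<p. \<alpha> i) = D"
    and rel: "(\<Sum>\<alpha>\<in>S. cst (c \<alpha>) * pw p v \<alpha>) = 0"
    and nz: "(\<Sum>\<alpha>\<in>S. c \<alpha> * pw p a \<alpha>) \<noteq> 0"
  obtains w where "w \<in> V" "l w \<noteq> 0" "covers {x \<in> V. l x = 0} (r + D - 1)"
proof -
  obtain \<alpha> where \<alpha>: "\<alpha> \<in> S" "pw p a \<alpha> \<noteq> 0" using nz by (metis (no_types, lifting) mult_zero_right sum.neutral)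
  have "\<not> (\<forall>i<p. \<alpha> i = 0)"
  proof
    assume "\<forall>i<p. \<alpha> i = 0"
    then have "(\<Sum>i<p. \<alpha> i) = 0" by simp
    then show False using D(1) D(3) [OF \<alpha>(1)] by simp
  qed
  then obtain i0 where i0: "i0 < p" "\<alpha> i0 \<noteq> 0" by blast
  have "a i0 \<noteq> 0"
  proof
    assume "a i0 = 0"
    then have "pw p a \<alpha> = 0" 
      unfolding pw_def using i0 by (subst prod.remove [of _ i0]) (auto simp: power_0_left)
    then show False using \<alpha> by blast
  qed
  define w where "w = cst (1 / a i0) * v i0"
  have w: "w \<in> V" "l w = 1" using V(2) v i0 l(2) \<open>a i0 \<noteq> 0\<close> by (auto simp: w_def)
  have wk: "keys (w ^ k) \<subseteq> Mon k" for k by (rule keys_power_Mon [OF V(3) [OF w(1)]])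
  define V' where "V' = {x \<in> V. l x = 0}"
  have V'_cst: "cst c * x \<in> V'" if "x \<in> V'" for c x using that V(2) l(2) by (simp add: V'_def)
  have l_diff: "l (x - y) = l x - l y" for x y
    using l(1) [of "x - y" y] by simp
  have V'_proj: "x - cst (l x) * w \<in> V'" if "x \<in> V" for x
    using that V(1,2) w by (simp add: V'_def l_diff l(2))
  have "covers V' (r + D - 1)"
    unfolding covers_def
  proof (intro allI impI ballI)
    fix U u assume U: "add_subgroup U" and VU: "\<forall>x\<in>V'. \<forall>t\<in>Mon (r + D - 1). x * xpow t \<in> U"
      and u: "u \<in> Mon (Suc (r + D - 1))"
    have VF: "x * f \<in> U" if x: "x \<in> V'" and f: "keys f \<subseteq> Mon (r + D - 1)" for x f
    proof -
      have "x * f = (\<Sum>t\<in>Mon (r + D - 1). (cst (lookup f t) * x) * xpow t)"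
        by (subst mpoly_expand [OF finite_Mon f]) (simp add: sum_distrib_left mult_ac)
      also have "\<dots> \<in> U" using VU V'_cst [OF x] by (intro add_subgroup_sum [OF U]) auto
      finally show ?thesis .
    qed
    \<comment> \<open>Modulo the hyperplane each \<open>v i\<close> is \<open>a i\<close> times
      \<open>w\<close>, so a product of \<open>k\<close> of them is \<open>pw p a \<alpha>\<close>
      times \<open>w ^ k\<close>; the factor \<open>g\<close> fills the degree up to
      \<open>r + D\<close>.\<close>
    have T: "pw p v \<alpha> * g - cst (pw p a \<alpha>) * (w ^ k * g) \<in> U"
      if "(\<Sum>i<p. \<alpha> i) = k" "k \<le> D" "keys g \<subseteq> Mon (r + D - k)" for k \<alpha> g
      using that
    proof (induction k arbitrary: \<alpha> g)
      case 0
      then have "\<forall>i<p. \<alpha> i = 0" by simp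
      then have "pw p h \<alpha> = 1" for h :: "nat \<Rightarrow> 'b::comm_ring_1" by (simp add: pw_def)
      then have "pw p v \<alpha> = 1" "pw p a \<alpha> = 1" using \<open>\<forall>i<p. \<alpha> i = 0\<close> by (simp_all add: pw_def)
      then show ?case using add_subgroup_0 [OF U] by simp
    next
      case (Suc k)
      have "\<exists>i<p. 0 < \<alpha> i"
      proof (rule ccontr)
        assume "\<not> ?thesis"
        then have "(\<Sum>i<p. \<alpha> i) = 0" by simp
        then show False using Suc.prems by simp
      qed
      then obtain i where i: "i < p" "0 < \<alpha> i" by blast
      define \<beta> where "\<beta> = \<alpha>(i := \<alpha> i - 1)"
      have \<beta>: "(\<Sum>j<p. \<beta> j) = k" "pw p v \<alpha> = v i * pw p v \<beta>" "pw p a \<alpha> = a i * pw p a \<beta>"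
        using pw_decrease [of i p \<alpha>, OF i] Suc.prems(1) by (auto simp: \<beta>_def)
      have vi: "v i \<in> V" "keys (v i) \<subseteq> Mon (Suc 0)" using v V(3) i by auto
      have "keys (v i * g) \<subseteq> Mon (Suc 0 + (r + D - Suc k))"
        using keys_mult_Mon [OF vi(2) Suc.prems(3)] .
      then have "keys (v i * g) \<subseteq> Mon (r + D - k)" using Suc.prems(2) by (simp add: Suc_diff_Suc)
      then have 1: "pw p v \<beta> * (v i * g) - cst (pw p a \<beta>) * (w ^ k * (v i * g)) \<in> U"
        using Suc.IH [OF \<beta>(1)] Suc.prems(2) by simp
      have "keys (w ^ k * g) \<subseteq> Mon (k + (r + D - Suc k))"
        by (rule keys_mult_Mon [OF wk Suc.prems(3)])
      then have "keys (cst (pw p a \<beta>) * (w ^ k * g)) \<subseteq> Mon (r + D - 1)"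
        using keys_cst_mult [of "pw p a \<beta>" "w ^ k * g"] Suc.prems(2) by auto
      then have 2: "(v i - cst (a i) * w) * (cst (pw p a \<beta>) * (w ^ k * g)) \<in> U"
        using V'_proj [OF vi(1)] v(2) [OF i(1)] VF by simp
      have "pw p v \<alpha> * g - cst (pw p a \<alpha>) * (w ^ Suc k * g) =
          (pw p v \<beta> * (v i * g) - cst (pw p a \<beta>) * (w ^ k * (v i * g))) +
          (v i - cst (a i) * w) * (cst (pw p a \<beta>) * (w ^ k * g))"
        unfolding \<beta>(2,3) cst_mult by (simp add: algebra_simps)
      then show ?case using add_subgroup_add [OF U 1 2] by simp
    qed
    define P where "P = (\<Sum>\<alpha>\<in>S. c \<alpha> * pw p a \<alpha>)"
    \<comment> \<open>Summed over the relation, the products of the \<open>v i\<close> vanish, while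
      their replacements add up to \<open>P * w ^ D\<close> with \<open>P\<close>
      invertible.\<close>
    have wD: "w ^ D * g \<in> U" if g: "keys g \<subseteq> Mon r" for g
    proof -
      define g' where "g' = cst (1 / P) * g"
      have "keys (cst (c \<alpha>) * g') \<subseteq> Mon (r + D - D)" for \<alpha>
        using keys_cst_mult [of "c \<alpha>" g'] keys_cst_mult [of "1 / P" g] g by (auto simp: g'_def)
      then have "(\<Sum>\<alpha>\<in>S. pw p v \<alpha> * (cst (c \<alpha>) * g') -
          cst (pw p a \<alpha>) * (w ^ D * (cst (c \<alpha>) * g'))) \<in> U"
        using D(3) by (intro add_subgroup_sum [OF U] T) auto
      also have "(\<Sum>\<alpha>\<in>S. pw p v \<alpha> * (cst (c \<alpha>) * g') - cst (pw p a \<alpha>) * (w ^ D * (cst (c \<alpha>) * g'))) =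
          (\<Sum>\<alpha>\<in>S. cst (c \<alpha>) * pw p v \<alpha>) * g' - (\<Sum>\<alpha>\<in>S. cst (c \<alpha> * pw p a \<alpha>)) * (w ^ D * g')"
        by (simp add: sum_subtractf sum_distrib_left sum_distrib_right cst_mult mult_ac)
      also have "(\<Sum>\<alpha>\<in>S. cst (c \<alpha> * pw p a \<alpha>)) = cst P"
        unfolding P_def using D(2) by (induction S) (simp_all add: cst_add)
      also have "cst P * (w ^ D * g') = w ^ D * g"
      proof -
        have "cst P * cst (1 / P) = 1" using nz by (simp add: P_def cst_mult [symmetric])
        then show ?thesis by (simp add: g'_def mult.left_commute [of "cst P"] mult.assoc [symmetric])
      qed
      finally have "- (w ^ D * g) \<in> U" by (simp add: rel)
      then show ?thesis using add_subgroup_uminus [OF U] by force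
    qed
    \<comment> \<open>Descending induction on \<open>k\<close>: write \<open>g\<close> through
      products of elements \<open>x\<close> of \<open>V\<close> with monomials and split
      \<open>x\<close> into its part in the hyperplane, which leads into \<open>U\<close>, and
      \<open>l x\<close> times \<open>w\<close>, which raises the power of \<open>w\<close>. At
      \<open>k = 0\<close> the power of \<open>w\<close> is gone.\<close>
    have claim: "\<forall>g. keys g \<subseteq> Mon (r + D - k) \<longrightarrow> w ^ k * g \<in> U" if "k \<le> D" for k
      using that
    proof (induction k rule: inc_induct)
      case base
      then show ?case using wD by simp
    next
      case (step k)
      have sk: "r + D - k = Suc (r + D - Suc k)" using step.hyps by simp
      have mon: "w ^ k * (cst e * xpow u) \<in> U" if u: "u \<in> Mon (r + D - k)" for e u
      proof -
        define U' where "U' = {p. w ^ k * (cst e * p) \<in> U}"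
        have "xpow u \<in> U'"
        proof (rule coversD [of V "r + D - Suc k"])
          show "covers V (r + D - Suc k)" using step.hyps by (intro covers_mono [OF _ cov]) simp
          show "add_subgroup U'"
            using U by (auto simp: U'_def add_subgroup_def right_diff_distrib)
          show "u \<in> Mon (Suc (r + D - Suc k))" using u sk by simp
          fix x t assume x: "x \<in> V" and t: "t \<in> Mon (r + D - Suc k)"
          have "keys (w ^ k * xpow t) \<subseteq> Mon (k + (r + D - Suc k))"
            by (rule keys_mult_Mon [OF wk]) (use t in simp)
          then have "keys (cst e * (w ^ k * xpow t)) \<subseteq> Mon (r + D - 1)"
            using keys_cst_mult [of e "w ^ k * xpow t"] step.hyps by auto
          then have 1: "(x - cst (l x) * w) * (cst e * (w ^ k * xpow t)) \<in> U"
            using VF V'_proj [OF x] by blast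
          have "keys (cst (e * l x) * xpow t) \<subseteq> Mon (r + D - Suc k)"
            using keys_cst_mult [of "e * l x" "xpow t"] t by auto
          then have 2: "w ^ Suc k * (cst (e * l x) * xpow t) \<in> U" using step.IH by blast
          have "w ^ k * (cst e * (x * xpow t)) =
              (x - cst (l x) * w) * (cst e * (w ^ k * xpow t)) + w ^ Suc k * (cst (e * l x) * xpow t)"
            by (simp add: cst_mult algebra_simps)
          then show "x * xpow t \<in> U'" using add_subgroup_add [OF U 1 2] by (simp add: U'_def)
        qed
        then show ?thesis by (simp add: U'_def)
      qed
      show ?case
      proof (intro allI impI)
        fix g :: "'a mpoly" assume g: "keys g \<subseteq> Mon (r + D - k)"
        have "w ^ k * g = (\<Sum>u\<in>Mon (r + D - k). w ^ k * (cst (lookup g u) * xpow u))"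
          by (subst mpoly_expand [OF finite_Mon g]) (simp add: sum_distrib_left)
        also have "\<dots> \<in> U" using mon by (intro add_subgroup_sum [OF U]) auto
        finally show "w ^ k * g \<in> U" .
      qed
    qed
    have "keys (xpow u :: 'a mpoly) \<subseteq> Mon (r + D - 0)" using u D(1) by simp
    then have "w ^ 0 * xpow u \<in> U" using claim [of 0] by blast
    then show "xpow u \<in> U" by simp
  qed
  then show thesis using that [of w] w by (simp add: V'_def)
qed

text \<open>Terms of \<open>I\<close> outside degree 2 lie in the product of \<open>I\<close> with
  the ideal of the variables; splitting off a variable later yields a multiplier without constant
  term.\<close>

lemma I_keys_decompose:
  assumes p: "p \<in> I" and x: "x \<in> keys p" "tdeg x \<noteq> 2"
  obtains u i y where "u \<in> Mon (Suc 0)" "x = u + (single i 1 + y)" "i \<in> {1..m}" "keys y \<subseteq> {1..m}"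
proof -
  obtain u z where u: "u \<in> Mon (Suc 0)" "x = u + z" "keys z \<subseteq> {1..m}"
    using MI_R_keys [OF _ x(1)] p unfolding I_eq_MI by metis
  have "z \<noteq> 0" using u x(2) Mon_tdeg [OF u(1)] by auto
  then obtain i where i: "i \<in> keys z" by (metis all_not_in_conv keys_eq_empty)
  have "z = single i 1 + (z - single i 1)"
    by (rule poly_mapping_eqI)
       (use i in \<open>auto simp: lookup_add lookup_minus lookup_single when_def in_keys_iff\<close>)
  then have "x = u + (single i 1 + (z - single i 1))" using u(2) by metis
  moreover have "keys (z - single i 1) \<subseteq> keys z"
    by (auto simp: in_keys_iff lookup_minus)
  ultimately show thesis using u i by (intro that [OF u(1)]) blast+
qed

text \<open>If the degree-two part of \<open>J\<close> had dimension above \<open>m\<close>, the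
  elements of \<open>J\<close> whose degree-two part lies in a suitable hyperplane would form a
  strictly smaller reduction.\<close>

lemma minimal_reduction_dim:
  fixes J :: "'a::field mpoly set"
  assumes inf: "infinite (UNIV :: 'a set)" and min: "minimal_reduction R J I"
  obtains v where "\<And>d. d < m \<Longrightarrow> keys (v d) \<subseteq> Mon (Suc 0)"
    "hc 2 ` J \<subseteq> {\<Sum>d<m. cst (a d) * v d |a. True}"
proof -
  have J: "is_ideal R J" "J \<subseteq> I" "\<exists>r. MI R (Suc r) = MI J r"
    using min unfolding minimal_reduction_def is_reduction_iff by auto
  then obtain r where r: "MI R (Suc r) = MI J r" by blast
  note sJ = ideal_subgroup [OF J(1)]
  have keysV: "keys x \<subseteq> Mon (Suc 0)" if "x \<in> hc 2 ` J" for x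
    using that keys_hc_I J(2) by blast
  show thesis
    using span_or_functionals [of m "hc 2 ` J"]
  proof (elim disjE exE conjE)
    fix v assume v: "\<forall>i<m. v i \<in> insert 0 (hc 2 ` J)"
      "hc 2 ` J \<subseteq> {\<Sum>i<m. cst (a i) * v i |a. True}"
    have "keys (v d) \<subseteq> Mon (Suc 0)" if "d < m" for d using v(1) that keysV by fastforce
    then show thesis using that v(2) by blast
  next
    fix v :: "nat \<Rightarrow> 'a mpoly"
    assume v: "\<forall>i<Suc m. v i \<in> hc 2 ` J"
      and fn: "\<forall>a. \<exists>l. (\<forall>x y. l (x + y) = l x + l y) \<and> (\<forall>c x. l (cst c * x) = c * l x) \<and>
        (\<forall>i<Suc m. l (v i) = a i)"
    have keysv: "keys (v i) \<subseteq> Mon (Suc 0)" if "i < Suc m" for i using v that keysV by blast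
    have "\<exists>D S c. 0 < D \<and> finite S \<and> (\<forall>\<alpha>\<in>S. (\<Sum>i<Suc m. \<alpha> i) = D) \<and>
      (\<forall>\<alpha>\<in>S. \<forall>\<beta>\<in>S. (\<forall>i<Suc m. \<alpha> i = \<beta> i) \<longrightarrow> \<alpha> = \<beta>) \<and>
      (\<exists>\<alpha>\<in>S. c \<alpha> \<noteq> 0) \<and> (\<Sum>\<alpha>\<in>S. cst (c \<alpha>) * pw (Suc m) v \<alpha>) = 0"
      by (rule quadrics_dependent) (rule keysv)
    then obtain D S c where D: "0 < D" "finite S" "\<forall>\<alpha>\<in>S. (\<Sum>i<Suc m. \<alpha> i) = D"
      "\<forall>\<alpha>\<in>S. \<forall>\<beta>\<in>S. (\<forall>i<Suc m. \<alpha> i = \<beta> i) \<longrightarrow> \<alpha> = \<beta>"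
      "\<exists>\<alpha>\<in>S. c \<alpha> \<noteq> 0" "(\<Sum>\<alpha>\<in>S. cst (c \<alpha>) * pw (Suc m) v \<alpha>) = 0"
      by (elim exE conjE)
    obtain a where a: "(\<Sum>\<alpha>\<in>S. c \<alpha> * pw (Suc m) a \<alpha>) \<noteq> 0"
      using exists_nonvanishing_point [OF inf D(2) _ D(5), of "Suc m"] D(4) by blast
    obtain l where l: "\<And>x y. l (x + y) = l x + l y" "\<And>c x. l (cst c * x) = c * l x"
      "\<And>i. i < Suc m \<Longrightarrow> l (v i) = a i" using fn by blast
    have V1: "x - y \<in> hc 2 ` J" if xy: "x \<in> hc 2 ` J" "y \<in> hc 2 ` J" for x y
    proof -
      obtain p q where "p \<in> J" "q \<in> J" "x = hc 2 p" "y = hc 2 q" using xy by blast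
      then show ?thesis using add_subgroup_diff [OF sJ] by (simp add: hc_diff [symmetric])
    qed
    have V2: "cst e * x \<in> hc 2 ` J" if x: "x \<in> hc 2 ` J" for x e
    proof -
      obtain p where "p \<in> J" "x = hc 2 p" using x by blast
      then show ?thesis using is_ideal_mult [OF J(1) cst_in_poly_ring] by (simp add: hc_cst_mult [symmetric])
    qed
    obtain w N where w: "w \<in> hc 2 ` J" "l w \<noteq> 0" and cov: "covers {x \<in> hc 2 ` J. l x = 0} N"
    proof (rule covers_hyperplane [where v = v and a = a and p = "Suc m", OF V1 V2 keysV l(1,2) reduction_covers [OF r] _ l(3) D(1,2) _ D(6) a])
      show "v i \<in> hc 2 ` J" if "i < Suc m" for i using v that by blast
      show "(\<Sum>i<Suc m. \<alpha> i) = D" if "\<alpha> \<in> S" for \<alpha> using D(3) that by blast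
    qed
    \<comment> \<open>An ideal by \<open>hc_mult_low\<close>, since elements of \<open>I\<close>
      have no terms below degree 2.\<close>
    define J' where "J' = {p \<in> J. l (hc 2 p) = 0}"
    have l_diff: "l (x - y) = l x - l y" for x y
      using l(1) [of "x - y" y] by simp
    have J': "is_ideal R J'"
    proof (rule is_idealI)
      show "J' \<subseteq> R" using is_ideal_subset [OF J(1)] by (auto simp: J'_def)
      have "l 0 = 0" using l_diff [of 0 0] by simp
      then show "add_subgroup J'"
        using sJ by (auto simp: J'_def add_subgroup_def hc_diff l_diff)
      fix x p :: "'a mpoly" assume x: "x \<in> R" and p: "p \<in> J'"
      have "hc 2 (x * p) = cst (lookup x 0) * hc 2 p"
        using p J(2) I_keys_tdeg by (intro hc_mult_low) (auto simp: J'_def)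
      then show "x * p \<in> J'" using p x is_ideal_mult [OF J(1)] by (simp add: J'_def l(2))
    qed
    note sJ' = ideal_subgroup [OF J']
    obtain k where k: "r \<le> k" "N \<le> k" by (metis max.cobounded1 max.cobounded2)
    have cov': "covers {x \<in> hc 2 ` J. l x = 0} k" using covers_mono [OF k(2) cov] .
    have rk: "MI R (Suc k) = MI J k" using reduction_mono [OF J(1,2) r k(1)] .
    have subJI: "J' \<subseteq> I" using J(2) by (auto simp: J'_def)
    have "MI R (Suc k) = MI J' k"
    proof
      show "MI J' k \<subseteq> MI R (Suc k)" by (rule MI_subset_power [OF subJI])
      show "MI R (Suc k) \<subseteq> MI J' k"
      proof (rule MI_R_least [OF MI_ideal [OF J']])
        fix u assume u: "u \<in> Mon (Suc k)"
        show "xpow u \<in> MI J' k"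
        proof (rule coversD [OF cov' MI_subgroup [OF sJ'] _ u])
          fix x t assume "x \<in> {x \<in> hc 2 ` J. l x = 0}" and t: "t \<in> Mon k"
          then obtain p where p: "p \<in> J" "x = hc 2 p" "p \<in> J'" by (auto simp: J'_def)
          have 1: "p * xpow t \<in> MI J' k" using MI_I [OF sJ' p(3) t] .
          \<comment> \<open>The terms of \<open>p\<close> above degree 2 are harmless: times
            \<open>xpow t\<close> they are multiples of monomials of I^(k+1) = J I^k by a variable,
            and a variable times an element of \<open>J\<close> has no degree-two part, hence lies
            in \<open>J'\<close>.\<close>
          have key: "cst e * xpow z * xpow t \<in> MI J' k" if z: "z \<in> keys (p - x)" for z e
          proof -
            have "z \<in> keys p" "tdeg z \<noteq> 2"
              using z by (auto simp: p(2) in_keys_iff lookup_minus lookup_hc split: if_splits)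
            then obtain g i y where g: "g \<in> Mon (Suc 0)" "z = g + (single i 1 + y)"
              "i \<in> {1..m}" "keys y \<subseteq> {1..m}"
              using I_keys_decompose p(1) J(2) by blast
            have "g + t \<in> Mon (Suc k)" using Mon_add [OF g(1) t] by simp
            then have "xpow (g + t) \<in> MI J k" using xpow_in_MI_R rk by blast
            then obtain b where b: "xpow (g + t) = (\<Sum>s\<in>Mon k. b s * xpow s)" "\<forall>s. b s \<in> J"
              by (auto simp: MI_def)
            define h :: "'a mpoly" where "h = cst e * xpow (single i 1 + y)"
            have hR: "h \<in> (R :: 'a mpoly set)"
            proof -
              have "keys (single i 1 + y) \<subseteq> {1..m}" using g by (auto simp: keys_add_nat)
              then show ?thesis
                unfolding h_def by (intro R_mult) (simp_all add: xpow_in_poly_ring)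
            qed
            have h0: "lookup h 0 = 0"
              by (simp add: h_def lookup_xpow) (metis tdeg_eq_0 add_is_0 wsum_add wsum_single mult_is_0 nat.distinct(1) One_nat_def)
            have hb: "h * b s \<in> J'" for s
            proof -
              have "hc 2 (h * b s) = cst (lookup h 0) * hc 2 (b s)"
                using b(2) J(2) I_keys_tdeg by (intro hc_mult_low) auto
              then have "l (hc 2 (h * b s)) = 0" by (simp only: l(2) h0 mult_zero_left)
              then show ?thesis using is_ideal_mult [OF J(1) hR] b(2) by (simp add: J'_def)
            qed
            have "cst e * xpow z * xpow t = h * xpow (g + t)"
              by (simp add: h_def g(2) xpow_add mult_ac)
            also have "\<dots> = (\<Sum>s\<in>Mon k. (h * b s) * xpow s)"
              by (simp add: b(1) sum_distrib_left mult.assoc)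
            also have "\<dots> \<in> MI J' k"
              using hb by (intro add_subgroup_sum [OF MI_subgroup [OF sJ']] MI_I [OF sJ']) auto
            finally show ?thesis .
          qed
          have "(p - x) * xpow t = (\<Sum>z\<in>keys (p - x). cst (lookup (p - x) z) * xpow z * xpow t)"
            by (subst mpoly_expand_keys [of "p - x"]) (simp add: sum_distrib_right)
          also have "\<dots> \<in> MI J' k"
            using key by (intro add_subgroup_sum [OF MI_subgroup [OF sJ']]) auto
          finally have "p * xpow t - (p - x) * xpow t \<in> MI J' k"
            using add_subgroup_diff [OF MI_subgroup [OF sJ'] 1] by blast
          then show "x * xpow t \<in> MI J' k" by (simp add: algebra_simps)
        qed
      qed
    qed
    then have "is_reduction R J' I" using is_reduction_iff J' subJI by blast
    moreover have "J' \<subset> J" using w by (auto simp: J'_def)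
    ultimately show thesis using min unfolding minimal_reduction_def by blast
  qed
qed

lemma reduction_number_lower_bound:
  fixes J :: "'a::field mpoly set"
  assumes inf: "infinite (UNIV :: 'a set)" and min: "minimal_reduction R J I"
    and b: "basic b" and r: "MI R (Suc r) = MI J r"
  shows "card b \<le> r"
proof (rule ccontr)
  assume "\<not> card b \<le> r"
  then obtain s where s: "card b = Suc s" "r \<le> s" by (metis Suc_le_D not_less_eq_eq)
  obtain v where v: "\<And>d. d < m \<Longrightarrow> keys (v d) \<subseteq> Mon (Suc 0)"
    "hc 2 ` J \<subseteq> {\<Sum>d<m. cst (a d) * v d |a. True}"
    using minimal_reduction_dim [OF inf min] by blast
  have "covers (hc 2 ` J) s" using covers_mono [OF s(2) reduction_covers [OF r]] .
  then show False using not_covers [OF inf b s(1) v] by blast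
qed

end

subsection \<open>Initial monomials with respect to a weight\<close>

text \<open>Strictness and the coefficient 1 make initial monomials multiplicative over any
  coefficient ring.\<close>

definition lowest :: "(nat \<Rightarrow> nat) \<Rightarrow> 'a::comm_ring_1 mpoly \<Rightarrow> (nat \<Rightarrow>\<^sub>0 nat) \<Rightarrow> bool" where
  "lowest \<omega> p u \<longleftrightarrow> lookup p u = 1 \<and> (\<forall>t\<in>keys p. t = u \<or> wsum \<omega> u < wsum \<omega> t)"

lemma lookup_mult_expand:
  fixes p q :: "'a::comm_ring_1 mpoly"
  shows "lookup (p * q) t = (\<Sum>u\<in>keys p. lookup p u * lookup (q * xpow u) t)"
proof -
  have "p * q = (\<Sum>u\<in>keys p. cst (lookup p u) * (q * xpow u))"
    by (subst (1) mpoly_expand_keys [of p]) (simp add: sum_distrib_left sum_distrib_right mult_ac)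
  then show ?thesis by (simp add: lookup_sum)
qed

lemma keys_mult_xpowE:
  assumes "t \<in> keys (q * xpow u)"
  obtains v where "v \<in> keys q" "t = v + u"
proof -
  have "t \<in> (\<lambda>v. v + u) ` keys q" using assms(1) keys_xpow_mult [of q u] by (rule rev_subsetD)
  then show thesis using that by blast
qed

lemma lowest_mult:
  assumes p: "lowest \<omega> p u" and q: "lowest \<omega> q v"
  shows "lowest \<omega> (p * q) (u + v)"
proof -
  have "lookup p a * lookup (q * xpow a) (u + v) = (if a = u then 1 else 0)" if a: "a \<in> keys p" for a
  proof (cases "a = u")
    case True
    then show ?thesis
      using lookup_mult_xpow [of q u v] p q by (simp add: lowest_def add.commute)
  next
    case False
    then have lt: "wsum \<omega> u < wsum \<omega> a" using p a by (auto simp: lowest_def)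
    have "u + v \<notin> keys (q * xpow a)"
    proof
      assume "u + v \<in> keys (q * xpow a)"
      then obtain b where b: "b \<in> keys q" "u + v = b + a" by (rule keys_mult_xpowE)
      then have "wsum \<omega> v \<le> wsum \<omega> b" using q by (auto simp: lowest_def)
      moreover have "wsum \<omega> u + wsum \<omega> v = wsum \<omega> b + wsum \<omega> a"
        using arg_cong [OF b(2), of "wsum \<omega>"] by (simp add: wsum_add)
      ultimately show False using lt by simp
    qed
    then show ?thesis using False by (simp add: in_keys_iff)
  qed
  moreover have "u \<in> keys p" using p by (auto simp: lowest_def in_keys_iff)
  ultimately have "lookup (p * q) (u + v) = 1" by (subst lookup_mult_expand) simp
  moreover have "t = u + v \<or> wsum \<omega> (u + v) < wsum \<omega> t" if t: "t \<in> keys (p * q)" for t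
  proof -
    obtain a b where ab: "t = a + b" "a \<in> keys p" "b \<in> keys q" using t keys_mult by blast
    then have "a = u \<or> wsum \<omega> u < wsum \<omega> a" "b = v \<or> wsum \<omega> v < wsum \<omega> b"
      using p q by (auto simp: lowest_def)
    then show ?thesis using ab(1) by (auto simp: wsum_add)
  qed
  ultimately show ?thesis by (simp add: lowest_def)
qed

lemma lowest_1: "lowest \<omega> 1 0"
  by (simp add: lowest_def)

lemma lowest_power: "lowest \<omega> p (pm v) \<Longrightarrow> lowest \<omega> (p ^ k) (msum (replicate_mset k v))"
  by (induction k) (simp_all add: lowest_1 lowest_mult)

lemma lowest_pw:
  assumes "\<And>i. i < l \<Longrightarrow> lowest \<omega> (g i) (pm (uv i))"
  shows "lowest \<omega> (pw l g \<alpha>) (msum (\<Sum>i<l. replicate_mset (\<alpha> i) (uv i)))"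
  using assms
proof (induction l)
  case (Suc l)
  then have "lowest \<omega> (pw l g \<alpha> * g l ^ \<alpha> l)
      (msum (\<Sum>i<l. replicate_mset (\<alpha> i) (uv i)) + msum (replicate_mset (\<alpha> l) (uv l)))"
    by (intro lowest_mult lowest_power) auto
  then show ?case by (simp add: pw_def add.commute)
qed (simp add: pw_def lowest_1)

text \<open>Among all terms of the coefficients choose one whose product with the initial monomial
  has least weight; that product arises only once and cannot cancel. Uniqueness is needed only up to
  the weight of the given term, as the minimum is no larger.\<close>

lemma lowest_independent:
  fixes c :: "(nat \<Rightarrow> nat) \<Rightarrow> 'a::comm_ring_1 mpoly"
  assumes low: "\<And>\<alpha>. \<alpha> \<in> mi l N \<Longrightarrow> lowest \<omega> (pw l g \<alpha>) (U \<alpha>)"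
    and \<alpha>0: "\<alpha>0 \<in> mi l N" "\<kappa>0 \<in> keys (c \<alpha>0)"
    and uniq: "\<And>\<alpha> \<kappa> \<alpha>' \<kappa>'. \<alpha> \<in> mi l N \<Longrightarrow> \<alpha>' \<in> mi l N \<Longrightarrow>
      wsum \<omega> (\<kappa> + U \<alpha>) \<le> wsum \<omega> (\<kappa>0 + U \<alpha>0) \<Longrightarrow> wsum \<omega> (\<kappa>' + U \<alpha>') \<le> wsum \<omega> (\<kappa>0 + U \<alpha>0) \<Longrightarrow>
      \<kappa> + U \<alpha> = \<kappa>' + U \<alpha>' \<Longrightarrow> \<alpha> = \<alpha>' \<and> \<kappa> = \<kappa>'"
  shows "(\<Sum>\<alpha>\<in>mi l N. c \<alpha> * pw l g \<alpha>) \<noteq> 0"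
proof -
  define P where "P = (\<lambda>x. fst x \<in> mi l N \<and> snd x \<in> keys (c (fst x)))"
  define W where "W = (\<lambda>x. wsum \<omega> (snd x + U (fst x)))"
  have "P (\<alpha>0, \<kappa>0)" using \<alpha>0 by (simp add: P_def)
  then obtain x where x: "P x" "\<And>y. P y \<Longrightarrow> W x \<le> W y"
    using exists_least_iff [of "\<lambda>w. \<exists>x. P x \<and> W x = w"] by (metis not_le)
  define \<alpha>s where "\<alpha>s = fst x"
  define \<kappa>s where "\<kappa>s = snd x"
  have s: "\<alpha>s \<in> mi l N" "\<kappa>s \<in> keys (c \<alpha>s)" using x(1) by (simp_all add: P_def \<alpha>s_def \<kappa>s_def)
  have min: "wsum \<omega> (\<kappa>s + U \<alpha>s) \<le> wsum \<omega> (\<kappa> + U \<alpha>)" if "\<alpha> \<in> mi l N" "\<kappa> \<in> keys (c \<alpha>)" for \<alpha> \<kappa>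
    using x(2) [of "(\<alpha>, \<kappa>)"] that by (simp add: P_def W_def \<alpha>s_def \<kappa>s_def)
  have val: "lookup (pw l g \<alpha> * xpow \<kappa>) (\<kappa>s + U \<alpha>s) = (if \<alpha> = \<alpha>s \<and> \<kappa> = \<kappa>s then 1 else 0)"
    if \<alpha>: "\<alpha> \<in> mi l N" "\<kappa> \<in> keys (c \<alpha>)" for \<alpha> \<kappa>
  proof (cases "\<alpha> = \<alpha>s \<and> \<kappa> = \<kappa>s")
    case True
    then show ?thesis
      using lookup_mult_xpow [of "pw l g \<alpha>s" \<kappa>s "U \<alpha>s"] low [OF s(1)]
      by (simp add: lowest_def add.commute)
  next
    case False
    have "\<kappa>s + U \<alpha>s \<notin> keys (pw l g \<alpha> * xpow \<kappa>)"
    proof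
      assume "\<kappa>s + U \<alpha>s \<in> keys (pw l g \<alpha> * xpow \<kappa>)"
      then obtain t where t: "t \<in> keys (pw l g \<alpha>)" "\<kappa>s + U \<alpha>s = t + \<kappa>" by (rule keys_mult_xpowE)
      have "t = U \<alpha> \<or> wsum \<omega> (U \<alpha>) < wsum \<omega> t" using low [OF \<alpha>(1)] t(1) by (auto simp: lowest_def)
      moreover have "wsum \<omega> (\<kappa>s + U \<alpha>s) = wsum \<omega> t + wsum \<omega> \<kappa>" by (simp add: t(2) wsum_add)
      ultimately have "t = U \<alpha>" using min [OF \<alpha>] by (auto simp: wsum_add)
      then have eq: "\<kappa>s + U \<alpha>s = \<kappa> + U \<alpha>" using t(2) by (simp add: add.commute)
      have "\<alpha>s = \<alpha> \<and> \<kappa>s = \<kappa>"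
        using uniq [OF s(1) \<alpha>(1) _ _ eq] min [OF \<alpha>0] eq by simp
      then show False using False by simp
    qed
    then have "lookup (pw l g \<alpha> * xpow \<kappa>) (\<kappa>s + U \<alpha>s) = 0" by (simp add: in_keys_iff)
    then show ?thesis using False by simp
  qed
  have "lookup (c \<alpha> * pw l g \<alpha>) (\<kappa>s + U \<alpha>s) = (if \<alpha> = \<alpha>s then lookup (c \<alpha>s) \<kappa>s else 0)"
    if \<alpha>: "\<alpha> \<in> mi l N" for \<alpha>
  proof -
    have "lookup (c \<alpha> * pw l g \<alpha>) (\<kappa>s + U \<alpha>s) =
        (\<Sum>\<kappa>\<in>keys (c \<alpha>). if \<kappa> = \<kappa>s then if \<alpha> = \<alpha>s then lookup (c \<alpha>) \<kappa> else 0 else 0)"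
    proof (subst lookup_mult_expand, rule sum.cong)
      fix \<kappa> assume \<kappa>: "\<kappa> \<in> keys (c \<alpha>)"
      show "lookup (c \<alpha>) \<kappa> * lookup (pw l g \<alpha> * xpow \<kappa>) (\<kappa>s + U \<alpha>s) =
          (if \<kappa> = \<kappa>s then if \<alpha> = \<alpha>s then lookup (c \<alpha>) \<kappa> else 0 else 0)"
        unfolding val [OF \<alpha> \<kappa>] by simp
    qed simp
    then show ?thesis using s(2) by simp
  qed
  then have "lookup (\<Sum>\<alpha>\<in>mi l N. c \<alpha> * pw l g \<alpha>) (\<kappa>s + U \<alpha>s) =
      (\<Sum>\<alpha>\<in>mi l N. if \<alpha> = \<alpha>s then lookup (c \<alpha>s) \<kappa>s else 0)"
    unfolding lookup_sum by (intro sum.cong) auto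
  also have "\<dots> = lookup (c \<alpha>s) \<kappa>s" using s(1) by simp
  finally show ?thesis using s(2) by (metis in_keys_iff lookup_zero)
qed

subsection \<open>The diagonal reduction is minimal\<close>

text \<open>The localization of the ideal at a prime \<open>q\<close> containing it; \<open>j\<close> is the least index with
  \<open>x\<^sub>j \<notin> q\<close> (or \<open>m + 1\<close>). There the ideal is generated by \<open>x\<^sub>1, \<dots>, x\<^sub>k\<close> and the generators in
  the remaining rows, it has analytic spread \<open>l\<close>, and the diagonal reduction is generated by
  the \<open>l\<close> elements \<open>gf 0, \<dots>, gf (l - 1)\<close>.\<close>

locale ferrers_point = spec_ferrers +
  fixes j k :: nat
  assumes n_less_j: "n < j"
    and k_le_n: "k \<le> n"
    and k_iff: "\<And>i. 1 \<le> i \<Longrightarrow> i \<le> n \<Longrightarrow> i \<le> k \<longleftrightarrow> j \<le> lam i"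
begin

text \<open>If every row reaches column \<open>j\<close>, the first \<open>n\<close> variables
  generate locally. Otherwise \<open>k\<close> variables are joined by the
  \<open>lam (Suc k) - k\<close> diagonals that meet row \<open>Suc k\<close>.\<close>

definition l :: nat where
  "l = (if k < n then lam (Suc k) else n)"

definition gf :: "nat \<Rightarrow> 'a::comm_ring_1 mpoly" where
  "gf i = (if i < k then theta (j - 1 - i) else theta (i - k))"

text \<open>Down column \<open>j\<close> through the rows up to \<open>k\<close>, then along row
  \<open>Suc k\<close>: each \<open>uv i\<close> lies on the diagonal of \<open>gf i\<close> and
  will be its initial monomial.\<close>

definition uv :: "nat \<Rightarrow> nat \<times> nat" where
  "uv i = (if i < k then (Suc i, j) else (Suc k, Suc i))"

lemma n_le_l: "n \<le> l"
  using n_le_lam [of "Suc k"] by (simp add: l_def)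

lemma l_pos: "0 < l"
  using n_le_l n_pos by simp

lemma l_less_j: "l < j"
  using k_iff [of "Suc k"] n_less_j by (auto simp: l_def not_le)

lemma l_le_m: "l \<le> m"
  using lam_le_m [of "Suc k"] n_le_m by (auto simp: l_def)

lemma lam_le_l: "k < i \<Longrightarrow> i \<le> n \<Longrightarrow> lam i \<le> l"
  using lam_mono [of "Suc k" i] by (auto simp: l_def)

lemma k_less_n: "k \<le> i \<Longrightarrow> i < l \<Longrightarrow> k < n"
  using k_le_n by (cases "k < n") (auto simp: l_def)

lemma j_le_m: "0 < k \<Longrightarrow> j \<le> m"
  using k_iff [of 1] n_pos lam_1 by simp

lemma gf_index: "i < l \<Longrightarrow> (if i < k then j - 1 - i else i - k) < m"
  using j_le_m l_le_m n_less_j by auto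

lemma theta_lookup:
  "v \<in> diag d \<Longrightarrow> lookup (theta d :: 'a::comm_ring_1 mpoly) (pm v) = 1"
proof -
  assume v: "v \<in> diag d"
  have "lookup (theta d :: 'a mpoly) (pm v) = (\<Sum>w\<in>diag d. if w = v then 1 else 0)"
    unfolding theta_def lookup_sum
  proof (rule sum.cong)
    fix w assume w: "w \<in> diag d"
    have "w = v" if eq: "pm w = pm v"
    proof -
      have "fst w + snd w = fst v + snd v"
        using arg_cong [OF eq, of "wsum (\<lambda>i. i)"] by (simp add: wsum_pm)
      then show ?thesis using v w by (auto simp: diag_def prod_eq_iff)
    qed
    then show "lookup (xpow (pm w) :: 'a mpoly) (pm v) = (if w = v then 1 else 0)"
      by (auto simp: lookup_xpow)
  qed simp
  then show ?thesis using v by simp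
qed

lemma lowest_theta:
  assumes "v \<in> diag d"
    and "\<And>w. w \<in> diag d \<Longrightarrow> w \<noteq> v \<Longrightarrow> \<omega> (fst v) + \<omega> (snd v) < \<omega> (fst w) + \<omega> (snd w)"
  shows "lowest \<omega> (theta d) (pm v)"
  unfolding lowest_def
proof (intro conjI ballI)
  show "lookup (theta d) (pm v) = 1" by (rule theta_lookup [OF assms(1)])
  fix t assume "t \<in> keys (theta d)"
  moreover have "keys (theta d) \<subseteq> pm ` diag d"
    unfolding theta_def by (rule keys_sum_subset) auto
  ultimately obtain w where "w \<in> diag d" "t = pm w" by blast
  then show "t = pm v \<or> wsum \<omega> (pm v) < wsum \<omega> t"
    using assms(2) [of w] by (cases "w = v") (simp_all add: wsum_pm)
qed

text \<open>The last branch is the distance from \<open>j\<close>. In the diagonals of the first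
  kind every pair has a heavy first index, and the distance selects column \<open>j\<close>; in the
  others a heavy index loses against two middle ones, and the index sum selects row
  \<open>Suc k\<close>.\<close>

definition om :: "nat \<Rightarrow> nat \<Rightarrow> nat" where
  "om B i = (if i \<le> k then 2 * B + 4 * m + 4 else if i \<le> l then B + i else (i - j) + (j - i))"

lemma diag_upper_rows:
  assumes i: "i < k" and v: "v \<in> diag (j - 1 - i)"
  shows "fst v \<le> k"
proof (rule ccontr)
  assume "\<not> fst v \<le> k"
  then have "lam (fst v) < j" "k < fst v" "snd v \<le> lam (fst v)" "snd v = fst v + (j - 1 - i)"
    using v k_iff [of "fst v"] by (auto simp: diag_def shape_def)
  then show False using i by linarith
qed

lemma lowest_gf:
  assumes i: "i < l" and B: "0 < B"
  shows "lowest (om B) (gf i) (pm (uv i))"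
proof (cases "i < k")
  case True
  have d: "Suc i + (j - 1 - i) = j" using True k_le_n n_less_j by simp
  have "uv i \<in> diag (j - 1 - i)"
    using True d k_le_n n_less_j k_iff [of "Suc i"] by (auto simp: uv_def diag_def shape_def)
  moreover have "om B (fst (uv i)) + om B (snd (uv i)) < om B (fst w) + om B (snd w)"
    if w: "w \<in> diag (j - 1 - i)" "w \<noteq> uv i" for w
  proof -
    have 1: "fst w \<le> k" by (rule diag_upper_rows [OF True w(1)])
    have "snd w \<noteq> j"
      using w d True by (auto simp: diag_def uv_def prod_eq_iff)
    then have "0 < om B (snd w)" using B by (auto simp: om_def)
    then show ?thesis using 1 True l_less_j k_le_n n_less_j by (simp add: uv_def om_def)
  qed
  ultimately show ?thesis using True by (simp add: gf_def lowest_theta)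
next
  case False
  then have kn: "k < n" using k_less_n [of i] i by simp
  have "uv i \<in> diag (i - k)"
    using False i kn by (auto simp: uv_def diag_def shape_def l_def)
  moreover have "om B (fst (uv i)) + om B (snd (uv i)) < om B (fst w) + om B (snd w)"
    if w: "w \<in> diag (i - k)" "w \<noteq> uv i" for w
  proof -
    have o: "om B (fst (uv i)) + om B (snd (uv i)) = 2 * B + k + i + 2"
      using False i kn n_le_l by (simp add: uv_def om_def)
    have sw: "snd w = fst w + (i - k)" "fst w \<le> n" "snd w \<le> lam (fst w)" "fst w \<le> snd w"
      using w(1) by (auto simp: diag_def shape_def)
    show ?thesis
    proof (cases "fst w \<le> k")
      case True
      then have "2 * B + 4 * m + 4 \<le> om B (fst w)" by (simp add: om_def)
      then show ?thesis using o i l_le_m kn n_le_m by linarith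
    next
      case 1: False
      then have "snd w \<le> l" using lam_le_l [of "fst w"] sw by simp
      then have "om B (fst w) + om B (snd w) = 2 * B + fst w + snd w"
        using 1 sw by (simp add: om_def)
      moreover have "fst w \<noteq> Suc k"
        using w(2) sw False by (auto simp: uv_def prod_eq_iff)
      ultimately show ?thesis using o sw 1 False by simp
    qed
  qed
  ultimately show ?thesis using False by (simp add: gf_def lowest_theta)
qed

lemma om_uv:
  assumes "i < l"
  shows "2 * B \<le> om B (fst (uv i)) + om B (snd (uv i))"
    "om B (fst (uv i)) + om B (snd (uv i)) \<le> 2 * B + 4 * m + 4"
proof -
  have "i < k \<Longrightarrow> om B (fst (uv i)) = 2 * B + 4 * m + 4 \<and> om B (snd (uv i)) = 0"
    using l_less_j k_le_n n_less_j by (simp add: uv_def om_def)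
  moreover have "\<not> i < k \<Longrightarrow> om B (fst (uv i)) = B + Suc k \<and> om B (snd (uv i)) = B + Suc i \<and> k < n"
    using k_less_n [of i] assms n_le_l by (simp add: uv_def om_def)
  ultimately show "2 * B \<le> om B (fst (uv i)) + om B (snd (uv i))"
    "om B (fst (uv i)) + om B (snd (uv i)) \<le> 2 * B + 4 * m + 4"
    using assms l_le_m n_le_m by (cases "i < k"; simp)+
qed

definition Um :: "(nat \<Rightarrow> nat) \<Rightarrow> (nat \<Rightarrow>\<^sub>0 nat)" where
  "Um \<alpha> = msum (\<Sum>i<l. replicate_mset (\<alpha> i) (uv i))"

lemma msum_sum: "finite A \<Longrightarrow> msum (\<Sum>i\<in>A. X i) = (\<Sum>i\<in>A. msum (X i))"
  by (induction A rule: finite_induct) simp_all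

lemma wsum_msum_replicate: "wsum f (msum (replicate_mset c v)) = c * (f (fst v) + f (snd v))"
  by (induction c) (simp_all add: wsum_add wsum_pm)

lemma wsum_Um: "wsum f (Um \<alpha>) = (\<Sum>i<l. \<alpha> i * (f (fst (uv i)) + f (snd (uv i))))"
  by (simp add: Um_def msum_sum wsum_sum wsum_msum_replicate)

lemma lookup_wsum: "lookup t x = wsum (\<lambda>i. if i = x then 1 else 0) t"
proof -
  have "wsum (\<lambda>i. if i = x then 1 else 0) t = (\<Sum>i\<in>keys t. if i = x then lookup t x else 0)"
    unfolding wsum_def by (rule sum.cong) auto
  then show ?thesis by (simp add: in_keys_iff)
qed

text \<open>The variable \<open>Suc k\<close> is excluded because it divides every
  \<open>uv i\<close> with \<open>k \<le> i\<close>; the exponent \<open>\<alpha> k\<close> is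
  recovered from the total degree.\<close>

lemma lookup_Um:
  assumes i: "i < l" "i \<noteq> k"
  shows "lookup (Um \<alpha>) (Suc i) = \<alpha> i"
proof -
  have "lookup (Um \<alpha>) (Suc i) = (\<Sum>i'<l. if i' = i then \<alpha> i else 0)"
    unfolding lookup_wsum [of "Um \<alpha>"] wsum_Um
  proof (rule sum.cong)
    fix i' assume "i' \<in> {..<l}"
    then show "\<alpha> i' * ((if fst (uv i') = Suc i then 1 else 0) + (if snd (uv i') = Suc i then 1 else 0)) =
        (if i' = i then \<alpha> i else 0)"
      using i l_less_j by (auto simp: uv_def)
  qed simp
  then show ?thesis using i by simp
qed

lemma Um_unique:
  assumes \<alpha>: "\<alpha> \<in> mi l N" "\<alpha>' \<in> mi l N" and eq: "\<kappa> + Um \<alpha> = \<kappa>' + Um \<alpha>'"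
    and \<kappa>: "keys \<kappa> \<inter> {1..l} = {}" "keys \<kappa>' \<inter> {1..l} = {}"
  shows "\<alpha> = \<alpha>' \<and> \<kappa> = \<kappa>'"
proof -
  have ne: "\<alpha> i = \<alpha>' i" if i: "i \<noteq> k" for i
  proof (cases "i < l")
    case True
    have "Suc i \<in> {1..l}" using True by simp
    then have "Suc i \<notin> keys \<kappa>" "Suc i \<notin> keys \<kappa>'" using \<kappa> by blast+
    then have "lookup \<kappa> (Suc i) = 0" "lookup \<kappa>' (Suc i) = 0" by (simp_all add: in_keys_iff)
    then have "lookup (Um \<alpha>) (Suc i) = lookup (Um \<alpha>') (Suc i)"
      using arg_cong [OF eq, of "\<lambda>t. lookup t (Suc i)"] by (simp add: lookup_add)
    then show ?thesis using lookup_Um [OF True i] by simp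
  next
    case False
    then show ?thesis using \<alpha> by (simp add: mi_def)
  qed
  have "\<alpha> k = \<alpha>' k"
  proof (cases "k < l")
    case True
    have "(\<Sum>i<l. \<alpha> i) = \<alpha> k + (\<Sum>i\<in>{..<l} - {k}. \<alpha> i)" "(\<Sum>i<l. \<alpha>' i) = \<alpha>' k + (\<Sum>i\<in>{..<l} - {k}. \<alpha>' i)"
      using True by (simp_all add: sum.remove)
    moreover have "(\<Sum>i\<in>{..<l} - {k}. \<alpha> i) = (\<Sum>i\<in>{..<l} - {k}. \<alpha>' i)"
      using ne by (intro sum.cong) auto
    ultimately show ?thesis using \<alpha> by (simp add: mi_def)
  next
    case False
    then show ?thesis using \<alpha> by (simp add: mi_def)
  qed
  then have "\<alpha> = \<alpha>'" using ne by (metis ext)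
  then show ?thesis using eq by simp
qed

text \<open>The \<open>gf i\<close> are analytically independent at \<open>q\<close>.\<close>

lemma gf_independent:
  fixes c :: "(nat \<Rightarrow> nat) \<Rightarrow> 'a::comm_ring_1 mpoly"
  assumes rel: "(\<Sum>\<alpha>\<in>mi l N. c \<alpha> * pw l gf \<alpha>) = 0"
    and \<alpha>0: "\<alpha>0 \<in> mi l N" and \<kappa>0: "\<kappa>0 \<in> keys (c \<alpha>0)" and zero: "0 \<notin> keys \<kappa>0"
  shows "keys \<kappa>0 \<inter> {1..l} \<noteq> {}"
proof
  assume disj: "keys \<kappa>0 \<inter> {1..l} = {}"
  define W where "W = wsum (\<lambda>i. (i - j) + (j - i)) \<kappa>0"
  \<comment> \<open>\<open>B\<close> exceeds the weight of \<open>\<kappa>0\<close> plus the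
    variation of the weights of the \<open>Um \<alpha>\<close>, so no term whose
    \<open>\<kappa>\<close> contains one of the variables 1, ..., \<open>l\<close> can compete with
    the given one.\<close>
  define B where "B = 1 + (4 * m + 4) * N + W"
  have W: "wsum (om B) \<kappa>0 = W"
    unfolding W_def wsum_def
  proof (rule sum.cong)
    fix i assume i: "i \<in> keys \<kappa>0"
    then have "i \<noteq> 0" using zero by metis
    moreover have "i \<notin> {1..l}" using disj i by blast
    ultimately have "\<not> i \<le> l" by simp
    then show "om B i * lookup \<kappa>0 i = ((i - j) + (j - i)) * lookup \<kappa>0 i"
      using k_le_n n_le_l by (simp add: om_def)
  qed simp
  have Um_low: "2 * B * N \<le> wsum (om B) (Um \<alpha>)"
    and Um_up: "wsum (om B) (Um \<alpha>) \<le> (2 * B + 4 * m + 4) * N" if "\<alpha> \<in> mi l N" for \<alpha>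
  proof -
    have N: "(\<Sum>i<l. \<alpha> i) = N" using that by (simp add: mi_def)
    have "(\<Sum>i<l. \<alpha> i * (2 * B)) \<le> wsum (om B) (Um \<alpha>)"
      unfolding wsum_Um using om_uv by (intro sum_mono mult_left_mono) auto
    then show "2 * B * N \<le> wsum (om B) (Um \<alpha>)"
      by (simp add: sum_distrib_right [symmetric] N mult.commute)
    have "wsum (om B) (Um \<alpha>) \<le> (\<Sum>i<l. \<alpha> i * (2 * B + 4 * m + 4))"
      unfolding wsum_Um using om_uv by (intro sum_mono mult_left_mono) auto
    then show "wsum (om B) (Um \<alpha>) \<le> (2 * B + 4 * m + 4) * N"
      by (simp add: sum_distrib_right [symmetric] N mult.commute)
  qed
  have small: "keys \<kappa> \<inter> {1..l} = {}"
    if "\<alpha> \<in> mi l N" "wsum (om B) (\<kappa> + Um \<alpha>) \<le> wsum (om B) (\<kappa>0 + Um \<alpha>0)" for \<alpha> \<kappa>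
  proof (rule ccontr)
    assume "keys \<kappa> \<inter> {1..l} \<noteq> {}"
    then obtain i where i: "i \<in> keys \<kappa>" "i \<le> l" by auto
    have "B \<le> om B i" using i by (auto simp: om_def)
    also have "\<dots> \<le> om B i * lookup \<kappa> i" using i by (simp add: in_keys_iff)
    also have "\<dots> \<le> wsum (om B) \<kappa>"
      unfolding wsum_def using i by (intro member_le_sum [of i "keys \<kappa>" "\<lambda>i. om B i * lookup \<kappa> i"]) auto
    finally have "B + 2 * B * N \<le> wsum (om B) (\<kappa> + Um \<alpha>)"
      using Um_low [OF that(1)] by (simp add: wsum_add)
    also have "\<dots> \<le> W + (2 * B + 4 * m + 4) * N"
      using that(2) Um_up [OF \<alpha>0] W by (simp add: wsum_add)
    finally show False by (simp add: B_def algebra_simps)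
  qed
  have "(\<Sum>\<alpha>\<in>mi l N. c \<alpha> * pw l gf \<alpha>) \<noteq> 0"
  proof (rule lowest_independent [where \<omega> = "om B" and U = Um and c = c and l = l, OF _ \<alpha>0 \<kappa>0])
    show "lowest (om B) (pw l gf \<alpha>) (Um \<alpha>)" for \<alpha>
      unfolding Um_def by (intro lowest_pw lowest_gf) (simp_all add: B_def)
  qed (use Um_unique small in blast)
  then show False using rel by blast
qed

end

context spec_ferrers
begin

section \<open>The ideal of the diagonal sums and its local generators\<close>

definition J0 :: "'a::comm_ring_1 mpoly set" where
  "J0 = {\<Sum>d<m. h d * theta d |h. \<forall>d. h d \<in> R}"

lemma theta_in_R: "theta d \<in> (R :: 'a::comm_ring_1 mpoly set)"
  unfolding theta_def
proof (rule add_subgroup_sum [OF R_subgroup])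
  fix v assume "v \<in> diag d"
  then have "v \<in> shape" by (simp add: diag_def)
  then show "xpow (pm v) \<in> (R :: 'a mpoly set)" by (rule xpow_in_R [OF pm_in_Mon])
qed

lemma J0_lincombs: "J0 = lincombs R theta {..<m}"
  by (simp add: J0_def lincombs_def)

lemma J0_ideal: "is_ideal R J0"
  unfolding J0_lincombs using theta_in_R by (intro lincombs_ideal [OF subring_poly_ring R_ideal])

lemma theta_in_J0: "d < m \<Longrightarrow> theta d \<in> J0"
  unfolding J0_lincombs by (subst mult_1 [symmetric], rule lincombs_member [OF R_subgroup _ _ R_1]) simp_all

lemma J0_subset: "(J0 :: 'a::comm_ring_1 mpoly set) \<subseteq> I"
proof
  fix x :: "'a mpoly" assume "x \<in> J0"
  then obtain h where h: "x = (\<Sum>d<m. h d * theta d)" "\<forall>d. h d \<in> R" by (auto simp: J0_def)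
  note sI = ideal_subgroup [OF I_ideal]
  have "theta d \<in> (I :: 'a mpoly set)" for d
    unfolding theta_def
  proof (rule add_subgroup_sum [OF sI])
    fix v assume "v \<in> diag d"
    then show "xpow (pm v) \<in> (I :: 'a mpoly set)"
      unfolding I_eq_MI by (intro xpow_in_MI_R pm_in_Mon) (simp add: diag_def)
  qed
  then show "x \<in> I"
    unfolding h(1) using h(2) by (intro add_subgroup_sum [OF sI] is_ideal_mult [OF I_ideal]) blast+
qed

lemma J0_reduction:
  assumes "\<And>b. basic b \<Longrightarrow> card b \<le> r"
  shows "MI R (Suc r) = (MI J0 r :: 'a::comm_ring_1 mpoly set)"
proof
  note sJ = ideal_subgroup [OF J0_ideal]
  show "(MI R (Suc r) :: 'a mpoly set) \<subseteq> MI J0 r"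
  proof (rule MI_R_least [OF MI_ideal [OF J0_ideal]])
    fix t assume t: "t \<in> Mon (Suc r)"
    show "xpow t \<in> (MI J0 r :: 'a mpoly set)"
    proof (rule theta_step [OF MI_subgroup [OF sJ] _ _ t])
      show "theta d * xpow t \<in> (MI J0 r :: 'a mpoly set)" if "d < m" "t \<in> Mon r" for d t
        using MI_I [OF sJ theta_in_J0 [OF that(1)] that(2)] .
      show "xpow (bmon b) \<in> (MI J0 r :: 'a mpoly set)" if "basic b" "card b = Suc r" for b
        using assms [OF that(1)] that(2) by simp
    qed
  qed
qed (rule MI_subset_power [OF J0_subset])

lemma theta_rows:
  "theta d = (\<Sum>a\<in>{1..n}. (if a + d \<le> lam a then Var (a + d) else 0) * Var a)"
proof -
  have "diag d = (\<lambda>a. (a, a + d)) ` {a \<in> {1..n}. a + d \<le> lam a}"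
    by (auto simp: diag_def shape_def image_iff prod_eq_iff)
  then have "theta d = (\<Sum>a\<in>{a \<in> {1..n}. a + d \<le> lam a}. xpow (pm (a, a + d)))"
    by (simp add: theta_def sum.reindex inj_on_def)
  also have "\<dots> = (\<Sum>a\<in>{1..n}. if a + d \<le> lam a then xpow (pm (a, a + d)) else 0)"
    by (rule sum.inter_filter) simp
  also have "\<dots> = (\<Sum>a\<in>{1..n}. (if a + d \<le> lam a then Var (a + d) else 0) * Var a)"
    by (rule sum.cong) (auto simp: pm_def xpow_add Var_xpow)
  finally show ?thesis .
qed

end

context ferrers_point
begin

definition G :: "'a::comm_ring_1 mpoly set" where
  "G = {\<Sum>i<l. b i * gf i |b. \<forall>i. b i \<in> R}"

lemma gf_in_J0: "i < l \<Longrightarrow> gf i \<in> J0"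
  using gf_index [of i] by (auto simp: gf_def intro!: theta_in_J0)

lemma G_lincombs: "G = lincombs R gf {..<l}"
  by (simp add: G_def lincombs_def)

lemma gf_in_G: "i < l \<Longrightarrow> r \<in> R \<Longrightarrow> r * gf i \<in> G"
  unfolding G_lincombs by (rule lincombs_member [OF R_subgroup]) simp_all

lemma gf_in_R: "i < l \<Longrightarrow> gf i \<in> R"
  using is_ideal_subset [OF J0_ideal gf_in_J0] .

lemma G_ideal: "is_ideal R G"
  unfolding G_lincombs using gf_in_R by (intro lincombs_ideal [OF subring_poly_ring R_ideal]) simp

lemmas G_subgroup = ideal_subgroup [OF G_ideal]

end

section \<open>Comparison of \<open>J0\<close> with a smaller reduction at one prime\<close>

locale ferrers_prime = ferrers_point +
  fixes q :: "'a::field mpoly set"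
  assumes q: "is_ideal R q" "1 \<notin> q"
    and prime: "\<And>x y. x \<in> R \<Longrightarrow> y \<in> R \<Longrightarrow> x * y \<in> q \<Longrightarrow> x \<in> q \<or> y \<in> q"
    and Var_low: "\<And>i. 1 \<le> i \<Longrightarrow> i < j \<Longrightarrow> Var i \<in> q"
    and Var_j: "j \<le> m \<Longrightarrow> Var j \<notin> q"
begin

lemma q_subgroup: "add_subgroup q"
  by (rule ideal_subgroup [OF q(1)])

text \<open>The diagonals \<open>theta (j - 1 - i)\<close> with \<open>i < k\<close> are
  combinations of the first \<open>k\<close> variables, and modulo \<open>q\<close> their matrix is
  triangular with the unit \<open>Var j\<close> on its diagonal. The dichotomy replaces inverting
  it.\<close>

lemma variables_in_G: "\<exists>u\<in>R - q. \<forall>i<k. u * Var (Suc i) \<in> G"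
proof (rule ideal_dichotomy [OF subring_poly_ring q prime G_ideal, where l = k and f = "\<lambda>t. Var (Suc t)"])
  fix u assume "u \<in> R" "u \<notin> q" "\<And>i. i < k \<Longrightarrow> u * Var (Suc i) \<in> G"
  then show ?thesis by blast
next
  fix \<tau> i0
  assume \<tau>: "\<And>i. i < k \<Longrightarrow> \<tau> i \<in> R" "i0 < k" "\<tau> i0 \<notin> q"
    "\<And>b. (\<And>i. b i \<in> R) \<Longrightarrow> (\<Sum>t<k. b t * Var (Suc t)) \<in> G \<Longrightarrow> (\<Sum>i<k. \<tau> i * b i) \<in> q"
  \<comment> \<open>Descending in \<open>i\<close>: for \<open>t < i\<close> the entry is a variable
    of index below \<open>j\<close> or 0, hence in \<open>q\<close>, and for \<open>t > i\<close>
    the coefficient \<open>\<tau> t\<close> is already known to be in \<open>q\<close>.\<close>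
  have "\<tau> i \<in> q" if "i < k" for i
    using that
  proof (induction "k - i" arbitrary: i rule: less_induct)
    case less
    define row :: "nat \<Rightarrow> 'a mpoly" where
      "row = (\<lambda>t. if t < k \<and> Suc t + (j - 1 - i) \<le> lam (Suc t) then Var (Suc t + (j - 1 - i)) else 0)"
    have jm: "j \<le> m" using j_le_m less.prems by simp
    have row_R: "row t \<in> R" for t
    proof (cases "t < k \<and> Suc t + (j - 1 - i) \<le> lam (Suc t)")
      case True
      then have "Suc t + (j - 1 - i) \<le> m" using lam_le_m [of "Suc t"] k_le_n by simp
      then show ?thesis using True by (simp add: row_def Var_in_poly_ring)
    next
      case False
      then show ?thesis using add_subgroup_0 [OF R_subgroup] by (auto simp: row_def)
    qed
    have "theta (j - 1 - i) = (\<Sum>a\<in>{1..n}. (if a + (j - 1 - i) \<le> lam a then Var (a + (j - 1 - i)) else 0) * Var a :: 'a mpoly)"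
      by (rule theta_rows)
    also have "\<dots> = (\<Sum>a\<in>{1..k}. (if a + (j - 1 - i) \<le> lam a then Var (a + (j - 1 - i)) else 0) * Var a)"
    proof (rule sum.mono_neutral_right)
      show "\<forall>a\<in>{1..n} - {1..k}. (if a + (j - 1 - i) \<le> lam a then Var (a + (j - 1 - i)) else 0) * Var a = (0 :: 'a mpoly)"
      proof
        fix a assume a: "a \<in> {1..n} - {1..k}"
        then have "lam a < j" "k < a" using k_iff [of a] by auto
        then have "\<not> a + (j - 1 - i) \<le> lam a" using less.prems by linarith
        then show "(if a + (j - 1 - i) \<le> lam a then Var (a + (j - 1 - i)) else 0) * Var a = (0 :: 'a mpoly)" by simp
      qed
    qed (use k_le_n in auto)
    also have "\<dots> = (\<Sum>t<k. row t * Var (Suc t))"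
    proof -
      have "{1..k} = Suc ` {..<k}" by (auto simp: image_iff) (metis Suc_le_D Suc_le_lessD lessThan_iff)
      then show ?thesis by (simp add: sum.reindex row_def)
    qed
    finally have "theta (j - 1 - i) = (\<Sum>t<k. row t * Var (Suc t))" .
    moreover have "theta (j - 1 - i) \<in> (G :: 'a mpoly set)"
      using gf_in_G [of i "1 :: 'a mpoly"] less.prems k_le_n n_le_l
      by (simp add: gf_def R_1)
    ultimately have 1: "(\<Sum>t<k. \<tau> t * row t) \<in> q" using row_R by (intro \<tau>(4)) simp_all
    have 2: "(\<Sum>t<k. \<tau> t * row t) = \<tau> i * row i + (\<Sum>t\<in>{..<k} - {i}. \<tau> t * row t)"
      using less.prems by (simp add: sum.remove)
    have 3: "(\<Sum>t\<in>{..<k} - {i}. \<tau> t * row t) \<in> q"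
    proof (rule add_subgroup_sum [OF q_subgroup])
      fix t assume t: "t \<in> {..<k} - {i}"
      show "\<tau> t * row t \<in> q"
      proof (cases "t < i")
        case True
        have "row t \<in> q"
        proof (cases "t < k \<and> Suc t + (j - 1 - i) \<le> lam (Suc t)")
          case 1: True
          have "Suc t + (j - 1 - i) < j" using True less.prems k_le_n n_less_j by linarith
          then have "Var (Suc t + (j - 1 - i)) \<in> q" by (intro Var_low) simp_all
          then show ?thesis using 1 by (simp add: row_def)
        next
          case False
          then show ?thesis using add_subgroup_0 [OF q_subgroup] by (auto simp: row_def)
        qed
        then show ?thesis using is_ideal_mult [OF q(1)] \<tau>(1) t by simp
      next
        case False
        then have "\<tau> t \<in> q" using t by (intro less.hyps) auto
        then show ?thesis using is_ideal_mult [OF q(1) row_R] by (simp add: mult.commute)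
      qed
    qed
    have "\<tau> i * row i \<in> q" using add_subgroup_diff [OF q_subgroup 1 3] by (simp add: 2)
    moreover have "row i = Var j"
    proof -
      have "Suc i + (j - 1 - i) = j" using less.prems k_le_n n_less_j by simp
      moreover have "j \<le> lam (Suc i)" using k_iff [of "Suc i"] less.prems k_le_n by simp
      ultimately show ?thesis using less.prems by (simp add: row_def)
    qed
    ultimately show "\<tau> i \<in> q"
      using prime [of "\<tau> i" "row i"] \<tau>(1) [OF less.prems] row_R [of i] Var_j [OF jm] by auto
  qed
  then show ?thesis using \<tau>(2,3) by blast
qed

text \<open>A diagonal with \<open>d < l - k\<close> is itself one of the \<open>gf i\<close>; a
  longer one misses all rows after \<open>k\<close>, so it is a combination of variables that lie in
  \<open>G\<close> locally.\<close>

lemma theta_in_G: "\<exists>u\<in>R - q. \<forall>d<m. u * theta d \<in> G"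
proof -
  obtain u where u: "u \<in> R - q" "\<And>i. i < k \<Longrightarrow> u * Var (Suc i) \<in> G" using variables_in_G by blast
  have "u * theta d \<in> G" if d: "d < m" for d
  proof (cases "d < l - k")
    case True
    then have "(gf (d + k) :: 'a mpoly) = theta d" by (simp add: gf_def)
    then show ?thesis using gf_in_G [of "d + k" u] True u(1) by simp
  next
    case False
    have "u * theta d = (\<Sum>a\<in>{1..n}. (if a + d \<le> lam a then Var (a + d) else 0) * (u * Var a))"
      by (simp only: theta_rows sum_distrib_left mult.left_commute)
    also have "\<dots> \<in> G"
    proof (rule add_subgroup_sum [OF G_subgroup])
      fix a assume a: "a \<in> {1..n}"
      show "(if a + d \<le> lam a then Var (a + d) else 0) * (u * Var a) \<in> G"
      proof (cases "a + d \<le> lam a")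
        case True
        have "a \<le> k"
        proof (rule ccontr)
          assume "\<not> a \<le> k"
          then have "lam a \<le> l" "k < a" using lam_le_l [of a] a by auto
          then show False using True False by linarith
        qed
        then have "a - 1 < k" using a by auto
        then have "u * Var a \<in> G" using u(2) [of "a - 1"] a by simp
        moreover have "Var (a + d) \<in> (R :: 'a mpoly set)"
          using True lam_le_m [of a] a by (intro Var_in_poly_ring) auto
        ultimately show ?thesis using True is_ideal_mult [OF G_ideal] by simp
      next
        case False
        then show ?thesis using add_subgroup_0 [OF G_subgroup] by simp
      qed
    qed
    finally show ?thesis .
  qed
  then show ?thesis using u(1) by blast
qed

text \<open>By analytic independence the coefficients of a form vanishing at \<open>gf\<close> lie
  in the ideal of the first \<open>l\<close> variables, which is contained in \<open>q\<close>
  because \<open>l < j\<close>.\<close>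

lemma form_zero_in_q:
  assumes "form R l gf \<tau> M 0 z" "\<And>i. i < l \<Longrightarrow> \<tau> i \<in> R"
  shows "z \<in> q"
proof -
  obtain c where c: "\<forall>\<alpha>. c \<alpha> \<in> R" "0 = (\<Sum>\<alpha>\<in>mi l M. c \<alpha> * pw l gf \<alpha>)"
    "z = (\<Sum>\<alpha>\<in>mi l M. c \<alpha> * pw l \<tau> \<alpha>)"
    using form_normal [OF subring_poly_ring assms(1)] by blast
  have cq: "c \<alpha> \<in> q" if \<alpha>: "\<alpha> \<in> mi l M" for \<alpha>
  proof -
    have "cst (lookup (c \<alpha>) \<kappa>) * xpow \<kappa> \<in> q" if \<kappa>: "\<kappa> \<in> keys (c \<alpha>)" for \<kappa>
    proof -
      have kR: "keys \<kappa> \<subseteq> {1..m}" using c(1) \<kappa> unfolding poly_ring_def by blast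
      then have "0 \<notin> keys \<kappa>" by auto
      then have "keys \<kappa> \<inter> {1..l} \<noteq> {}" using gf_independent [OF c(2) [symmetric] \<alpha> \<kappa>] by blast
      then obtain i where i: "i \<in> keys \<kappa>" "1 \<le> i" "i \<le> l" by auto
      have "\<kappa> = (\<kappa> - single i 1) + single i 1"
        by (rule poly_mapping_eqI)
           (use i in \<open>auto simp: lookup_add lookup_minus lookup_single when_def in_keys_iff\<close>)
      then have "cst (lookup (c \<alpha>) \<kappa>) * xpow \<kappa> = (cst (lookup (c \<alpha>) \<kappa>) * xpow (\<kappa> - single i 1)) * Var i"
        unfolding Var_xpow mult.assoc xpow_add [symmetric] by simp
      moreover have "keys (\<kappa> - single i 1) \<subseteq> {1..m}"
        using kR by (auto simp: in_keys_iff lookup_minus)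
      then have "cst (lookup (c \<alpha>) \<kappa>) * xpow (\<kappa> - single i 1) \<in> R"
        by (intro R_mult) (simp_all add: xpow_in_poly_ring)
      moreover have "Var i \<in> q" using Var_low [of i] i l_less_j by simp
      ultimately show ?thesis using is_ideal_mult [OF q(1)] by metis
    qed
    then have "(\<Sum>\<kappa>\<in>keys (c \<alpha>). cst (lookup (c \<alpha>) \<kappa>) * xpow \<kappa>) \<in> q"
      by (intro add_subgroup_sum [OF q_subgroup])
    then show ?thesis by (simp add: mpoly_expand_keys [symmetric])
  qed
  have "pw l \<tau> \<alpha> \<in> R" for \<alpha>
    unfolding pw_def
    by (intro subring_prod [OF subring_poly_ring] subring_power [OF subring_poly_ring])
      (use assms(2) in auto)
  then show ?thesis
    unfolding c(3) using cq is_ideal_mult [OF q(1)]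
    by (intro add_subgroup_sum [OF q_subgroup]) (metis mult.commute)
qed

text \<open>By \<open>colon\<close> the prime \<open>q\<close> contains \<open>J' : J0\<close>, that is, \<open>J'\<close> and \<open>J0\<close> differ at \<open>q\<close>.\<close>

lemma reduction_agrees:
  assumes J': "is_ideal R J'" "J' \<subseteq> J0" and red: "MI R (Suc r) = MI J' r"
    and colon: "\<And>x. x \<in> R \<Longrightarrow> (\<And>h. h \<in> J0 \<Longrightarrow> x * h \<in> J') \<Longrightarrow> x \<in> q"
  shows False
proof -
  note sJ' = ideal_subgroup [OF J'(1)]
  obtain u where u: "u \<in> R" "u \<notin> q" "\<And>d. d < m \<Longrightarrow> u * theta d \<in> G" using theta_in_G by blast
  have uJ0: "u * h \<in> G" if hJ: "h \<in> J0" for h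
  proof -
    obtain f where f: "h = (\<Sum>d<m. f d * theta d)" "\<forall>d. f d \<in> R" using hJ by (auto simp: J0_def)
    have "u * h = (\<Sum>d<m. f d * (u * theta d))" by (simp add: f sum_distrib_left mult.left_commute)
    also have "\<dots> \<in> G"
    proof (rule add_subgroup_sum [OF G_subgroup])
      fix d assume "d \<in> {..<m}"
      then show "f d * (u * theta d) \<in> G" using f(2) u(3) by (simp add: is_ideal_mult [OF G_ideal])
    qed
    finally show ?thesis .
  qed
  show False
  proof (rule ideal_dichotomy [OF subring_poly_ring q prime J'(1), where l = l and f = gf])
    fix w assume w: "w \<in> R" "w \<notin> q" and wg: "\<And>i. i < l \<Longrightarrow> w * gf i \<in> J'"
    have "w * u \<in> q"
    proof (rule colon)
      show "w * u \<in> R" using w u R_mult by blast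
      fix h :: "'a mpoly" assume "h \<in> J0"
      then obtain b where b: "u * h = (\<Sum>i<l. b i * gf i)" "\<forall>i. b i \<in> R"
        using uJ0 by (fastforce simp: G_def)
      have "w * u * h = (\<Sum>i<l. b i * (w * gf i))"
        by (simp add: mult.assoc b(1) sum_distrib_left mult.left_commute)
      also have "\<dots> \<in> J'"
      proof (rule add_subgroup_sum [OF sJ'])
        fix i assume "i \<in> {..<l}"
        then have "w * gf i \<in> J'" using wg by simp
        then show "b i * (w * gf i) \<in> J'" using b(2) is_ideal_mult [OF J'(1)] by blast
      qed
      finally show "w * u * h \<in> J'" .
    qed
    then show False using prime w(1,2) u(1,2) by blast
  next
    fix \<tau> i0
    assume \<tau>: "\<And>i. i < l \<Longrightarrow> \<tau> i \<in> R" "i0 < l" "\<tau> i0 \<notin> q"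
      "\<And>b. (\<And>i. b i \<in> R) \<Longrightarrow> (\<Sum>i<l. b i * gf i) \<in> J' \<Longrightarrow> (\<Sum>i<l. \<tau> i * b i) \<in> q"
    \<comment> \<open>Integral dependence: as I^(r+1) = J' I^r, multiplication by
      \<open>gf i0\<close> acts on the monomials of \<open>Mon r\<close> through a matrix over
      \<open>J'\<close>.\<close>
    have "\<exists>f. (\<forall>b. f b \<in> J') \<and> (a \<in> Mon r \<longrightarrow> gf i0 * xpow a = (\<Sum>b\<in>Mon r. f b * xpow b))" for a
    proof (cases "a \<in> Mon r")
      case True
      have "gf i0 \<in> (I :: 'a mpoly set)" using gf_in_J0 [OF \<tau>(2)] J0_subset by blast
      then have "gf i0 * xpow a \<in> (MI I r :: 'a mpoly set)"
        using MI_I [OF ideal_subgroup [OF I_ideal]] True by blast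
      then have "gf i0 * xpow a \<in> MI J' r" using MI_I_eq red by blast
      then show ?thesis by (auto simp: MI_def)
    next
      case False
      then show ?thesis using add_subgroup_0 [OF sJ'] by (intro exI [of _ "\<lambda>_. 0"]) simp
    qed
    then obtain A where A: "\<And>a b. A a b \<in> J'"
      "\<And>a. a \<in> Mon r \<Longrightarrow> gf i0 * xpow a = (\<Sum>b\<in>Mon r. A a b * xpow b)" by metis
    have "\<exists>f. (\<forall>i. f i \<in> R) \<and> u * A a b = (\<Sum>i<l. f i * gf i)" for a b
    proof -
      have "u * A a b \<in> G" using uJ0 A(1) J'(2) by blast
      then show ?thesis by (auto simp: G_def)
    qed
    then obtain \<beta> where \<beta>: "\<And>a b i. \<beta> a b i \<in> R" "\<And>a b. u * A a b = (\<Sum>i<l. \<beta> a b i * gf i)" by metis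
    have \<beta>q: "(\<Sum>i<l. \<beta> a b i * \<tau> i) \<in> q" for a b
      using \<tau>(4) [of "\<beta> a b"] \<beta> is_ideal_mult [OF J'(1) u(1) A(1) [of a b]]
      by (simp add: mult.commute)
    \<comment> \<open>Coefficients of the matrix \<open>u\<close> times (\<open>gf i0\<close> times
      the identity minus \<open>A\<close>), written in linear forms in \<open>gf\<close>. At
      \<open>\<tau>\<close> the contribution of \<open>A\<close> lies in \<open>q\<close>, leaving
      \<open>u * \<tau> i0\<close> on the diagonal, which is outside \<open>q\<close>.\<close>
    define \<gamma> where "\<gamma> = (\<lambda>a b i. (if a = b \<and> i = i0 then u else 0) - \<beta> a b i)"
    define Y where "Y = (\<lambda>a b. \<Sum>i<l. \<gamma> a b i * gf i)"
    define Z where "Z = (\<lambda>a b. \<Sum>i<l. \<gamma> a b i * \<tau> i)"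
    have \<gamma>R: "\<gamma> a b i \<in> R" for a b i
      unfolding \<gamma>_def using u(1) \<beta>(1) add_subgroup_0 [OF R_subgroup] by (intro add_subgroup_diff [OF R_subgroup]) auto
    have \<gamma>_sum: "(\<Sum>i<l. \<gamma> a b i * h i) = (if a = b then u * h i0 else 0) - (\<Sum>i<l. \<beta> a b i * h i)"
      for a b and h :: "nat \<Rightarrow> 'a mpoly"
    proof -
      have "(\<Sum>i<l. (if a = b \<and> i = i0 then u else 0) * h i) =
          (\<Sum>i<l. if i = i0 then if a = b then u * h i0 else 0 else 0)"
        by (rule sum.cong) auto
      then show ?thesis using \<tau>(2) by (simp add: \<gamma>_def left_diff_distrib sum_subtractf)
    qed
    have "\<exists>M y z. form R l gf \<tau> M y z \<and> z \<in> R - q \<and> (\<forall>a\<in>Mon r. y * xpow a = 0)"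
    proof (rule form_elimination [OF subring_poly_ring q prime finite_Mon, where Y = Y and Z = Z])
      show "form R l gf \<tau> 1 (Y a b) (Z a b)" for a b
        unfolding Y_def Z_def by (rule form_linear [OF subring_poly_ring l_pos \<gamma>R])
      show ZR: "Z a b \<in> R" for a b
        unfolding Z_def using \<gamma>R \<tau>(1)
        by (intro add_subgroup_sum [OF R_subgroup] R_mult) auto
      show "Z a a \<notin> q" for a
      proof
        assume "Z a a \<in> q"
        then have "u * \<tau> i0 \<in> q"
          using add_subgroup_add [OF q_subgroup _ \<beta>q [of a a]] by (simp add: Z_def \<gamma>_sum)
            (metis diff_add_cancel)
        then show False using prime u(1,2) \<tau>(1-3) by blast
      qed
      show "Z a b \<in> q" if "a \<noteq> b" for a b
        using that add_subgroup_uminus [OF q_subgroup \<beta>q [of a b]] by (simp add: Z_def \<gamma>_sum)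
      show "(\<Sum>b\<in>Mon r. Y a b * xpow b) = 0" if a: "a \<in> Mon r" for a
      proof -
        have "(\<Sum>b\<in>Mon r. Y a b * xpow b) =
            (\<Sum>b\<in>Mon r. if a = b then u * gf i0 * xpow a else 0) - u * (\<Sum>b\<in>Mon r. A a b * xpow b)"
          unfolding Y_def \<gamma>_sum \<beta>(2) [symmetric]
          by (simp add: left_diff_distrib sum_subtractf sum_distrib_left mult.assoc if_distrib [of "\<lambda>x. x * _"] cong: if_cong)
        then show ?thesis using a A(2) [OF a] by (simp add: mult.assoc)
      qed
    qed
    then obtain M y z where yz: "form R l gf \<tau> M y z" "z \<notin> q" "\<And>a. a \<in> Mon r \<Longrightarrow> y * xpow a = 0"
      by blast
    \<comment> \<open>One monomial suffices to conclude \<open>y = 0\<close>, since monomials are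
      not zero divisors.\<close>
    have "msum (replicate_mset r (1, 1)) \<in> Mon r"
      using n_pos lam_1 n_le_m by (intro MonI) (auto simp: shape_def)
    then have "y * xpow (msum (replicate_mset r (1, 1))) = 0" by (rule yz(3))
    then have "lookup y t = 0" for t
      using lookup_mult_xpow [of y "msum (replicate_mset r (1, 1))" t] by simp
    then have "y = 0" by (intro poly_mapping_eqI) simp
    then show False using form_zero_in_q yz(1,2) \<tau>(1) by blast
  qed
qed

end

section \<open>Minimality of \<open>J0\<close> and the reduction number\<close>

context spec_ferrers
begin

lemma Var_diag_power: "xpow (msum (replicate_mset r (i, i))) = (Var i * Var i) ^ r"
  by (induction r) (simp_all add: xpow_add pm_def Var_xpow)

text \<open>If the ideals differ, the colon ideal \<open>a\<close> is proper and lies in a prime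
  \<open>q\<close>, which also contains \<open>J'\<close>. The position of \<open>q\<close> among
  the variables gives the data of \<open>ferrers_prime\<close>, where the contradiction
  arises.\<close>

lemma J0_minimal:
  fixes J' :: "'a::field mpoly set"
  assumes J': "is_ideal R J'" "J' \<subseteq> J0" and red: "MI R (Suc r) = MI J' r"
  shows "J' = J0"
proof (rule ccontr)
  assume ne: "J' \<noteq> J0"
  note sJ' = ideal_subgroup [OF J'(1)]
  define a where "a = {x \<in> R. \<forall>h\<in>J0. x * h \<in> J'}"
  have a: "is_ideal R a"
  proof (rule is_idealI)
    show "a \<subseteq> R" by (auto simp: a_def)
    show "add_subgroup a"
      using add_subgroup_0 [OF sJ'] add_subgroup_diff [OF sJ'] add_subgroup_0 [OF R_subgroup]
        add_subgroup_diff [OF R_subgroup]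
      by (auto simp: a_def add_subgroup_def left_diff_distrib)
    show "s * x \<in> a" if "s \<in> R" "x \<in> a" for s x
      using that is_ideal_mult [OF J'(1)] R_mult
      by (auto simp: a_def mult.assoc)
  qed
  have "1 \<notin> a" using ne J'(2) by (auto simp: a_def)
  then obtain q where q: "is_ideal R q" "a \<subseteq> q" "1 \<notin> q"
    "\<And>x y. x \<in> R \<Longrightarrow> y \<in> R \<Longrightarrow> x * y \<in> q \<Longrightarrow> x \<in> q \<or> y \<in> q"
    using exists_prime_ideal [OF subring_poly_ring a] by blast
  have J'q: "J' \<subseteq> q"
  proof
    fix x assume x: "x \<in> J'"
    have "x * h \<in> J'" if "h \<in> J0" for h
      using is_ideal_mult [OF J'(1) is_ideal_subset [OF J0_ideal that] x] by (simp add: mult.commute)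
    then have "x \<in> a" using is_ideal_subset [OF J'(1) x] by (simp add: a_def)
    then show "x \<in> q" using q(2) by blast
  qed
  \<comment> \<open>The square of \<open>Var i\<close> is a generator of \<open>I\<close>, so its
    power with exponent \<open>Suc r\<close> lies in J' I^r and hence in \<open>q\<close>.\<close>
  have low: "Var i \<in> q" if i: "1 \<le> i" "i \<le> n" for i
  proof -
    have VR: "Var i \<in> (R :: 'a mpoly set)" using i n_le_m by (intro Var_in_poly_ring) auto
    have "msum (replicate_mset (Suc r) (i, i)) \<in> Mon (Suc r)"
      using i n_le_lam [of i] by (intro MonI) (auto simp: shape_def)
    then have "(Var i * Var i) ^ Suc r \<in> MI J' r"
      using xpow_in_MI_R red unfolding Var_diag_power [symmetric] by blast
    then obtain c where c: "(Var i * Var i) ^ Suc r = (\<Sum>t\<in>Mon r. c t * xpow t)" "\<forall>t. c t \<in> J'"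
      by (auto simp: MI_def)
    have "(\<Sum>t\<in>Mon r. c t * xpow t) \<in> q"
    proof (rule add_subgroup_sum [OF ideal_subgroup [OF q(1)]])
      fix t assume "t \<in> Mon r"
      then show "c t * xpow t \<in> q"
        using is_ideal_mult [OF q(1) xpow_in_R] c(2) J'q by (metis mult.commute subsetD)
    qed
    then have "(Var i * Var i) ^ Suc r \<in> q" by (simp only: c(1))
    moreover have "Var i \<in> q" if "(Var i * Var i) ^ Suc s \<in> q" for s
      using that
    proof (induction s)
      case 0
      then show ?case using q(4) VR by auto
    next
      case (Suc s)
      have 1: "(Var i * Var i) ^ Suc s \<in> (R :: 'a mpoly set)"
        using VR by (intro subring_power [OF subring_poly_ring] R_mult)
      have 2: "Var i * Var i \<in> (R :: 'a mpoly set)" using VR R_mult by blast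
      have "(Var i * Var i) * (Var i * Var i) ^ Suc s \<in> q" using Suc.prems by simp
      then consider "Var i * Var i \<in> q" | "(Var i * Var i) ^ Suc s \<in> q" using q(4) [OF 2 1] by blast
      then show ?case using q(4) VR Suc.IH by cases blast+
    qed
    ultimately show ?thesis by blast
  qed
  \<comment> \<open>The alternative \<open>m < j\<close> supplies the value \<open>m + 1\<close>
    when \<open>q\<close> contains all variables.\<close>
  define j where "j = (LEAST j. 1 \<le> j \<and> (m < j \<or> Var j \<notin> q))"
  have j: "1 \<le> j" "m < j \<or> Var j \<notin> q"
    using LeastI [of "\<lambda>j. 1 \<le> j \<and> (m < j \<or> Var j \<notin> q)" "Suc m"] by (auto simp: j_def)
  have jlow: "Var i \<in> q" if "1 \<le> i" "i < j" for i
    using not_less_Least [of i "\<lambda>j. 1 \<le> j \<and> (m < j \<or> Var j \<notin> q)"] that by (auto simp: j_def)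
  have nj: "n < j" using low [of j] j n_le_m by force
  obtain k where k: "k \<le> n" "\<And>i. 1 \<le> i \<Longrightarrow> i \<le> n \<Longrightarrow> i \<le> k \<longleftrightarrow> j \<le> lam i"
  proof (cases "\<exists>i\<in>{1..n}. j \<le> lam i")
    case False
    then show thesis by (intro that [of 0]) auto
  next
    case True
    define S where "S = {i \<in> {1..n}. j \<le> lam i}"
    have S: "finite S" "S \<noteq> {}" using True by (auto simp: S_def)
    then have M: "Max S \<in> S" by (rule Max_in)
    show thesis
    proof (rule that [of "Max S"])
      show "Max S \<le> n" using M by (simp add: S_def)
      fix i assume i: "1 \<le> i" "i \<le> n"
      show "i \<le> Max S \<longleftrightarrow> j \<le> lam i"
      proof
        assume "i \<le> Max S"
        then have "lam (Max S) \<le> lam i" using M i lam_mono by (auto simp: S_def)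
        then show "j \<le> lam i" using M by (auto simp: S_def)
      next
        assume "j \<le> lam i"
        then show "i \<le> Max S" using S i by (intro Max_ge) (auto simp: S_def)
      qed
    qed
  qed
  have "ferrers_prime n m lam j k q"
  proof unfold_locales
    show "Var j \<notin> q" if "j \<le> m" using j(2) that by auto
  qed (fact nj k q jlow)+
  then interpret at_q: ferrers_prime n m lam j k q .
  show False
  proof (rule at_q.reduction_agrees [OF J' red])
    fix x :: "'a mpoly" assume "x \<in> R" "\<And>h. h \<in> J0 \<Longrightarrow> x * h \<in> J'"
    then have "x \<in> a" by (simp add: a_def)
    then show "x \<in> q" using q(2) by blast
  qed
qed

lemma reduction_number_eq:
  assumes inf: "infinite (UNIV :: 'a::field set)"
    and rho: "\<And>b. basic b \<Longrightarrow> card b \<le> r" "basic b0" "card b0 = r"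
  shows "reduction_number R (I :: 'a mpoly set) = r"
proof -
  have J0_red: "MI R (Suc r) = (MI J0 r :: 'a mpoly set)" by (rule J0_reduction [OF rho(1)])
  have min: "minimal_reduction R (J0 :: 'a mpoly set) I"
    unfolding minimal_reduction_def is_reduction_iff
    using J0_ideal J0_subset J0_red J0_minimal by blast
  have lower: "r \<le> reduction_number_wrt R J I" if "minimal_reduction R (J :: 'a mpoly set) I" for J
  proof -
    have J: "is_ideal R J" "\<exists>s. MI R (Suc s) = MI J s"
      using that unfolding minimal_reduction_def is_reduction_iff by auto
    have "MI R (Suc (reduction_number_wrt R J I)) = MI J (reduction_number_wrt R J I)"
      unfolding reduction_number_wrt_eq [OF J(1)] by (rule LeastI_ex [OF J(2)])
    from reduction_number_lower_bound [OF inf that rho(2) this] show ?thesis by (simp add: rho(3))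
  qed
  have "reduction_number_wrt R (J0 :: 'a mpoly set) I \<le> r"
    unfolding reduction_number_wrt_eq [OF J0_ideal] by (rule Least_le) (rule J0_red)
  then have "reduction_number_wrt R (J0 :: 'a mpoly set) I = r" using lower [OF min] by simp
  then show ?thesis
    unfolding reduction_number_def using min lower by (intro Least_equality) auto
qed

end

theorem theorem6p8:
  fixes lam :: "nat \<Rightarrow> nat" and n m :: nat
    and K :: "'a::field itself"
  assumes "infinite (UNIV :: 'a set)"
    and "n \<ge> 1"
    and "\<And>i j. 1 \<le> i \<Longrightarrow> i \<le> j \<Longrightarrow> j \<le> n \<Longrightarrow> lam j \<le> lam i"
    and "lam 1 = m"
    and "lam n \<ge> n"
  shows "reduction_number (poly_ring m :: 'a mpoly set)
           (spec_ferrers_ideal m n lam (\<lambda>i. int i - 1))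
         = Min ({n - 1} \<union> {(lam i + i) div 2 - 1 | i. 2 \<le> i \<and> i \<le> n})"
proof -
  interpret spec_ferrers n m lam by unfold_locales (fact assms)+
  define r where "r = Min ({n - 1} \<union> {(lam i + i) div 2 - 1 | i. 2 \<le> i \<and> i \<le> n})"
  have "{(lam i + i) div 2 - 1 | i. 2 \<le> i \<and> i \<le> n} = (\<lambda>i. (lam i + i) div 2 - 1) ` {2..n}" by auto
  then have fin: "finite ({n - 1} \<union> {(lam i + i) div 2 - 1 | i. 2 \<le> i \<and> i \<le> n})" by simp
  have up: "card b \<le> r" if "basic b" for b
    unfolding r_def using fin basic_card_less_n [OF that] basic_card_le [OF that] by auto
  have "r \<le> n - 1" "\<And>i. 2 \<le> i \<Longrightarrow> i \<le> n \<Longrightarrow> r \<le> (lam i + i) div 2 - 1"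
    unfolding r_def using fin by (auto intro!: Min_le)
  then obtain b where "basic b" "card b = r" using exists_basic by blast
  then show ?thesis using reduction_number_eq [OF assms(1) up] by (simp add: r_def)
qed

end
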